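(* Let $d\ge1$, $r>d/2$, $s>d/2+r$, $0\le q<s$ and $0<s-q\le2$. Let $\beta\ge r+q$, and assume that $\beta$ is sufficiently large that the Bessel kernel $\Phi_n$ satisfies, for some $L>d+1$ and some constant $C_L$ independent of $n$, $$|\Phi_n(x,y)|\le C_L\,n^{d}(1+n\rho(x,y))^{-L}\qquad\text{for all }x,y\in\mathbb S^d,\ n\ge1.$$ Assume that the sampling measures satisfy $\|\nu_m\|_{H^{-r}}\le C_1\delta_m^{r}$ for all $m$, with $C_1$ independent of $m$. Then: (i) There is a constant $C>0$, independent of $m$, $n$ and $f$, such that for all $m$, $n\ge1$ and $f\in H^s(\mathbb S^d)$, $$\|f-\mathcal F_nf\|_{H^q}\le C\left(n^{-(s-q)}+\delta_m^{r}n^{r+q}\right)\|f\|_{H^s}.$$ (ii) If $n=n(m)\ge1$ is chosen so that $c_1\delta_m^{-r/(s+r)}\le n\le c_2\delta_m^{-r/(s+r)}$ with constants $c_1,c_2>0$ independent of $m$, then, with $C'$ independent of $m$ and $f$, $$\|f-\mathcal F_nf\|_{H^q}\le C'\,\delta_m^{\frac{r(s-q)}{s+r}}\|f\|_{H^s}.$$ (iii) If, in addition, the sampling sets are quasi-uniform ($\delta_m\le C_0\gamma_m$ for all $m$, with $C_0$ independent of $m$) and $0<w_j\le C_2\delta_m^{d}$ for all $j$ and $m$ with $C_2$ independent of $j,m$, then for every $C_3>0$ there is a constant $C''>0$ independent of $m,n,f$ such that $\|\mathcal F_nf\|_{L^\infty}\le C''\|f\|_{L^\infty}$ for all $f\in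 C(\mathbb S^d)$ and all $m$ and $n\ge1$ with $n\le C_3\delta_m^{-1}$.
   Context: $\mathbb S^d=\{x\in\mathbb R^{d+1}:|x|=1\}$ carries the normalized surface measure $\sigma$ ($\sigma(\mathbb S^d)=1$) and the geodesic distance $\rho(x,y)=\arccos(x\cdot y)$. For each $\ell\ge0$, $\{Y_{\ell,k}:1\le k\le Z(d,\ell)\}$ is an $L^2(\mathbb S^d,\sigma)$-orthonormal basis of the (real) spherical harmonics of degree $\ell$; $\lambda_\ell=\ell(\ell+d-1)$ is the corresponding eigenvalue of $-\Delta_{\mathbb S^d}$. For a distribution $u$ put $\widehat u_{\ell,k}=\langle u,Y_{\ell,k}\rangle$. For $s\in\mathbb R$, $H^s(\mathbb S^d)$ is the space of distributions with $\|u\|_{H^s}^2=\sum_{\ell\ge0}(1+\lambda_\ell)^s\sum_k|\widehat u_{\ell,k}|^2<\infty$; for $s>d/2$ its elements are identified with their continuous representatives. Sampling: for each $m$ (in an infinite set of positive integers, with $m\ge2$ whenever $\gamma_m$ is used) there are a point set $\mathcal X_m=\{x_j\}_{j=1}^m\subset\mathbb S^d$ and weights $w_j>0$ with $\sum_{j=1}^mw_j=1$ (points and weights may depend on $m$). The mesh norm is $\delta_m=\sup_{x\in\mathbb S^d}\min_{j}\rho(x,x_j)$ and the separation radius is $\gamma_m=\tfrac12\min_{i\ne j}\rho(x_i,x_j)$. Set $\nu_m=\sum_{j=1}^mw_j\delta_{x_j}-\sigma$, where $\delta_{x_j}$ is the Dirac mass at $x_j$. For $n\ge1$, the Bessel kernel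 is $\Phi_n(x,y)=\sum_{\ell\ge0}(1+n^{-2}\lambda_\ell)^{-\beta/2}\sum_kY_{\ell,k}(x)Y_{\ell,k}(y)$, i.e. the kernel of $(I-n^{-2}\Delta_{\mathbb S^d})^{-\beta/2}$, and $\mathcal F_nf(x)=\sum_{j=1}^mw_jf(x_j)\Phi_n(x,x_j)$; $\mathcal F_n$ depends on $m$ as well as $n$. *)

theory Defs
  imports "HOL-Analysis.Analysis" "HOL-Probability.Essential_Supremum"
begin

text \<open>
  The sphere \<open>S^d\<close> is \<open>sphere 0 1\<close> in a Euclidean space \<open>'a\<close> with \<open>DIM('a) = d + 1\<close>. Functions
  on \<open>S^d\<close> are represented by functions on \<open>'a\<close>; only their values on \<open>sphere 0 1\<close> matter. The
  parameters \<open>d\<close>, \<open>Z\<close>, \<open>Y\<close> of the definitions below are the dimension of the sphere, the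
  multiplicities \<open>Z(d,l)\<close> and the orthonormal basis functions \<open>Y l k\<close>, \<open>1 \<le> k \<le> Z l\<close>.
\<close>

text \<open>
  Normalized surface measure, as the cone measure of polar coordinates: the measure of \<open>A\<close> is the
  proportion of the unit ball filled by the cone \<open>{x. sgn x \<in> A}\<close>, where \<open>sgn x = x / \<bar>x\<bar>\<close>. (The
  origin, where \<open>sgn\<close> leaves the sphere, is a null set.)
\<close>

definition sphere_measure :: "'a::euclidean_space measure" where
  "sphere_measure =
     restrict_space (distr (uniform_measure lborel (cball 0 1)) borel sgn) (sphere 0 1)"

definition geodist :: "'a::euclidean_space \<Rightarrow> 'a \<Rightarrow> real" where
  "geodist x y = arccos (x \<bullet> y)"

definition Linf_norm :: "('a::euclidean_space \<Rightarrow> real) \<Rightarrow> ereal" where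
  "Linf_norm f = esssup sphere_measure (\<lambda>x. ereal \<bar>f x\<bar>)"


definition laplacian :: "('a::euclidean_space \<Rightarrow> real) \<Rightarrow> 'a \<Rightarrow> real" where
  "laplacian p x = (\<Sum>b\<in>Basis. deriv (deriv (\<lambda>t. p (x + t *\<^sub>R b))) 0)"

definition spherical_harmonic :: "nat \<Rightarrow> ('a::euclidean_space \<Rightarrow> real) \<Rightarrow> bool" where
  "spherical_harmonic l g \<longleftrightarrow>
     (\<exists>p. real_polynomial_function p \<and>
          (\<forall>c x. p (c *\<^sub>R x) = c ^ l * p x) \<and>
          (\<forall>x. laplacian p x = 0) \<and>
          (\<forall>x\<in>sphere 0 1. g x = p x))"

definition harmonic_onb :: "(nat \<Rightarrow> nat) \<Rightarrow> (nat \<Rightarrow> nat \<Rightarrow> 'a::euclidean_space \<Rightarrow> real) \<Rightarrow> bool" where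
  "harmonic_onb Z Y \<longleftrightarrow>
     (\<forall>l. (\<forall>k\<in>{1..Z l}. spherical_harmonic l (Y l k)) \<and>
          (\<forall>k\<in>{1..Z l}. \<forall>k'\<in>{1..Z l}.
             (LINT x|sphere_measure. Y l k x * Y l k' x) = (if k = k' then 1 else 0)) \<and>
          (\<forall>g. spherical_harmonic l g \<longrightarrow>
             (\<exists>c. \<forall>x\<in>sphere 0 1. g x = (\<Sum>k=1..Z l. c k * Y l k x))))"

definition eigval :: "nat \<Rightarrow> nat \<Rightarrow> real" where
  "eigval d l = real l * (real l + real d - 1)"


text \<open>
  Iterated partial derivatives, in the directions listed in \<open>bs\<close>, of the extension of \<open>\<phi>\<close> that is
  constant along rays. The function \<open>\<phi>\<close> is smooth on the sphere iff this extension is smooth off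
  the origin, and the suprema over the sphere of these derivatives generate the topology of
  \<open>C^\<infinity>(S^d)\<close>.
\<close>

definition sphere_deriv :: "'a::euclidean_space list \<Rightarrow> ('a \<Rightarrow> real) \<Rightarrow> 'a \<Rightarrow> real" where
  "sphere_deriv bs \<phi> = foldr (\<lambda>b h x. frechet_derivative h (at x) b) bs (\<lambda>x. \<phi> (sgn x))"

definition sphere_smooth :: "('a::euclidean_space \<Rightarrow> real) set" where
  "sphere_smooth = {\<phi>. \<forall>bs. set bs \<subseteq> Basis \<longrightarrow> sphere_deriv bs \<phi> differentiable_on (- {0})}"

definition sphere_Ck_norm :: "nat \<Rightarrow> ('a::euclidean_space \<Rightarrow> real) \<Rightarrow> real" where
  "sphere_Ck_norm k \<phi> =
     (\<Sum>bs | set bs \<subseteq> Basis \<and> length bs \<le> k. SUP x\<in>sphere 0 1. \<bar>sphere_deriv bs \<phi> x\<bar>)"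

text \<open>
  Distributions on the sphere: continuous linear functionals on \<open>C^\<infinity>(S^d)\<close>. The values of \<open>u\<close>
  outside \<open>sphere_smooth\<close> are irrelevant; the estimate forces \<open>u \<phi>\<close> to depend only on the
  restriction of \<open>\<phi>\<close> to the sphere.
\<close>

definition sphere_distribution :: "(('a::euclidean_space \<Rightarrow> real) \<Rightarrow> real) \<Rightarrow> bool" where
  "sphere_distribution u \<longleftrightarrow>
     (\<forall>\<phi>\<in>sphere_smooth. \<forall>\<psi>\<in>sphere_smooth. \<forall>a b.
        u (\<lambda>x. a * \<phi> x + b * \<psi> x) = a * u \<phi> + b * u \<psi>) \<and>
     (\<exists>C k. \<forall>\<phi>\<in>sphere_smooth. \<bar>u \<phi>\<bar> \<le> C * sphere_Ck_norm k \<phi>)"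

definition sobolev_term ::
  "nat \<Rightarrow> (nat \<Rightarrow> nat) \<Rightarrow> (nat \<Rightarrow> nat \<Rightarrow> 'a::euclidean_space \<Rightarrow> real) \<Rightarrow> real \<Rightarrow>
    (('a \<Rightarrow> real) \<Rightarrow> real) \<Rightarrow> nat \<Rightarrow> real" where
  "sobolev_term d Z Y s u l = (1 + eigval d l) powr s * (\<Sum>k=1..Z l. (u (Y l k))\<^sup>2)"

definition sobolev ::
  "nat \<Rightarrow> (nat \<Rightarrow> nat) \<Rightarrow> (nat \<Rightarrow> nat \<Rightarrow> 'a::euclidean_space \<Rightarrow> real) \<Rightarrow> real \<Rightarrow>
    (('a \<Rightarrow> real) \<Rightarrow> real) set" where
  "sobolev d Z Y s = {u. sphere_distribution u \<and> summable (sobolev_term d Z Y s u)}"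

definition sobolev_norm ::
  "nat \<Rightarrow> (nat \<Rightarrow> nat) \<Rightarrow> (nat \<Rightarrow> nat \<Rightarrow> 'a::euclidean_space \<Rightarrow> real) \<Rightarrow> real \<Rightarrow>
    (('a \<Rightarrow> real) \<Rightarrow> real) \<Rightarrow> real" where
  "sobolev_norm d Z Y s u = sqrt (\<Sum>l. sobolev_term d Z Y s u l)"

definition regular_distribution :: "('a::euclidean_space \<Rightarrow> real) \<Rightarrow> ('a \<Rightarrow> real) \<Rightarrow> real" where
  "regular_distribution g \<phi> = (LINT x|sphere_measure. g x * \<phi> x)"

text \<open>
  Functions that are elements of \<open>H^s\<close>. Integrability is demanded because the Bochner integral of
  a non-integrable function is 0 by convention.
\<close>

definition sobolev_fun ::
  "nat \<Rightarrow> (nat \<Rightarrow> nat) \<Rightarrow> (nat \<Rightarrow> nat \<Rightarrow> 'a::euclidean_space \<Rightarrow> real) \<Rightarrow> real \<Rightarrow> ('a \<Rightarrow> real) set" where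
  "sobolev_fun d Z Y s =
     {g. integrable sphere_measure g \<and> regular_distribution g \<in> sobolev d Z Y s}"

definition sobolev_fun_norm ::
  "nat \<Rightarrow> (nat \<Rightarrow> nat) \<Rightarrow> (nat \<Rightarrow> nat \<Rightarrow> 'a::euclidean_space \<Rightarrow> real) \<Rightarrow> real \<Rightarrow>
    ('a \<Rightarrow> real) \<Rightarrow> real" where
  "sobolev_fun_norm d Z Y s g = sobolev_norm d Z Y s (regular_distribution g)"


definition mesh_norm :: "nat \<Rightarrow> (nat \<Rightarrow> 'a::euclidean_space) \<Rightarrow> real" where
  "mesh_norm m xs = (SUP x\<in>sphere 0 1. Min ((\<lambda>j. geodist x (xs j)) ` {1..m}))"

definition separation_radius :: "nat \<Rightarrow> (nat \<Rightarrow> 'a::euclidean_space) \<Rightarrow> real" where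
  "separation_radius m xs =
     Min {geodist (xs i) (xs j) | i j. i \<in> {1..m} \<and> j \<in> {1..m} \<and> i \<noteq> j} / 2"

text \<open>The sampling error measure, a signed measure, as the functional it defines on functions.\<close>

definition sampling_nu ::
  "nat \<Rightarrow> (nat \<Rightarrow> 'a::euclidean_space) \<Rightarrow> (nat \<Rightarrow> real) \<Rightarrow> ('a \<Rightarrow> real) \<Rightarrow> real" where
  "sampling_nu m xs ws \<phi> = (\<Sum>j=1..m. ws j * \<phi> (xs j)) - (LINT x|sphere_measure. \<phi> x)"

definition bessel_term ::
  "nat \<Rightarrow> (nat \<Rightarrow> nat) \<Rightarrow> (nat \<Rightarrow> nat \<Rightarrow> 'a::euclidean_space \<Rightarrow> real) \<Rightarrow> real \<Rightarrow> real \<Rightarrow>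
    'a \<Rightarrow> 'a \<Rightarrow> nat \<Rightarrow> real" where
  "bessel_term d Z Y \<beta> n x y l =
     (1 + eigval d l / n\<^sup>2) powr (- \<beta> / 2) * (\<Sum>k=1..Z l. Y l k x * Y l k y)"

definition bessel_kernel ::
  "nat \<Rightarrow> (nat \<Rightarrow> nat) \<Rightarrow> (nat \<Rightarrow> nat \<Rightarrow> 'a::euclidean_space \<Rightarrow> real) \<Rightarrow> real \<Rightarrow> real \<Rightarrow>
    'a \<Rightarrow> 'a \<Rightarrow> real" where
  "bessel_kernel d Z Y \<beta> n x y = (\<Sum>l. bessel_term d Z Y \<beta> n x y l)"

definition sampling_op ::
  "nat \<Rightarrow> (nat \<Rightarrow> nat) \<Rightarrow> (nat \<Rightarrow> nat \<Rightarrow> 'a::euclidean_space \<Rightarrow> real) \<Rightarrow> real \<Rightarrow>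
    nat \<Rightarrow> (nat \<Rightarrow> 'a) \<Rightarrow> (nat \<Rightarrow> real) \<Rightarrow> real \<Rightarrow> ('a \<Rightarrow> real) \<Rightarrow> 'a \<Rightarrow> real" where
  "sampling_op d Z Y \<beta> m xs ws n f x =
     (\<Sum>j=1..m. ws j * f (xs j) * bessel_kernel d Z Y \<beta> n x (xs j))"

end

theory Submission
  imports Defs "HOL-Probability.Probability_Measure" "HOL-Library.Function_Algebras"
begin

text \<open>
  The coefficients of \<open>f - F\<^sub>n f\<close> are \<open>(1 - b\<^sub>l) f\<^sub>l\<^sub>k - b\<^sub>l \<nu>(f Y\<^sub>l\<^sub>k)\<close> with
  \<open>b\<^sub>l = (1 + \<lambda>\<^sub>l/n\<^sup>2) powr (-\<beta>/2)\<close>. The first part gives the rate \<open>n powr (-(s - q))\<close>; the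
  second is controlled by \<open>n powr (r + q)\<close> times the \<open>H\<^sup>-\<^sup>r\<close> norm of \<open>f \<nu>\<close>, so the point is that
  multiplication by \<open>f \<in> H\<^sup>s\<close> is bounded on \<open>H\<^sup>-\<^sup>r\<close> for \<open>s > d/2 + r\<close>. A harmonic \<open>g\<close> of degree
  \<open>i\<close> multiplies \<open>L\<^sup>2\<close> with norm at most \<open>sup \<bar>g\<bar>\<close> and moves degrees by at most \<open>i\<close>, hence multiplies
  \<open>H\<^sup>-\<^sup>r\<close> with norm \<open>O((1 + i) powr r * sup \<bar>g\<bar>)\<close>; with \<open>sup \<bar>f\<^sub>i\<bar> \<le> Z(d,i) powr (1/2) * \<parallel>f\<^sub>i\<parallel>\<close> and
  \<open>Z(d,0) + \<dots> + Z(d,l) = O(l\<^sup>d)\<close> the harmonic components of \<open>f\<close> sum up. The stability in (iii) is a packing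
  argument: the number of nodes in a cap is bounded through the volumes of the cones over caps.
\<close>

section \<open>The surface measure\<close>

text \<open>The functional \<open>sampling_nu\<close> is controlled as a distribution, that is, on
  smooth functions, but it is tested on f Y_lk with f merely of class H^s. Hence f \<nu> is never
  formed as a distribution: linearity on spherical polynomials (\<open>hlin\<close>) and passage to
  dominated series (\<open>series_cont\<close>) are read off from the formula for
  \<open>sampling_nu\<close>, every norm estimate is made on finite sums of coefficients, and the
  limit is taken last. In place of the Laplace-Beltrami operator, rotation invariance of the measure
  is differentiated: the fields x_a d_b - x_b d_a integrate to zero, and orthogonality and the
  addition theorem follow from Euclidean polynomial calculus. The condition s - q <= 2 comes from 1
  - (1 + t)^(-a) = O(t^((s-q)/2)) near t = 0, the condition \<beta> >= r + q from trading b_l^2 (1 +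
  \<lambda>_l)^q for n^(2(r+q)) (1 + \<lambda>_l)^(-r). The choice of n in (ii) balances n^(-(s-q))
  against \<delta>^r n^(r+q).\<close>

lemma nn_integral_lborel_translate:
  fixes g :: "'a::euclidean_space \<Rightarrow> ennreal"
  assumes [measurable]: "g \<in> borel_measurable borel"
  shows "(\<integral>\<^sup>+x. g (c + x) \<partial>lborel) = (\<integral>\<^sup>+x. g x \<partial>lborel)"
proof -
  have "(\<integral>\<^sup>+x. g x \<partial>lborel) = (\<integral>\<^sup>+x. g x \<partial>distr lborel borel ((+) c))"
    by (simp add: lborel_distr_plus)
  also have "\<dots> = (\<integral>\<^sup>+x. g (c + x) \<partial>lborel)"
    by (subst nn_integral_distr) auto
  finally show ?thesis by simp
qed

text \<open>
  Uniqueness of Haar measure: \<open>\<integral>\<integral> b(Rx) g(y + Rx) dx dy\<close>, with \<open>b\<close> the indicator of the unit ball,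
  is evaluated by translating in \<open>y\<close> and by translating in \<open>x\<close>.
\<close>

lemma lborel_distr_orthogonal:
  fixes R :: "'a::euclidean_space \<Rightarrow> 'a"
  assumes "orthogonal_transformation R"
  shows "distr lborel borel R = lborel"
proof (rule measure_eqI)
  fix A assume "A \<in> sets (distr lborel borel R)"
  then have [measurable]: "A \<in> sets borel" by simp
  have lin: "linear R" and normR: "\<And>x. norm (R x) = norm x" and "surj R"
    using assms by (auto simp: orthogonal_transformation_linear orthogonal_transformation_norm
      orthogonal_transformation_surj)
  define R' where "R' = inv R"
  have RR': "R (R' y) = y" for y using \<open>surj R\<close> by (simp add: R'_def surj_f_inv_f)
  have [measurable]: "R \<in> borel_measurable borel"
    using lin by (intro borel_measurable_continuous_onI linear_continuous_on) (simp add: linear_conv_bounded_linear)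
  define b :: "'a \<Rightarrow> ennreal" where "b = indicator (ball 0 1)"
  have [measurable]: "b \<in> borel_measurable borel"
    unfolding b_def by (intro borel_measurable_indicator borel_open) simp
  let ?v = "emeasure lborel (ball (0::'a) 1)"
  have v0: "?v \<noteq> 0" "?v \<noteq> \<infinity>"
    using less_imp_neq[OF unit_ball_vol_pos[of "real DIM('a)"], symmetric] by (auto simp: emeasure_ball)
  have ib: "(\<integral>\<^sup>+y. b (z - y) \<partial>lborel) = ?v" for z
  proof -
    have "(\<integral>\<^sup>+y. b (z - y) \<partial>lborel) = (\<integral>\<^sup>+y. indicator (ball z 1) y \<partial>lborel)"
      by (intro nn_integral_cong) (auto simp: b_def dist_norm norm_minus_commute split: split_indicator)
    then show ?thesis by (simp add: emeasure_ball)
  qed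
  have "?v * emeasure lborel A = (\<integral>\<^sup>+x. b (R x) * emeasure lborel A \<partial>lborel)"
  proof (subst nn_integral_multc)
    have "(\<integral>\<^sup>+x. b (R x) \<partial>lborel) = (\<integral>\<^sup>+x. b x \<partial>lborel)"
      by (intro nn_integral_cong) (auto simp: b_def normR split: split_indicator)
    then show "?v * emeasure lborel A = (\<integral>\<^sup>+x. b (R x) \<partial>lborel) * emeasure lborel A"
      by (simp add: b_def)
  qed auto
  also have "\<dots> = (\<integral>\<^sup>+x. \<integral>\<^sup>+y. b (R x) * indicator A (R x + y) \<partial>lborel \<partial>lborel)"
    by (simp add: nn_integral_cmult nn_integral_lborel_translate[of "indicator A"])
  also have "\<dots> = (\<integral>\<^sup>+y. \<integral>\<^sup>+x. b (R x) * indicator A (R x + y) \<partial>lborel \<partial>lborel)"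
    by (rule lborel_pair.Fubini') measurable
  \<comment> \<open>Translating x by the preimage of y replaces R x by y + R x, which moves the
    shift from the indicator of A to the ball, where it can be integrated out.\<close>
  also have "\<dots> = (\<integral>\<^sup>+y. \<integral>\<^sup>+x. b (R x - y) * indicator A (R x) \<partial>lborel \<partial>lborel)"
  proof (rule nn_integral_cong)
    fix y
    have "(\<integral>\<^sup>+x. b (R x - y) * indicator A (R x) \<partial>lborel)
        = (\<integral>\<^sup>+x. b (R (R' y + x) - y) * indicator A (R (R' y + x)) \<partial>lborel)"
      by (rule nn_integral_lborel_translate[symmetric]) simp
    then show "(\<integral>\<^sup>+x. b (R x) * indicator A (R x + y) \<partial>lborel) = (\<integral>\<^sup>+x. b (R x - y) * indicator A (R x) \<partial>lborel)"
      by (simp add: linear_add[OF lin] RR' add.commute)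
  qed
  also have "\<dots> = (\<integral>\<^sup>+x. \<integral>\<^sup>+y. b (R x - y) * indicator A (R x) \<partial>lborel \<partial>lborel)"
    by (rule lborel_pair.Fubini') measurable
  also have "\<dots> = ?v * (\<integral>\<^sup>+x. indicator A (R x) \<partial>lborel)"
    by (simp add: nn_integral_multc ib nn_integral_cmult)
  also have "(\<integral>\<^sup>+x. indicator A (R x) \<partial>lborel) = emeasure (distr lborel borel R) A"
    by (simp flip: nn_integral_indicator add: nn_integral_distr)
  finally show "emeasure (distr lborel borel R) A = emeasure lborel A"
    using v0 by (metis ennreal_mult_cancel_left infinity_ennreal_def)
qed simp

section \<open>The cone measure on the sphere and its rotation invariance\<close>

lemma borel_measurable_sgn_euclidean [measurable]:
  "(sgn :: 'a::euclidean_space \<Rightarrow> 'a) \<in> borel_measurable borel"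
  unfolding sgn_div_norm[abs_def] by measurable

definition cap_cone :: "'a::euclidean_space set \<Rightarrow> 'a set" where
  "cap_cone A = cball 0 1 \<inter> sgn -` A"

lemma space_sphere_measure [simp]: "space sphere_measure = sphere 0 1"
  by (simp add: sphere_measure_def space_restrict_space)

lemma sets_sphere_measure [measurable_cong]:
  "sets (sphere_measure :: 'a::euclidean_space measure) = sets (restrict_space borel (sphere 0 1))"
  by (simp add: sphere_measure_def sets_restrict_space)

lemma sets_sphere_measure_subset:
  "A \<in> sets (sphere_measure :: 'a::euclidean_space measure) \<longleftrightarrow> A \<in> sets borel \<and> A \<subseteq> sphere 0 1"
  unfolding sets_sphere_measure by (subst sets_restrict_space_iff) auto

lemma cap_cone_measurable [measurable]:
  assumes [measurable]: "A \<in> sets borel" shows "cap_cone A \<in> sets borel"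
  using measurable_sets[OF borel_measurable_sgn_euclidean assms] by (auto simp: cap_cone_def)

lemma emeasure_cball_pos: "emeasure lborel (cball (0::'a::euclidean_space) 1) \<noteq> 0"
  "emeasure lborel (cball (0::'a::euclidean_space) 1) \<noteq> \<infinity>"
  using less_imp_neq[OF unit_ball_vol_pos[of "real DIM('a)"], symmetric] by (auto simp: emeasure_cball)

lemma emeasure_sphere_measure:
  fixes A :: "'a::euclidean_space set"
  assumes [measurable]: "A \<in> sets borel" and "A \<subseteq> sphere 0 1"
  shows "emeasure sphere_measure A = emeasure lborel (cap_cone A) / emeasure lborel (cball (0::'a) 1)"
proof -
  have "emeasure sphere_measure A = emeasure (distr (uniform_measure lborel (cball 0 1)) borel sgn) A"
    unfolding sphere_measure_def using assms by (subst emeasure_restrict_space) auto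
  also have "\<dots> = emeasure (uniform_measure lborel (cball 0 1)) (sgn -` A)"
    by (subst emeasure_distr) auto
  also have "\<dots> = emeasure lborel (cap_cone A) / emeasure lborel (cball (0::'a) 1)"
    using measurable_sets[OF borel_measurable_sgn_euclidean assms(1)]
    by (subst emeasure_uniform_measure) (auto simp: cap_cone_def)
  finally show ?thesis .
qed

lemma prob_space_sphere_measure: "prob_space (sphere_measure :: 'a::euclidean_space measure)"
proof
  have "AE x in lborel. x \<in> cap_cone (sphere 0 1) \<longleftrightarrow> x \<in> cball (0::'a) 1"
    using AE_lborel_singleton[of "0::'a"] by eventually_elim (auto simp: cap_cone_def norm_sgn)
  then have "emeasure lborel (cap_cone (sphere (0::'a) 1)) = emeasure lborel (cball (0::'a) 1)"
    by (intro emeasure_eq_AE) auto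
  then show "emeasure sphere_measure (space (sphere_measure :: 'a measure)) = 1"
    using emeasure_cball_pos[where 'a='a]
    by (subst emeasure_sphere_measure) (auto intro!: ennreal_divide_self simp: less_top[symmetric])
qed

interpretation sph: prob_space "sphere_measure :: 'a::euclidean_space measure"
  by (rule prob_space_sphere_measure)

text \<open>\<open>sgn\<close> commutes with a linear isometry, so the cone over a preimage is the
  preimage of the cone, and invariance of Lebesgue measure applies.\<close>

lemma sphere_measure_distr_orthogonal:
  fixes R :: "'a::euclidean_space \<Rightarrow> 'a"
  assumes R: "orthogonal_transformation R"
  shows "distr sphere_measure sphere_measure R = sphere_measure"
proof (rule measure_eqI)
  have lin: "linear R" and normR: "\<And>x. norm (R x) = norm x"
    using assms by (auto simp: orthogonal_transformation_linear orthogonal_transformation_norm)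
  have [measurable]: "R \<in> borel_measurable borel"
    using lin by (intro borel_measurable_continuous_onI linear_continuous_on) (simp add: linear_conv_bounded_linear)
  have Rm: "R \<in> sphere_measure \<rightarrow>\<^sub>M sphere_measure"
    unfolding measurable_cong_sets[OF sets_sphere_measure sets_sphere_measure]
    by (intro measurable_restrict_space3) (auto simp: normR)
  fix A assume "A \<in> sets (distr sphere_measure sphere_measure R)"
  then have A [measurable]: "A \<in> sets borel" and As: "A \<subseteq> sphere 0 1" and A': "A \<in> sets sphere_measure"
    by (auto simp: sets_sphere_measure_subset)
  have "emeasure (distr sphere_measure sphere_measure R) A = emeasure sphere_measure (R -` A)"
    using As by (subst emeasure_distr[OF Rm A']) (auto intro!: arg_cong[where f="emeasure _"] simp: normR subset_eq)
  also have "\<dots> = emeasure lborel (cap_cone (R -` A)) / emeasure lborel (cball (0::'a) 1)"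
    using As measurable_sets[of R borel borel A]
    by (intro emeasure_sphere_measure) (auto simp: subset_eq normR)
  also have "cap_cone (R -` A) = R -` (cap_cone A)"
    by (auto simp: cap_cone_def normR sgn_div_norm linear_cmul[OF lin])
  also have "emeasure lborel (R -` (cap_cone A)) = emeasure (distr lborel borel R) (cap_cone A)"
    by (subst emeasure_distr) auto
  also have "\<dots> = emeasure lborel (cap_cone A)"
    by (simp add: lborel_distr_orthogonal[OF R])
  finally show "emeasure (distr sphere_measure sphere_measure R) A = emeasure sphere_measure A"
    using A As by (simp add: emeasure_sphere_measure)
qed simp

lemma sphere_measurable_continuous [intro]:
  fixes f :: "'a::euclidean_space \<Rightarrow> real"
  shows "continuous_on (sphere 0 1) f \<Longrightarrow> f \<in> borel_measurable sphere_measure"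
  unfolding measurable_cong_sets[OF sets_sphere_measure refl]
  by (rule borel_measurable_continuous_on_restrict)

lemma sphere_integrable_continuous [intro]:
  fixes f :: "'a::euclidean_space \<Rightarrow> real"
  assumes "continuous_on (sphere 0 1) f"
  shows "integrable sphere_measure f"
proof -
  have "bounded (f ` sphere 0 1)"
    using assms by (intro compact_imp_bounded compact_continuous_image) auto
  then obtain B where "\<And>x. x \<in> sphere 0 1 \<Longrightarrow> norm (f x) \<le> B"
    unfolding bounded_iff by blast
  then show ?thesis
    using assms by (intro sph.integrable_const_bound[where B=B]) auto
qed

lemma sphere_integral_cong:
  fixes f g :: "'a::euclidean_space \<Rightarrow> real"
  assumes "\<And>x. x \<in> sphere 0 1 \<Longrightarrow> f x = g x"
  shows "(LINT x|sphere_measure. f x) = (LINT x|sphere_measure. g x)"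
  using assms by (intro Bochner_Integration.integral_cong) auto

text \<open>The cone over a relatively open set contains a Euclidean ball around half of any of its
  points. This positivity turns almost-everywhere statements about continuous functions into
  pointwise ones.\<close>

lemma sphere_measure_open_pos:
  fixes U :: "'a::euclidean_space set"
  assumes "openin (top_of_set (sphere 0 1)) U" "U \<noteq> {}"
  shows "emeasure sphere_measure U > 0"
proof -
  from assms obtain T where T: "open T" "U = sphere 0 1 \<inter> T" by (auto simp: openin_open)
  obtain x where x: "x \<in> U" using assms by auto
  then have [simp]: "norm x = 1" using T by auto
  have meas: "U \<in> sets borel" using T by (auto intro: borel_open borel_closed)
  let ?G = "{y \<in> ball 0 1 - {0}. sgn y \<in> T}"
  have "continuous_on (ball 0 1 - {0::'a}) sgn"
    by (intro continuous_intros) auto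
  then have "open ((ball 0 1 - {0}) \<inter> sgn -` T)"
    using T(1) by (intro continuous_open_preimage) (auto intro: open_delete)
  also have "(ball 0 1 - {0}) \<inter> sgn -` T = ?G" by auto
  finally have oG: "open ?G" .
  have "(1/2) *\<^sub>R x \<in> ?G"
    using x T \<open>norm x = 1\<close> by (auto simp: sgn_div_norm simp del: \<open>norm x = 1\<close>)
  then obtain e where e: "e > 0" "ball ((1/2) *\<^sub>R x) e \<subseteq> ?G"
    using oG unfolding open_contains_ball by blast
  have "0 < emeasure lborel (ball ((1/2) *\<^sub>R x) e)"
    using e by (simp add: emeasure_ball unit_ball_vol_pos)
  also have "\<dots> \<le> emeasure lborel (cap_cone U)"
    using e T cap_cone_measurable[OF meas] by (intro emeasure_mono) (auto simp: cap_cone_def norm_sgn)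
  finally show ?thesis
    using emeasure_cball_pos[where 'a='a] meas T
    by (subst emeasure_sphere_measure) (auto simp: ennreal_zero_less_divide top.not_eq_extremum)
qed

lemma sphere_AE_continuous:
  fixes f :: "'a::euclidean_space \<Rightarrow> real"
  assumes f: "continuous_on (sphere 0 1) f" and AE: "AE x in sphere_measure. f x \<le> c"
    and x: "x \<in> sphere 0 1"
  shows "f x \<le> c"
proof (rule ccontr)
  assume "\<not> f x \<le> c"
  define U where "U = sphere 0 1 \<inter> f -` {c<..}"
  have op: "openin (top_of_set (sphere 0 1)) U"
    unfolding U_def using f by (rule continuous_openin_preimage_gen) auto
  have "U \<in> sets sphere_measure"
  proof -
    have "{x \<in> space sphere_measure. f x > c} \<in> sets sphere_measure"
      using sphere_measurable_continuous[OF f] by measurable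
    also have "{x \<in> space sphere_measure. f x > c} = U" by (auto simp: U_def)
    finally show ?thesis .
  qed
  then have "emeasure sphere_measure U = 0"
    using AE by (subst (asm) AE_iff_measurable[of U]) (auto simp: U_def)
  moreover have "emeasure sphere_measure U > 0"
    using \<open>\<not> f x \<le> c\<close> x by (intro sphere_measure_open_pos op) (auto simp: U_def)
  ultimately show False by simp
qed

lemma sphere_integral_eq_0D:
  fixes f :: "'a::euclidean_space \<Rightarrow> real"
  assumes f: "continuous_on (sphere 0 1) f" and nn: "\<And>x. x \<in> sphere 0 1 \<Longrightarrow> 0 \<le> f x"
    and 0: "(LINT x|sphere_measure. f x) = 0" and x: "x \<in> sphere 0 1"
  shows "f x = 0"
proof -
  have "AE x in sphere_measure. f x = 0"
    using integral_nonneg_eq_0_iff_AE[OF sphere_integrable_continuous[OF f]] AE_I2[of sphere_measure "\<lambda>x. 0 \<le> f x"] nn 0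
    by simp
  then have "AE x in sphere_measure. f x \<le> 0" by eventually_elim simp
  from sphere_AE_continuous[OF f this x] nn[OF x] show ?thesis by simp
qed

section \<open>Polynomial calculus and the Laplacian\<close>

lemmas rpf_intros = real_polynomial_function.intros

text \<open>Directional derivative through the total derivative, so that linearity in the direction
  and the product rule come with it; \<open>laplacian_eq_lap\<close> ties it to the one-variable
  \<open>deriv\<close> in \<open>laplacian\<close>.\<close>

definition pd :: "'a::euclidean_space \<Rightarrow> ('a \<Rightarrow> real) \<Rightarrow> 'a \<Rightarrow> real" where
  "pd b p x = frechet_derivative p (at x) b"

lemma rpf_differentiable:
  fixes p :: "'a::euclidean_space \<Rightarrow> real"
  assumes "real_polynomial_function p" shows "p differentiable (at x)"
  using assms
  by (induction rule: real_polynomial_function.induct) (auto intro: bounded_linear_imp_differentiable)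

lemma rpf_continuous_on:
  fixes p :: "'a::euclidean_space \<Rightarrow> real"
  assumes "real_polynomial_function p" shows "continuous_on S p"
  using rpf_differentiable[OF assms]
  by (meson continuous_at_imp_continuous_on differentiable_imp_continuous_within)

lemma pd_has_derivative:
  fixes p :: "'a::euclidean_space \<Rightarrow> real"
  assumes "real_polynomial_function p"
  shows "(p has_derivative (\<lambda>h. \<Sum>b\<in>Basis. (h \<bullet> b) * pd b p x)) (at x)"
proof -
  have D: "(p has_derivative frechet_derivative p (at x)) (at x)"
    using rpf_differentiable[OF assms] by (simp add: frechet_derivative_works)
  then have "linear (frechet_derivative p (at x))" by (rule has_derivative_linear)
  then have "frechet_derivative p (at x) h = (\<Sum>b\<in>Basis. (h \<bullet> b) * pd b p x)" for h
    by (subst euclidean_representation[of h, symmetric], subst linear_sum)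
       (auto simp: pd_def linear_cmul)
  then have "frechet_derivative p (at x) = (\<lambda>h. \<Sum>b\<in>Basis. (h \<bullet> b) * pd b p x)" by blast
  with D show ?thesis by simp
qed

lemma pd_eqI: "(p has_derivative p') (at x) \<Longrightarrow> pd b p x = p' b"
  unfolding pd_def by (metis frechet_derivative_at)

lemma pd_linear: "bounded_linear f \<Longrightarrow> pd b f x = f b"
  by (rule pd_eqI) (rule bounded_linear_imp_has_derivative)

lemma pd_const [simp]: "pd b (\<lambda>x. c) x = 0"
  by (rule pd_eqI) auto

lemma pd_inner [simp]: "pd b (\<lambda>x. x \<bullet> a) x = b \<bullet> a"
  by (rule pd_linear) (rule bounded_linear_inner_left)

context
  fixes p q :: "'a::euclidean_space \<Rightarrow> real"
  assumes p: "real_polynomial_function p" and q: "real_polynomial_function q"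
begin

lemma pd_add: "pd b (\<lambda>x. p x + q x) x = pd b p x + pd b q x"
  using rpf_differentiable[OF p] rpf_differentiable[OF q]
  by (intro pd_eqI[THEN trans]) (auto simp: pd_def frechet_derivative_works intro!: has_derivative_add)

lemma pd_diff: "pd b (\<lambda>x. p x - q x) x = pd b p x - pd b q x"
  using rpf_differentiable[OF p] rpf_differentiable[OF q]
  by (intro pd_eqI[THEN trans]) (auto simp: pd_def frechet_derivative_works intro!: has_derivative_diff)

lemma pd_mult: "pd b (\<lambda>x. p x * q x) x = p x * pd b q x + pd b p x * q x"
  using rpf_differentiable[OF p] rpf_differentiable[OF q]
  by (intro pd_eqI[THEN trans]) (auto simp: pd_def frechet_derivative_works intro!: has_derivative_mult)

lemma pd_cmult: "pd b (\<lambda>x. c * p x) x = c * pd b p x"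
  using rpf_differentiable[OF p]
  by (intro pd_eqI[THEN trans]) (auto simp: pd_def frechet_derivative_works intro!: has_derivative_mult_right)

end

lemma pd_sum:
  fixes p :: "'i \<Rightarrow> 'a::euclidean_space \<Rightarrow> real"
  assumes "\<And>i. i \<in> I \<Longrightarrow> real_polynomial_function (p i)"
  shows "pd b (\<lambda>x. \<Sum>i\<in>I. p i x) x = (\<Sum>i\<in>I. pd b (p i) x)"
  using rpf_differentiable[OF assms]
  by (intro pd_eqI[THEN trans]) (auto simp: pd_def frechet_derivative_works intro!: has_derivative_sum)

lemma rpf_inner [intro]: "real_polynomial_function (\<lambda>x. x \<bullet> a)"
  by (rule real_polynomial_function.intros(1)) (rule bounded_linear_inner_left)

lemma rpf_norm2 [intro]: "real_polynomial_function (\<lambda>x::'a::euclidean_space. x \<bullet> x)"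
proof -
  have "real_polynomial_function (\<lambda>x::'a. \<Sum>b\<in>Basis. (x \<bullet> b) * (x \<bullet> b))"
    by (intro real_polynomial_function_sum) auto
  then show ?thesis by (simp flip: euclidean_inner)
qed

lemma rpf_pd [intro]:
  fixes p :: "'a::euclidean_space \<Rightarrow> real"
  assumes "real_polynomial_function p" shows "real_polynomial_function (pd b p)"
  using assms
proof (induction rule: real_polynomial_function.induct)
  case (linear f)
  then have "pd b f = (\<lambda>x. f b)" by (simp add: pd_linear fun_eq_iff)
  then show ?case by auto
next
  case (const c)
  then have "pd b (\<lambda>x::'a. c) = (\<lambda>x. 0)" by (simp add: fun_eq_iff)
  then show ?case by auto
next
  case (add f g)
  then have "pd b (\<lambda>x. f x + g x) = (\<lambda>x. pd b f x + pd b g x)" by (simp add: fun_eq_iff pd_add)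
  with add show ?case by auto
next
  case (mult f g)
  then have "pd b (\<lambda>x. f x * g x) = (\<lambda>x. f x * pd b g x + pd b f x * g x)" by (simp add: fun_eq_iff pd_mult)
  with mult show ?case by (simp add: rpf_intros(3,4))
qed

text \<open>Induction on the construction of the polynomial. \<open>lap_ang\<close> uses the
  symmetry to commute \<open>lap\<close> with \<open>pd\<close> and to cancel mixed
  derivatives.\<close>

lemma pd_commute:
  fixes p :: "'a::euclidean_space \<Rightarrow> real"
  assumes "real_polynomial_function p" shows "pd a (pd b p) x = pd b (pd a p) x"
  using assms
proof (induction arbitrary: x rule: real_polynomial_function.induct)
  case (linear f)
  then have "pd b f = (\<lambda>x. f b)" for b by (simp add: pd_linear fun_eq_iff)
  then show ?case by auto
next
  case (const c)
  then have "pd b (\<lambda>x::'a. c) = (\<lambda>x. 0)" for b by (simp add: fun_eq_iff)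
  then show ?case by auto
next
  case (add f g)
  then have "pd b (\<lambda>x. f x + g x) = (\<lambda>x. pd b f x + pd b g x)" for b by (simp add: fun_eq_iff pd_add)
  with add show ?case by (simp add: pd_add rpf_pd)
next
  case (mult f g)
  then have "pd b (\<lambda>x. f x * g x) = (\<lambda>x. f x * pd b g x + pd b f x * g x)" for b
    by (simp add: fun_eq_iff pd_mult)
  with mult show ?case
    by (simp add: pd_add pd_mult rpf_pd rpf_intros(4))
qed

definition lap :: "('a::euclidean_space \<Rightarrow> real) \<Rightarrow> 'a \<Rightarrow> real" where
  "lap p x = (\<Sum>b\<in>Basis. pd b (pd b p) x)"

lemma rpf_lap [intro]: "real_polynomial_function p \<Longrightarrow> real_polynomial_function (lap p)"
  unfolding lap_def[abs_def] by (intro real_polynomial_function_sum) auto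

lemma deriv_line_pd:
  fixes p :: "'a::euclidean_space \<Rightarrow> real"
  assumes p: "real_polynomial_function p" and b: "b \<in> Basis"
  shows "deriv (\<lambda>t. p (x + t *\<^sub>R b)) t = pd b p (x + t *\<^sub>R b)"
proof (rule DERIV_imp_deriv)
  have "((\<lambda>t. x + t *\<^sub>R b) has_derivative (\<lambda>h. h *\<^sub>R b)) (at t)"
    by (auto intro!: derivative_eq_intros)
  note D = has_derivative_compose[OF this pd_has_derivative[OF p]]
  show "((\<lambda>t. p (x + t *\<^sub>R b)) has_real_derivative pd b p (x + t *\<^sub>R b)) (at t)"
  proof -
    have "(\<Sum>ba\<in>Basis. (h *\<^sub>R b \<bullet> ba) * pd ba p (x + t *\<^sub>R b)) = pd b p (x + t *\<^sub>R b) * h" for h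
    proof -
      have "(\<Sum>ba\<in>Basis. (h *\<^sub>R b \<bullet> ba) * pd ba p (x + t *\<^sub>R b))
          = (\<Sum>ba\<in>Basis. if ba = b then h * pd b p (x + t *\<^sub>R b) else 0)"
        using b by (intro sum.cong) (auto simp: inner_Basis)
      then show ?thesis using b by simp
    qed
    then show ?thesis
      using D by (simp only: has_field_derivative_def)
  qed
qed

lemma laplacian_eq_lap:
  fixes p :: "'a::euclidean_space \<Rightarrow> real"
  assumes p: "real_polynomial_function p"
  shows "laplacian p x = lap p x"
proof -
  have "deriv (deriv (\<lambda>t. p (x + t *\<^sub>R b))) 0 = pd b (pd b p) x" if b: "b \<in> Basis" for b
  proof -
    have "deriv (\<lambda>t. p (x + t *\<^sub>R b)) = (\<lambda>t. pd b p (x + t *\<^sub>R b))"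
      by (simp add: fun_eq_iff deriv_line_pd[OF p b])
    then show ?thesis using deriv_line_pd[OF rpf_pd[OF p] b, of b x 0] by simp
  qed
  then show ?thesis unfolding laplacian_def lap_def by simp
qed

section \<open>Homogeneous polynomials, Euler's identity and iterated Laplacians\<close>

definition homog :: "nat \<Rightarrow> ('a::euclidean_space \<Rightarrow> real) \<Rightarrow> bool" where
  "homog l p \<longleftrightarrow> real_polynomial_function p \<and> (\<forall>c x. p (c *\<^sub>R x) = c ^ l * p x)"

lemma homog_rpf: "homog l p \<Longrightarrow> real_polynomial_function p"
  by (simp add: homog_def)

lemma homog_scale: "homog l p \<Longrightarrow> p (c *\<^sub>R x) = c ^ l * p x"
  by (simp add: homog_def)

lemma homog_zero [simp]: "homog l (\<lambda>x. 0)"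
  by (auto simp: homog_def)

lemma homog_const [simp]: "homog 0 (\<lambda>x. c)"
  by (auto simp: homog_def)

lemma homog_inner: "homog 1 (\<lambda>x. x \<bullet> a)"
  by (auto simp: homog_def)

lemma homog_norm2: "homog 2 (\<lambda>x. x \<bullet> x)"
  by (auto simp: homog_def power2_eq_square)

lemma homog_diff: "homog l p \<Longrightarrow> homog l q \<Longrightarrow> homog l (\<lambda>x. p x - q x)"
  by (auto simp: homog_def algebra_simps)

lemma homog_cmult: "homog l p \<Longrightarrow> homog l (\<lambda>x. c * p x)"
  by (auto simp: homog_def)

lemma homog_mult: "homog l p \<Longrightarrow> homog k q \<Longrightarrow> homog (l + k) (\<lambda>x. p x * q x)"
  by (auto simp: homog_def power_add)

lemma homog_sum: "finite I \<Longrightarrow> (\<And>i. i \<in> I \<Longrightarrow> homog l (p i)) \<Longrightarrow> homog l (\<lambda>x. \<Sum>i\<in>I. p i x)"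
  by (auto simp: homog_def sum_distrib_left intro!: real_polynomial_function_sum)

lemma homog_norm2_power_mult:
  "homog k q \<Longrightarrow> homog (k + 2 * j) (\<lambda>x. (x \<bullet> x) ^ j * q x)"
proof (induction j)
  case (Suc j)
  from homog_mult[OF homog_norm2 Suc.IH[OF Suc.prems]] show ?case
    by (simp add: mult.assoc)
qed simp

text \<open>Scaling by 0, with 0 ^ 0 = 1.\<close>

lemma homog_0_const:
  assumes "homog 0 p" shows "p x = p 0"
  using homog_scale[OF assms, of 0 x] by simp

lemma pd_homog_0: "homog 0 p \<Longrightarrow> pd b p x = 0"
  using homog_0_const[of p] by (metis ext pd_const)

text \<open>Euler's identity: the function c to p(cx) is differentiated at c = 1 once by the chain
  rule and once through homogeneity.\<close>

lemma pd_euler: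
  assumes "homog l p"
  shows "(\<Sum>b\<in>Basis. (x \<bullet> b) * pd b p x) = real l * p x"
proof -
  have "((\<lambda>c. c *\<^sub>R x) has_derivative (\<lambda>h. h *\<^sub>R x)) (at (1::real))"
    by (auto intro!: derivative_eq_intros)
  from has_derivative_compose[OF this pd_has_derivative[OF homog_rpf[OF assms]]]
  have "((\<lambda>c. p (c *\<^sub>R x)) has_real_derivative (\<Sum>b\<in>Basis. (x \<bullet> b) * pd b p x)) (at 1)"
    by (auto simp: has_field_derivative_def fun_eq_iff sum_distrib_left sum_distrib_right mult_ac
      elim!: has_derivative_eq_rhs intro!: sum.cong)
  moreover have "((\<lambda>c. p (c *\<^sub>R x)) has_real_derivative real l * p x) (at 1)"
    unfolding homog_scale[OF assms] by (auto intro!: derivative_eq_intros)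
  ultimately show ?thesis by (rule DERIV_unique)
qed

text \<open>Truncated subtraction is right here: in degree 0 the derivative is zero, which is
  homogeneous of every degree.\<close>

lemma homog_pd:
  assumes p: "homog l p" shows "homog (l - 1) (pd b p)"
proof (cases l)
  case 0
  then have "pd b p = (\<lambda>x. 0)" using p pd_homog_0 by blast
  then show ?thesis by simp
next
  case (Suc k)
  note rp = homog_rpf[OF p]
  have ne: "pd b p (c *\<^sub>R x) = c ^ k * pd b p x" if "c \<noteq> 0" for c x
  proof -
    have "((\<lambda>x. c *\<^sub>R x) has_derivative (\<lambda>h. c *\<^sub>R h)) (at x)"
      by (auto intro!: derivative_eq_intros)
    from has_derivative_compose[OF this, of p "frechet_derivative p (at (c *\<^sub>R x))"]
    have "((\<lambda>x. p (c *\<^sub>R x)) has_derivative (\<lambda>h. frechet_derivative p (at (c *\<^sub>R x)) (c *\<^sub>R h))) (at x)"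
      using rpf_differentiable[OF rp] by (simp add: frechet_derivative_works)
    from pd_eqI[OF this, of b] have "pd b (\<lambda>x. p (c *\<^sub>R x)) x = c * pd b p (c *\<^sub>R x)"
      using linear_frechet_derivative[OF rpf_differentiable[OF rp]] by (simp add: pd_def linear_cmul)
    moreover have "pd b (\<lambda>x. p (c *\<^sub>R x)) x = c ^ l * pd b p x"
      unfolding homog_scale[OF p] by (rule pd_cmult[OF rp rp])
    ultimately show ?thesis using that Suc by simp
  qed
  \<comment> \<open>The chain rule leaves a factor c on one side, which cancels only for nonzero c;
    continuity of both sides in c settles c = 0.\<close>
  have "pd b p (c *\<^sub>R x) = c ^ k * pd b p x" for c x
  proof -
    have c1: "isCont (\<lambda>c. pd b p (c *\<^sub>R x)) c"
    proof -
      have "continuous_on UNIV (pd b p)" using rpf_pd[OF rp] by (rule rpf_continuous_on)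
      then have "continuous_on UNIV (\<lambda>c. pd b p (c *\<^sub>R x))"
        by (rule continuous_on_compose2) (auto intro!: continuous_intros)
      then show ?thesis by (simp add: continuous_on_eq_continuous_at)
    qed
    have "(\<lambda>c. pd b p (c *\<^sub>R x)) \<midarrow>0\<rightarrow> pd b p (0 *\<^sub>R x)" if "c = 0"
      using c1 that by (simp add: isCont_def)
    moreover have "(\<lambda>c. pd b p (c *\<^sub>R x)) \<midarrow>0\<rightarrow> 0 ^ k * pd b p x"
    proof -
      have "(\<lambda>c. c ^ k * pd b p x) \<midarrow>0\<rightarrow> 0 ^ k * pd b p x" by (intro tendsto_intros)
      moreover have "eventually (\<lambda>c. c ^ k * pd b p x = pd b p (c *\<^sub>R x)) (at 0)"
        using ne by (auto simp: eventually_at_filter)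
      ultimately show ?thesis by (rule Lim_transform_eventually)
    qed
    ultimately show ?thesis
      using ne[of c x] by (cases "c = 0") (auto dest: LIM_unique)
  qed
  then show ?thesis using rpf_pd[OF rp] Suc by (auto simp: homog_def)
qed

lemma homog_lap:
  fixes p :: "'a::euclidean_space \<Rightarrow> real"
  assumes p: "homog l p" shows "homog (l - 2) (lap p)"
proof -
  have "homog (l - 1 - 1) (lap p)"
    unfolding lap_def[abs_def] using homog_pd[OF homog_pd[OF p]] by (intro homog_sum) auto
  then show ?thesis by (simp add: numeral_2_eq_2)
qed

lemma lap_homog_le_1:
  fixes p :: "'a::euclidean_space \<Rightarrow> real"
  assumes "homog l p" "l < 2" shows "lap p x = 0"
proof -
  have "homog 0 (pd b p)" for b using homog_pd[OF assms(1), of b] assms(2) by (cases l) auto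
  then show ?thesis unfolding lap_def by (simp add: pd_homog_0)
qed

lemma homog_funpow_lap:
  fixes p :: "'a::euclidean_space \<Rightarrow> real"
  assumes "homog l p" shows "homog (l - 2 * j) ((lap ^^ j) p)"
proof (induction j)
  case (Suc j)
  from homog_lap[OF this] show ?case by (simp add: diff_diff_add add.commute)
qed (use assms in simp)

lemma funpow_lap_eq_0:
  fixes p :: "'a::euclidean_space \<Rightarrow> real"
  assumes "homog l p" "l < 2 * j" shows "(lap ^^ j) p = (\<lambda>x. 0)"
proof -
  obtain i where i: "j = Suc i" using assms by (cases j) auto
  show ?thesis
    using lap_homog_le_1[OF homog_funpow_lap[OF assms(1), of i]] assms(2) i by (auto simp: fun_eq_iff)
qed

context
  fixes p q :: "'a::euclidean_space \<Rightarrow> real"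
  assumes p: "real_polynomial_function p" and q: "real_polynomial_function q"
begin

lemma lap_diff: "lap (\<lambda>x. p x - q x) x = lap p x - lap q x"
proof -
  have "pd b (\<lambda>x. p x - q x) = (\<lambda>x. pd b p x - pd b q x)" for b
    using p q by (simp add: fun_eq_iff pd_diff)
  then show ?thesis
    using p q by (simp add: lap_def pd_diff rpf_pd sum_subtractf)
qed

lemma lap_cmult: "lap (\<lambda>x. c * p x) x = c * lap p x"
proof -
  have "pd b (\<lambda>x. c * p x) = (\<lambda>x. c * pd b p x)" for b
    using p by (simp add: fun_eq_iff pd_cmult)
  then show ?thesis
    using p by (simp add: lap_def pd_cmult rpf_pd sum_distrib_left)
qed

lemma lap_mult: "lap (\<lambda>x. p x * q x) x =
    lap p x * q x + 2 * (\<Sum>b\<in>Basis. pd b p x * pd b q x) + p x * lap q x"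
proof -
  have "pd b (\<lambda>x. p x * q x) = (\<lambda>x. p x * pd b q x + pd b p x * q x)" for b
    using p q by (simp add: fun_eq_iff pd_mult)
  then have "lap (\<lambda>x. p x * q x) x = (\<Sum>b\<in>Basis. p x * pd b (pd b q) x + pd b p x * pd b q x
      + (pd b p x * pd b q x + pd b (pd b p) x * q x))"
    using p q by (simp add: lap_def pd_add pd_mult rpf_pd rpf_intros(4))
  then show ?thesis
    by (simp add: lap_def sum.distrib sum_distrib_left sum_distrib_right algebra_simps)
qed

end

lemma pd_norm2: "b \<in> Basis \<Longrightarrow> pd b (\<lambda>x. x \<bullet> x) x = 2 * (x \<bullet> b)"
proof (rule pd_eqI[THEN trans])
  show "((\<lambda>x. x \<bullet> x) has_derivative (\<lambda>h. x \<bullet> h + h \<bullet> x)) (at x)"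
    by (intro has_derivative_inner has_derivative_ident)
qed (simp add: inner_commute)

lemma lap_norm2: "lap (\<lambda>x. x \<bullet> x) (x::'a::euclidean_space) = 2 * real DIM('a)"
proof -
  have "pd b (pd b (\<lambda>x. x \<bullet> x)) x = 2" if b: "b \<in> Basis" for b :: 'a
  proof -
    have "pd b (\<lambda>x. x \<bullet> x) = (\<lambda>x. 2 * (x \<bullet> b))" using b by (simp add: fun_eq_iff pd_norm2)
    then show ?thesis using b by (simp add: pd_cmult[OF rpf_inner rpf_inner])
  qed
  then show ?thesis by (simp add: lap_def)
qed

text \<open>The product rule gives 2 DIM from the Laplacian of |x|^2 and, by Euler's identity, 4k
  from the cross term.\<close>

lemma lap_norm2_mult:
  fixes q :: "'a::euclidean_space \<Rightarrow> real"
  assumes q: "homog k q"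
  shows "lap (\<lambda>x. (x \<bullet> x) * q x) x = (2 * real DIM('a) + 4 * real k) * q x + (x \<bullet> x) * lap q x"
proof -
  have "(\<Sum>b\<in>Basis. pd b (\<lambda>x. x \<bullet> x) x * pd b q x) = 2 * (real k * q x)"
    unfolding pd_euler[OF q, symmetric] by (simp add: pd_norm2 sum_distrib_left mult.assoc)
  then show ?thesis
    unfolding lap_mult[OF rpf_norm2 homog_rpf[OF q]] lap_norm2 by (simp add: algebra_simps)
qed

lemma lap_norm2_power_mult:
  fixes q :: "'a::euclidean_space \<Rightarrow> real"
  assumes q: "homog k q" "\<And>x. lap q x = 0"
  shows "\<exists>c>0. \<forall>x. lap (\<lambda>x. (x \<bullet> x) ^ Suc j * q x) x = c * ((x \<bullet> x) ^ j * q x)"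
proof (induction j)
  case 0
  show ?case
    by (rule exI[of _ "2 * real DIM('a) + 4 * real k"]) (simp add: lap_norm2_mult[OF q(1)] q(2) add_pos_nonneg)
next
  case (Suc j)
  then obtain c where c: "c > 0" "\<And>x. lap (\<lambda>x. (x \<bullet> x) ^ Suc j * q x) x = c * ((x \<bullet> x) ^ j * q x)"
    by blast
  have "lap (\<lambda>x. (x \<bullet> x) ^ Suc (Suc j) * q x) x
      = (2 * real DIM('a) + 4 * real (k + 2 * Suc j) + c) * ((x \<bullet> x) ^ Suc j * q x)" for x
  proof -
    have "lap (\<lambda>x. (x \<bullet> x) ^ Suc (Suc j) * q x) x = lap (\<lambda>x. (x \<bullet> x) * ((x \<bullet> x) ^ Suc j * q x)) x"
      by (simp only: power_Suc mult.assoc)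
    also have "\<dots> = (2 * real DIM('a) + 4 * real (k + 2 * Suc j)) * ((x \<bullet> x) ^ Suc j * q x)
        + (x \<bullet> x) * (c * ((x \<bullet> x) ^ j * q x))"
      by (subst lap_norm2_mult[OF homog_norm2_power_mult[OF q(1)]]) (simp only: c(2))
    also have "\<dots> = (2 * real DIM('a) + 4 * real (k + 2 * Suc j) + c) * ((x \<bullet> x) ^ Suc j * q x)"
      by (simp only: power_Suc distrib_right) (simp only: mult.assoc mult.left_commute)
    finally show ?thesis .
  qed
  then show ?case
    using c(1) by (intro exI[of _ "2 * real DIM('a) + 4 * real (k + 2 * Suc j) + c"]) (auto intro!: add_pos_pos add_nonneg_pos)
qed

text \<open>Each Laplacian lowers the power of |x|^2 by one at the price of a positive factor. That
  the product of these factors is nonzero lets \<open>homog_hsum\<close> split off a harmonic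
  component of a polynomial by subtraction.\<close>

lemma funpow_lap_norm2_power:
  fixes q :: "'a::euclidean_space \<Rightarrow> real"
  assumes q: "homog k q" "\<And>x. lap q x = 0"
  shows "\<exists>c>0. (lap ^^ j) (\<lambda>x. (x \<bullet> x) ^ j * q x) = (\<lambda>x. c * q x)"
proof (induction j)
  case 0 then show ?case by (intro exI[of _ 1]) simp
next
  case (Suc j)
  then obtain c where c: "c > 0" "(lap ^^ j) (\<lambda>x. (x \<bullet> x) ^ j * q x) = (\<lambda>x. c * q x)" by blast
  obtain c' where c': "c' > 0" "\<And>x. lap (\<lambda>x. (x \<bullet> x) ^ Suc j * q x) x = c' * ((x \<bullet> x) ^ j * q x)"
    using lap_norm2_power_mult[OF q, of j] by blast
  have rp: "real_polynomial_function ((lap ^^ i) (\<lambda>x. (x \<bullet> x) ^ j * q x))" for i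
    using homog_funpow_lap[OF homog_norm2_power_mult[OF q(1)]] by (rule homog_rpf)
  have scale: "(lap ^^ i) (\<lambda>x. c' * ((x \<bullet> x) ^ j * q x)) = (\<lambda>x. c' * (lap ^^ i) (\<lambda>x. (x \<bullet> x) ^ j * q x) x)" for i
  proof (induction i)
    case (Suc i)
    have "(lap ^^ Suc i) (\<lambda>x. c' * ((x \<bullet> x) ^ j * q x)) =
        lap (\<lambda>x. c' * (lap ^^ i) (\<lambda>x. (x \<bullet> x) ^ j * q x) x)"
      by (simp add: Suc)
    also have "\<dots> = (\<lambda>x. c' * (lap ^^ Suc i) (\<lambda>x. (x \<bullet> x) ^ j * q x) x)"
      using lap_cmult[OF rp rp] by auto
    finally show ?case .
  qed simp
  have "(lap ^^ Suc j) (\<lambda>x. (x \<bullet> x) ^ Suc j * q x) = (\<lambda>x. (c' * c) * q x)"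
  proof -
    have "lap (\<lambda>x. (x \<bullet> x) ^ Suc j * q x) = (\<lambda>x. c' * ((x \<bullet> x) ^ j * q x))"
      using c'(2) by blast
    then show ?thesis
      unfolding funpow_Suc_right comp_def using c(2) scale[of j] by (simp add: mult.assoc)
  qed
  then show ?case using c c' by (intro exI[of _ "c' * c"]) simp
qed

section \<open>Green's formula on the sphere\<close>

text \<open>Rotation by the angle t in the plane of a and b, written as the identity plus a
  correction so that the orthogonal complement of the plane needs no separate treatment.\<close>

definition plane_rot :: "'a::euclidean_space \<Rightarrow> 'a \<Rightarrow> real \<Rightarrow> 'a \<Rightarrow> 'a" where
  "plane_rot a b t x = x + ((cos t - 1) * (x \<bullet> a) - sin t * (x \<bullet> b)) *\<^sub>R a
     + (sin t * (x \<bullet> a) + (cos t - 1) * (x \<bullet> b)) *\<^sub>R b"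

text \<open>The infinitesimal generator of \<open>plane_rot a b\<close>, a vector field tangential
  to every sphere around the origin.\<close>

definition ang :: "'a::euclidean_space \<Rightarrow> 'a \<Rightarrow> ('a \<Rightarrow> real) \<Rightarrow> 'a \<Rightarrow> real" where
  "ang a b g x = (x \<bullet> a) * pd b g x - (x \<bullet> b) * pd a g x"

lemma rpf_ang [intro]: "real_polynomial_function g \<Longrightarrow> real_polynomial_function (ang a b g)"
  unfolding ang_def[abs_def] by (intro real_polynomial_function_diff rpf_intros(4)) auto

lemma plane_rot_orthogonal:
  assumes "a \<in> Basis" "b \<in> Basis" "a \<noteq> b"
  shows "orthogonal_transformation (plane_rot a b t)"
  unfolding orthogonal_transformation
proof
  show "linear (plane_rot a b t)"
    by (rule linearI) (auto simp: plane_rot_def algebra_simps)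
  show "\<forall>v. norm (plane_rot a b t v) = norm v"
  proof
    fix v :: 'a
    let ?u = "v \<bullet> a" and ?w = "v \<bullet> b"
    let ?al = "(cos t - 1) * ?u - sin t * ?w" and ?be = "sin t * ?u + (cos t - 1) * ?w"
    have "plane_rot a b t v \<bullet> plane_rot a b t v = v \<bullet> v + 2 * (?al * ?u + ?be * ?w) + ?al\<^sup>2 + ?be\<^sup>2"
      using assms by (simp add: plane_rot_def inner_add_left inner_add_right inner_Basis power2_eq_square
        inner_commute algebra_simps)
    also have "\<dots> = v \<bullet> v + (?u\<^sup>2 + ?w\<^sup>2) * ((sin t)\<^sup>2 + (cos t)\<^sup>2 - 1)"
      by algebra
    finally show "norm (plane_rot a b t v) = norm v" by (simp add: norm_eq_sqrt_inner)
  qed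
qed

lemma plane_rot_0 [simp]: "plane_rot a b 0 x = x"
  by (simp add: plane_rot_def)

lemma plane_rot_derivative:
  fixes g :: "'a::euclidean_space \<Rightarrow> real"
  assumes "a \<in> Basis" "b \<in> Basis" "a \<noteq> b" and g: "real_polynomial_function g"
  shows "((\<lambda>t. g (plane_rot a b t x)) has_real_derivative ang a b g (plane_rot a b t x)) (at t)"
proof -
  let ?y = "plane_rot a b t x"
  have y: "?y \<bullet> a = cos t * (x \<bullet> a) - sin t * (x \<bullet> b)" "?y \<bullet> b = sin t * (x \<bullet> a) + cos t * (x \<bullet> b)"
    using assms by (simp_all add: plane_rot_def inner_add_left inner_Basis algebra_simps)
  have "((\<lambda>t. plane_rot a b t x) has_derivative (\<lambda>h. h *\<^sub>R ((?y \<bullet> a) *\<^sub>R b - (?y \<bullet> b) *\<^sub>R a))) (at t)"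
    unfolding plane_rot_def[abs_def] y[unfolded plane_rot_def]
    by (auto intro!: derivative_eq_intros simp: algebra_simps)
  from has_derivative_compose[OF this pd_has_derivative[OF g]]
  have D: "((\<lambda>t. g (plane_rot a b t x)) has_derivative
     (\<lambda>h. \<Sum>c\<in>Basis. (h *\<^sub>R ((?y \<bullet> a) *\<^sub>R b - (?y \<bullet> b) *\<^sub>R a) \<bullet> c) * pd c g ?y)) (at t)" .
  have "(\<Sum>c\<in>Basis. (h *\<^sub>R ((?y \<bullet> a) *\<^sub>R b - (?y \<bullet> b) *\<^sub>R a) \<bullet> c) * pd c g ?y) = ang a b g ?y * h" for h
  proof -
    have "(\<Sum>c\<in>Basis. (h *\<^sub>R ((?y \<bullet> a) *\<^sub>R b - (?y \<bullet> b) *\<^sub>R a) \<bullet> c) * pd c g ?y)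
        = (\<Sum>c\<in>Basis. (if c = b then h * (?y \<bullet> a) * pd b g ?y else 0) - (if c = a then h * (?y \<bullet> b) * pd a g ?y else 0))"
      using assms by (intro sum.cong) (auto simp: inner_diff_left inner_Basis)
    also have "\<dots> = ang a b g ?y * h"
      using assms by (simp add: sum_subtractf ang_def algebra_simps)
    finally show ?thesis .
  qed
  with D show ?thesis by (simp only: has_field_derivative_def)
qed

lemma continuous_sphere_bound:
  fixes f :: "'a::euclidean_space \<Rightarrow> real"
  assumes "continuous_on (sphere 0 1) f"
  obtains B where "B > 0" "\<And>x. x \<in> sphere 0 1 \<Longrightarrow> \<bar>f x\<bar> \<le> B"
proof -
  have "bounded (f ` sphere 0 1)"
    using assms by (intro compact_imp_bounded compact_continuous_image) auto
  then obtain B where "B > 0" "\<And>y. y \<in> f ` sphere 0 1 \<Longrightarrow> norm y \<le> B"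
    by (auto simp: bounded_pos)
  then show ?thesis using that by auto
qed

lemma rpf_integrable: "real_polynomial_function p \<Longrightarrow> integrable sphere_measure p"
  by (intro sphere_integrable_continuous rpf_continuous_on)

text \<open>By rotation invariance the integral of g after a rotation by t does not depend on t;
  differentiation at t = 0 under the integral sign gives the claim.\<close>

lemma sphere_integral_ang:
  fixes g :: "'a::euclidean_space \<Rightarrow> real"
  assumes ab: "a \<in> Basis" "b \<in> Basis" and g: "real_polynomial_function g"
  shows "(LINT x|sphere_measure. ang a b g x) = 0"
proof (cases "a = b")
  case True then show ?thesis by (simp add: ang_def)
next
  case False
  note D = plane_rot_derivative[OF ab False g]
  note O = plane_rot_orthogonal[OF ab False]
  have ns: "plane_rot a b t x \<in> sphere 0 1" if "x \<in> sphere 0 1" for t x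
    using that orthogonal_transformation_norm[OF O] by simp
  have cg: "continuous_on S g" for S using rpf_continuous_on[OF g] .
  have cR: "continuous_on S (plane_rot a b t)" for S t
    by (rule linear_continuous_on) (use O in \<open>simp add: orthogonal_transformation linear_conv_bounded_linear\<close>)
  obtain B where B: "\<And>x. x \<in> sphere 0 1 \<Longrightarrow> \<bar>ang a b g x\<bar> \<le> B"
    using continuous_sphere_bound[OF rpf_continuous_on[OF rpf_ang[OF g]]] by blast
  \<comment> \<open>Difference quotients at t = 1 / (n + 1). Each has integral zero, and they
    converge pointwise to \<open>ang a b g\<close>.\<close>
  define h where "h n x = real (Suc n) * (g (plane_rot a b (1 / real (Suc n)) x) - g x)" for n x
  have ch: "continuous_on (sphere 0 1) (h n)" for n
    unfolding h_def by (intro continuous_intros continuous_on_compose2[OF cg cR] cg) auto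
  have h0: "(LINT x|sphere_measure. h n x) = 0" for n
  proof -
    let ?R = "plane_rot a b (1 / real (Suc n))"
    have Rm: "?R \<in> sphere_measure \<rightarrow>\<^sub>M sphere_measure"
      unfolding measurable_cong_sets[OF sets_sphere_measure sets_sphere_measure]
      using ns by (intro measurable_restrict_space3 borel_measurable_continuous_onI cR) auto
    have "(LINT x|sphere_measure. g x) = (LINT x|distr sphere_measure sphere_measure ?R. g x)"
      by (simp add: sphere_measure_distr_orthogonal[OF O])
    also have "\<dots> = (LINT x|sphere_measure. g (?R x))"
      using cg by (intro integral_distr Rm) auto
    finally show ?thesis
      unfolding h_def
      by (subst integral_mult_right_zero, subst Bochner_Integration.integral_diff)
         (auto intro!: sphere_integrable_continuous continuous_on_compose2[OF cg cR] cg)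
  qed
  have "(\<lambda>n. LINT x|sphere_measure. h n x) \<longlonglongrightarrow> (LINT x|sphere_measure. ang a b g x)"
  proof (rule integral_dominated_convergence[where w="\<lambda>_. B"])
    show "ang a b g \<in> borel_measurable sphere_measure"
      using rpf_continuous_on[OF rpf_ang[OF g]] by auto
    show "h n \<in> borel_measurable sphere_measure" for n using ch by auto
    show "AE x in sphere_measure. (\<lambda>n. h n x) \<longlonglongrightarrow> ang a b g x"
    proof (rule AE_I2)
      fix x
      have "(\<lambda>t. (g (plane_rot a b (0 + t) x) - g (plane_rot a b 0 x)) / t) \<midarrow>0\<rightarrow> ang a b g (plane_rot a b 0 x)"
        using D[of x 0] by (simp add: DERIV_def)
      moreover have "(\<lambda>n. 1 / real (Suc n)) \<longlonglongrightarrow> 0" using LIMSEQ_inverse_real_of_nat by (simp add: inverse_eq_divide)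
      ultimately have "(\<lambda>n. (g (plane_rot a b (0 + 1 / real (Suc n)) x) - g (plane_rot a b 0 x)) / (1 / real (Suc n)))
          \<longlonglongrightarrow> ang a b g (plane_rot a b 0 x)"
        by (rule filterlim_compose[where g="\<lambda>t. (g (plane_rot a b (0 + t) x) - g (plane_rot a b 0 x)) / t", OF _ filterlim_atI])
          auto
      then show "(\<lambda>n. h n x) \<longlonglongrightarrow> ang a b g x" by (simp add: h_def mult.commute)
    qed
    \<comment> \<open>By the mean value theorem the quotient is a value of \<open>ang a b g\<close>
      at a rotated point, so its maximum on the sphere dominates the whole sequence.\<close>
    show "AE x in sphere_measure. norm (h n x) \<le> B" for n
    proof (rule AE_I2)
      fix x :: 'a assume "x \<in> space sphere_measure"
      then have x: "x \<in> sphere 0 1" by simp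
      obtain z where "g (plane_rot a b (1 / real (Suc n)) x) - g (plane_rot a b 0 x)
          = (1 / real (Suc n) - 0) * ang a b g (plane_rot a b z x)"
        using MVT2[of 0 "1 / real (Suc n)" "\<lambda>t. g (plane_rot a b t x)" "\<lambda>t. ang a b g (plane_rot a b t x)"] D
        by auto
      then have "h n x = ang a b g (plane_rot a b z x)" by (simp add: h_def)
      then show "norm (h n x) \<le> B" using B ns[OF x] by simp
    qed
  qed auto
  then show ?thesis using LIMSEQ_unique[OF _ tendsto_const] by (simp add: h0 LIMSEQ_const_iff)
qed

lemma norm2_eq_sum: "(\<Sum>a\<in>Basis. (x \<bullet> a)\<^sup>2) = x \<bullet> x" for x :: "'a::euclidean_space"
  by (subst euclidean_inner[of x x]) (simp add: power2_eq_square)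

text \<open>The divergence theorem on the sphere, from \<open>\<Sum>\<^sub>a (x\<^sub>a \<partial>\<^sub>b - x\<^sub>b \<partial>\<^sub>a) (x\<^sub>a G)\<close>.\<close>

lemma sphere_integral_pd:
  fixes G :: "'a::euclidean_space \<Rightarrow> real"
  assumes G: "homog k G" and b: "b \<in> Basis"
  shows "(LINT x|sphere_measure. pd b G x)
    = (real k + real DIM('a) - 1) * (LINT x|sphere_measure. (x \<bullet> b) * G x)"
proof -
  note rG = homog_rpf[OF G]
  have rp: "real_polynomial_function (\<lambda>x. (x \<bullet> a) * G x)" for a
    using rG by (intro rpf_intros(4)) auto
  have "(\<Sum>a\<in>Basis. ang a b (\<lambda>x. (x \<bullet> a) * G x) x)
      = pd b G x - (real k + real DIM('a) - 1) * ((x \<bullet> b) * G x)" if "x \<in> sphere 0 1" for x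
  proof -
    \<comment> \<open>In k + DIM - 1, Euler's identity accounts for k, differentiating each x_a in
      its own direction for DIM, and the derivative of x_b along b for -1.\<close>
    have "(\<Sum>a\<in>Basis. ang a b (\<lambda>x. (x \<bullet> a) * G x) x)
        = (\<Sum>a\<in>Basis. (x \<bullet> a) * (b \<bullet> a) * G x + (x \<bullet> a)\<^sup>2 * pd b G x - (x \<bullet> b) * G x
             - (x \<bullet> b) * ((x \<bullet> a) * pd a G x))"
      unfolding ang_def pd_mult[OF rpf_inner rG]
      by (intro sum.cong) (auto simp: inner_Basis power2_eq_square algebra_simps)
    also have "\<dots> = (\<Sum>a\<in>Basis. (x \<bullet> a) * (b \<bullet> a)) * G x + (\<Sum>a\<in>Basis. (x \<bullet> a)\<^sup>2) * pd b G x
        - real DIM('a) * ((x \<bullet> b) * G x) - (x \<bullet> b) * (\<Sum>a\<in>Basis. (x \<bullet> a) * pd a G x)"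
      by (simp add: sum.distrib sum_subtractf sum_distrib_left sum_distrib_right)
    also have "(\<Sum>a\<in>Basis. (x \<bullet> a) * (b \<bullet> a)) = x \<bullet> b" by (simp add: euclidean_inner[of x b])
    also have "(\<Sum>a\<in>Basis. (x \<bullet> a)\<^sup>2) = 1" using that by (simp add: norm2_eq_sum dot_square_norm)
    finally show ?thesis unfolding pd_euler[OF G] by (simp add: algebra_simps)
  qed
  then have "(LINT x|sphere_measure. (\<Sum>a\<in>Basis. ang a b (\<lambda>x. (x \<bullet> a) * G x) x))
      = (LINT x|sphere_measure. pd b G x - (real k + real DIM('a) - 1) * ((x \<bullet> b) * G x))"
    by (rule sphere_integral_cong)
  also have "(LINT x|sphere_measure. (\<Sum>a\<in>Basis. ang a b (\<lambda>x. (x \<bullet> a) * G x) x)) = 0"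
    by (subst Bochner_Integration.integral_sum)
       (use rp b in \<open>auto intro!: rpf_integrable sum.neutral simp: sphere_integral_ang\<close>)
  finally show ?thesis
    by (subst (asm) Bochner_Integration.integral_diff)
       (use rp rG in \<open>auto intro!: rpf_integrable\<close>)
qed

text \<open>Green's formula. The divergence identity is applied to (d_b p) q, of degree l - 1 + k;
  since p is harmonic the divergence is the product of gradients, and Euler's identity evaluates the
  normal derivative of p as l p.\<close>

lemma sphere_integral_grad:
  fixes p q :: "'a::euclidean_space \<Rightarrow> real"
  assumes p: "homog l p" "\<And>x. lap p x = 0" and q: "homog k q"
  shows "(LINT x|sphere_measure. (\<Sum>b\<in>Basis. pd b p x * pd b q x))
    = real l * (real l + real k + real DIM('a) - 2) * (LINT x|sphere_measure. p x * q x)"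
proof (cases l)
  case 0
  then show ?thesis using pd_homog_0[of p] p by simp
next
  case (Suc i)
  note rp = homog_rpf[OF p(1)] and rq = homog_rpf[OF q]
  have G: "homog (i + k) (\<lambda>x. pd b p x * q x)" for b
    using homog_mult[OF homog_pd[OF p(1)] q] Suc by simp
  have "(LINT x|sphere_measure. (\<Sum>b\<in>Basis. pd b p x * pd b q x))
      = (LINT x|sphere_measure. (\<Sum>b\<in>Basis. pd b (\<lambda>x. pd b p x * q x) x))"
  proof (rule sphere_integral_cong)
    fix x
    have "(\<Sum>b\<in>Basis. pd b (\<lambda>x. pd b p x * q x) x) = (\<Sum>b\<in>Basis. pd b p x * pd b q x) + lap p x * q x"
      using rp rq by (simp add: pd_mult rpf_pd sum.distrib sum_distrib_right lap_def)
    then show "(\<Sum>b\<in>Basis. pd b p x * pd b q x) = (\<Sum>b\<in>Basis. pd b (\<lambda>x. pd b p x * q x) x)"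
      by (simp add: p)
  qed
  also have "\<dots> = (\<Sum>b\<in>Basis. (LINT x|sphere_measure. pd b (\<lambda>x. pd b p x * q x) x))"
    using homog_rpf[OF G] by (intro Bochner_Integration.integral_sum) (auto intro!: rpf_integrable)
  also have "\<dots> = (\<Sum>b\<in>Basis. (real l + real k + real DIM('a) - 2) * (LINT x|sphere_measure. (x \<bullet> b) * (pd b p x * q x)))"
    by (intro sum.cong) (simp_all add: sphere_integral_pd[OF G] Suc)
  also have "\<dots> = (real l + real k + real DIM('a) - 2) * (LINT x|sphere_measure. (\<Sum>b\<in>Basis. (x \<bullet> b) * (pd b p x * q x)))"
    by (subst Bochner_Integration.integral_sum)
       (use rp rq in \<open>auto intro!: rpf_integrable rpf_intros(4) simp: sum_distrib_left\<close>)
  also have "(\<lambda>x. (\<Sum>b\<in>Basis. (x \<bullet> b) * (pd b p x * q x))) = (\<lambda>x. real l * (p x * q x))"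
    using pd_euler[OF p(1)] by (simp add: fun_eq_iff sum_distrib_right[symmetric] mult.assoc[symmetric])
  finally show ?thesis by simp
qed

text \<open>The pairing of gradients is symmetric, so Green's formula with p and q exchanged yields
  that (l - k)(l + k + DIM - 2) times the integral is 0.\<close>

lemma harmonic_orthogonal:
  fixes p q :: "'a::euclidean_space \<Rightarrow> real"
  assumes p: "homog l p" "\<And>x. lap p x = 0" and q: "homog k q" "\<And>x. lap q x = 0"
    and "l \<noteq> k" "DIM('a) \<ge> 2"
  shows "(LINT x|sphere_measure. p x * q x) = 0"
proof -
  let ?J = "LINT x|sphere_measure. p x * q x"
  have "real l * (real l + real k + real DIM('a) - 2) * ?J = real k * (real l + real k + real DIM('a) - 2) * ?J"
    using sphere_integral_grad[OF p q(1)] sphere_integral_grad[OF q p(1)]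
    by (simp add: mult.commute add.commute)
  moreover have "real l + real k + real DIM('a) - 2 > 0" using assms(5,6) by (cases l; cases k) auto
  ultimately show ?thesis using \<open>l \<noteq> k\<close> by simp
qed

text \<open>Integration by parts without boundary: \<open>ang a b\<close> is a derivation whose
  values integrate to zero.\<close>

lemma sphere_integral_ang_antisym:
  fixes p q :: "'a::euclidean_space \<Rightarrow> real"
  assumes ab: "a \<in> Basis" "b \<in> Basis" and p: "real_polynomial_function p" and q: "real_polynomial_function q"
  shows "(LINT x|sphere_measure. ang a b p x * q x) = - (LINT x|sphere_measure. p x * ang a b q x)"
proof -
  have "(\<lambda>x. ang a b p x * q x + p x * ang a b q x) = ang a b (\<lambda>x. p x * q x)"
    by (simp add: fun_eq_iff ang_def pd_mult[OF p q] algebra_simps)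
  with sphere_integral_ang[OF ab rpf_intros(4)[OF p q]]
  have "(LINT x|sphere_measure. ang a b p x * q x + p x * ang a b q x) = 0" by simp
  then show ?thesis
    by (subst (asm) Bochner_Integration.integral_add)
       (use p q in \<open>auto intro!: rpf_integrable rpf_intros(4)\<close>)
qed

lemma homog_ang:
  assumes "homog l p" shows "homog l (ang a b p)"
proof (cases l)
  case 0
  then have "pd c p x = 0" for c x using pd_homog_0[of p c x] assms by simp
  then have "ang a b p = (\<lambda>x. 0)" by (simp add: ang_def fun_eq_iff)
  then show ?thesis by simp
next
  case (Suc k)
  have "homog (1 + (l - 1)) (\<lambda>x. (x \<bullet> a) * pd b p x)" for a b
    using assms by (intro homog_mult homog_inner homog_pd)
  then show ?thesis unfolding ang_def[abs_def] using Suc by (intro homog_diff) auto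
qed

text \<open>Infinitesimal form of the rotation invariance of the Laplacian: the mixed second
  derivatives produced by the factors x_a and x_b cancel.\<close>

lemma lap_ang:
  fixes p :: "'a::euclidean_space \<Rightarrow> real"
  assumes ab: "a \<in> Basis" "b \<in> Basis" and p: "real_polynomial_function p" "\<And>x. lap p x = 0"
  shows "lap (ang a b p) x = 0"
proof -
  have lpd: "lap (pd b p) x = 0" for b x
  proof -
    have "lap (pd b p) x = (\<Sum>c\<in>Basis. pd b (pd c (pd c p)) x)"
    proof (unfold lap_def, intro sum.cong refl)
      fix c :: 'a
      have "pd c (pd b p) = pd b (pd c p)" using pd_commute[OF p(1)] by blast
      then show "pd c (pd c (pd b p)) x = pd b (pd c (pd c p)) x"
        using pd_commute[OF rpf_pd[OF p(1)]] by simp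
    qed
    also have "\<dots> = pd b (lap p) x"
      unfolding lap_def[abs_def] using p(1) by (intro pd_sum[symmetric]) auto
    also have "lap p = (\<lambda>x. 0)" using p(2) by blast
    finally show ?thesis by simp
  qed
  have linn: "lap (\<lambda>x. x \<bullet> a) x = 0" for a x :: 'a
  proof -
    have "pd b (\<lambda>x. x \<bullet> a) = (\<lambda>x. b \<bullet> a)" for b by (simp add: fun_eq_iff)
    then show ?thesis by (simp add: lap_def)
  qed
  have *: "lap (\<lambda>x. (x \<bullet> a) * pd b p x) x = 2 * pd a (pd b p) x" if "a \<in> Basis" for a b
  proof -
    have "(\<Sum>c\<in>Basis. pd c (\<lambda>x. x \<bullet> a) x * pd c (pd b p) x) = (\<Sum>c\<in>Basis. if c = a then pd a (pd b p) x else 0)"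
      using that by (intro sum.cong) (auto simp: inner_Basis)
    then show ?thesis
      unfolding lap_mult[OF rpf_inner rpf_pd[OF p(1)]] using that by (simp add: lpd linn)
  qed
  show ?thesis
    unfolding ang_def[abs_def]
    by (subst lap_diff) (use p(1) ab in \<open>auto intro!: rpf_intros(4) simp: * pd_commute[OF p(1)]\<close>)
qed

section \<open>Expansion in spherical harmonics\<close>

lemma spherical_harmonic_iff:
  "spherical_harmonic l g \<longleftrightarrow>
    (\<exists>p. homog l p \<and> (\<forall>x. lap p x = 0) \<and> (\<forall>x\<in>sphere 0 1. g x = p x))"
  unfolding spherical_harmonic_def homog_def by (metis laplacian_eq_lap)

locale sphere_harmonics =
  fixes d :: nat and Z :: "nat \<Rightarrow> nat" and Y :: "nat \<Rightarrow> nat \<Rightarrow> 'a::euclidean_space \<Rightarrow> real"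
  assumes d_ge_1: "d \<ge> 1" and DIM_eq: "DIM('a) = d + 1" and onb: "harmonic_onb Z Y"
begin

abbreviation I :: "('a \<Rightarrow> real) \<Rightarrow> real" where
  "I g \<equiv> (LINT x|sphere_measure. g x)"

abbreviation (input) ysph :: "nat \<times> nat \<Rightarrow> 'a \<Rightarrow> real" where
  "ysph i \<equiv> Y (fst i) (snd i)"

definition J :: "nat set \<Rightarrow> (nat \<times> nat) set" where
  "J S = (SIGMA l:S. {1..Z l})"

lemma J_iff: "i \<in> J S \<longleftrightarrow> fst i \<in> S \<and> 1 \<le> snd i \<and> snd i \<le> Z (fst i)"
  by (cases i) (auto simp: J_def)

lemma finite_J [simp]: "finite S \<Longrightarrow> finite (J S)"
  by (auto simp: J_def)

lemma sum_J: "finite S \<Longrightarrow> sum f (J S) = (\<Sum>l\<in>S. \<Sum>k=1..Z l. f (l, k))"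
  unfolding J_def by (subst sum.Sigma) auto

lemma J_mono: "S \<subseteq> T \<Longrightarrow> J S \<subseteq> J T"
  by (auto simp: J_iff)

text \<open>A solid harmonic that agrees with Y_lk on the sphere. Off the sphere the values of
  \<open>Y\<close> are arbitrary, so all differentiation is done on \<open>hp\<close>.\<close>

definition hp :: "nat \<Rightarrow> nat \<Rightarrow> 'a \<Rightarrow> real" where
  "hp l k = (SOME p. homog l p \<and> (\<forall>x. lap p x = 0) \<and> (\<forall>x\<in>sphere 0 1. Y l k x = p x))"

lemma hp:
  assumes "k \<in> {1..Z l}"
  shows "homog l (hp l k)" "lap (hp l k) x = 0" "x \<in> sphere 0 1 \<Longrightarrow> Y l k x = hp l k x"
proof -
  have "spherical_harmonic l (Y l k)" using onb assms by (auto simp: harmonic_onb_def)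
  then have "\<exists>p. homog l p \<and> (\<forall>x. lap p x = 0) \<and> (\<forall>x\<in>sphere 0 1. Y l k x = p x)"
    by (simp add: spherical_harmonic_iff)
  from someI_ex[OF this, folded hp_def]
  show "homog l (hp l k)" "lap (hp l k) x = 0" "x \<in> sphere 0 1 \<Longrightarrow> Y l k x = hp l k x" by auto
qed

lemma Y_continuous: "i \<in> J S \<Longrightarrow> continuous_on (sphere 0 1) (ysph i)"
  using hp(3)[of "snd i" "fst i"] rpf_continuous_on[OF homog_rpf[OF hp(1)[of "snd i" "fst i"]], of "sphere 0 1"]
  by (subst continuous_on_cong[OF refl, of _ _ "hp (fst i) (snd i)"]) (auto simp: J_iff)

text \<open>Within one degree this is part of \<open>harmonic_onb\<close>; between degrees it is
  Green's formula for the solid harmonics.\<close>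

lemma Y_orthonormal:
  assumes "i \<in> J S" "j \<in> J T"
  shows "I (\<lambda>x. ysph i x * ysph j x) = (if i = j then 1 else 0)"
proof (cases "fst i = fst j")
  case True
  then show ?thesis
    using onb assms unfolding harmonic_onb_def by (auto simp: J_iff prod_eq_iff)
next
  case False
  have "I (\<lambda>x. ysph i x * ysph j x) = I (\<lambda>x. hp (fst i) (snd i) x * hp (fst j) (snd j) x)"
    using assms hp(3) by (intro sphere_integral_cong) (auto simp: J_iff)
  also have "\<dots> = 0"
    using assms False DIM_eq d_ge_1 by (intro harmonic_orthogonal[OF hp(1) _ hp(1)] hp(2)) (auto simp: J_iff)
  finally show ?thesis using False by auto
qed

lemma I_mult_integrable [intro]:
  fixes f g :: "'a \<Rightarrow> real"
  shows "continuous_on (sphere 0 1) f \<Longrightarrow> continuous_on (sphere 0 1) g \<Longrightarrow> integrable sphere_measure (\<lambda>x. f x * g x)"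
  by (intro sphere_integrable_continuous continuous_intros)

lemma I_sum_mult:
  fixes g :: "'a \<Rightarrow> real"
  assumes "A \<subseteq> J S" "continuous_on (sphere 0 1) g"
  shows "I (\<lambda>x. (\<Sum>i\<in>A. c i * ysph i x) * g x) = (\<Sum>i\<in>A. c i * I (\<lambda>x. ysph i x * g x))"
proof -
  have "I (\<lambda>x. (\<Sum>i\<in>A. c i * ysph i x) * g x) = I (\<lambda>x. \<Sum>i\<in>A. c i * (ysph i x * g x))"
    by (simp add: sum_distrib_right mult.assoc)
  also have "\<dots> = (\<Sum>i\<in>A. I (\<lambda>x. c i * (ysph i x * g x)))"
    using assms by (intro Bochner_Integration.integral_sum integrable_mult_right I_mult_integrable)
      (auto intro: Y_continuous)
  finally show ?thesis by simp
qed

lemma continuous_Y_sum: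
  "A \<subseteq> J S \<Longrightarrow> continuous_on (sphere 0 1) (\<lambda>x. \<Sum>i\<in>A. c i * ysph i x)"
  by (intro continuous_intros) (auto intro: Y_continuous)

lemma I_sum_Y:
  assumes "A \<subseteq> J S" "finite A" "j \<in> J T"
  shows "I (\<lambda>x. (\<Sum>i\<in>A. c i * ysph i x) * ysph j x) = (if j \<in> A then c j else 0)"
proof -
  have "I (\<lambda>x. (\<Sum>i\<in>A. c i * ysph i x) * ysph j x) = (\<Sum>i\<in>A. c i * (if i = j then 1 else 0))"
    unfolding I_sum_mult[OF assms(1) Y_continuous[OF assms(3)]]
    using assms by (intro sum.cong refl, subst Y_orthonormal) auto
  also have "\<dots> = (if j \<in> A then c j else 0)"
    using assms(2) by (simp add: if_distrib[where f="\<lambda>t. _ * t"] sum.delta cong: if_cong)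
  finally show ?thesis .
qed

lemma I_sum_square:
  assumes "A \<subseteq> J S" "finite A"
  shows "I (\<lambda>x. (\<Sum>i\<in>A. c i * ysph i x)\<^sup>2) = (\<Sum>i\<in>A. (c i)\<^sup>2)"
proof -
  have "I (\<lambda>x. (\<Sum>i\<in>A. c i * ysph i x)\<^sup>2) = (\<Sum>i\<in>A. c i * I (\<lambda>x. ysph i x * (\<Sum>i\<in>A. c i * ysph i x)))"
    unfolding power2_eq_square by (rule I_sum_mult[OF assms(1) continuous_Y_sum[OF assms(1)]])
  also have "\<dots> = (\<Sum>i\<in>A. c i * c i)"
    using assms I_sum_Y[OF assms, of _ S c] by (intro sum.cong refl) (auto simp: mult.commute)
  finally show ?thesis by (simp add: power2_eq_square)
qed

lemma bessel_inequality:
  assumes A: "A \<subseteq> J S" "finite A" and u: "continuous_on (sphere 0 1) u"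
  shows "(\<Sum>i\<in>A. (I (\<lambda>x. u x * ysph i x))\<^sup>2) \<le> I (\<lambda>x. (u x)\<^sup>2)"
proof -
  define c where "c i = I (\<lambda>x. u x * ysph i x)" for i
  let ?s = "\<lambda>x. \<Sum>i\<in>A. c i * ysph i x"
  note cs = continuous_Y_sum[OF A(1), of c]
  have "0 \<le> I (\<lambda>x. (u x - ?s x)\<^sup>2)" by (intro Bochner_Integration.integral_nonneg) auto
  also have "(\<lambda>x. (u x - ?s x)\<^sup>2) = (\<lambda>x. (u x)\<^sup>2 - 2 * (?s x * u x) + (?s x)\<^sup>2)"
    by (simp add: fun_eq_iff power2_eq_square algebra_simps)
  also have "I \<dots> = I (\<lambda>x. (u x)\<^sup>2) - 2 * I (\<lambda>x. ?s x * u x) + I (\<lambda>x. (?s x)\<^sup>2)"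
  proof -
    have "integrable sphere_measure (\<lambda>x. (u x)\<^sup>2)" "integrable sphere_measure (\<lambda>x. 2 * (?s x * u x))"
      "integrable sphere_measure (\<lambda>x. (?s x)\<^sup>2)"
      using u cs by (auto intro!: sphere_integrable_continuous continuous_on_power continuous_on_mult continuous_on_const)
    then show ?thesis by simp
  qed
  also have "I (\<lambda>x. ?s x * u x) = (\<Sum>i\<in>A. (c i)\<^sup>2)"
    unfolding I_sum_mult[OF A(1) u] by (simp add: c_def power2_eq_square mult.commute)
  also have "I (\<lambda>x. (?s x)\<^sup>2) = (\<Sum>i\<in>A. (c i)\<^sup>2)" by (rule I_sum_square[OF A])
  finally show ?thesis by (simp add: c_def)
qed

text \<open>Spherical polynomials of degree at most n, as functions on the whole space that are
  constrained on the sphere only.\<close>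

definition hsum :: "nat \<Rightarrow> ('a \<Rightarrow> real) \<Rightarrow> bool" where
  "hsum n g \<longleftrightarrow> (\<exists>c. \<forall>x\<in>sphere 0 1. g x = (\<Sum>i\<in>J {..n}. c i * ysph i x))"

lemma hsumI: "(\<And>x. x \<in> sphere 0 1 \<Longrightarrow> g x = (\<Sum>i\<in>J {..n}. c i * ysph i x)) \<Longrightarrow> hsum n g"
  unfolding hsum_def by (intro exI[of _ c]) auto

lemma hsum_cong: "hsum n f \<Longrightarrow> (\<And>x. x \<in> sphere 0 1 \<Longrightarrow> g x = f x) \<Longrightarrow> hsum n g"
  unfolding hsum_def by auto

lemma hsum_mono:
  assumes "hsum m g" "m \<le> n" shows "hsum n g"
proof -
  obtain c where c: "\<And>x. x \<in> sphere 0 1 \<Longrightarrow> g x = (\<Sum>i\<in>J {..m}. c i * ysph i x)"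
    using assms(1) by (auto simp: hsum_def)
  have "g x = (\<Sum>i\<in>J {..n}. (if i \<in> J {..m} then c i else 0) * ysph i x)" if "x \<in> sphere 0 1" for x
    unfolding c[OF that] using assms(2) J_mono[of "{..m}" "{..n}"]
    by (intro sum.mono_neutral_cong_left) auto
  then show ?thesis by (rule hsumI)
qed

lemma hsum_add:
  assumes "hsum n f" "hsum n g" shows "hsum n (\<lambda>x. f x + g x)"
proof -
  obtain a b where "\<And>x. x \<in> sphere 0 1 \<Longrightarrow> f x = (\<Sum>i\<in>J {..n}. a i * ysph i x)"
    "\<And>x. x \<in> sphere 0 1 \<Longrightarrow> g x = (\<Sum>i\<in>J {..n}. b i * ysph i x)"
    using assms by (auto simp: hsum_def)
  then have "f x + g x = (\<Sum>i\<in>J {..n}. (a i + b i) * ysph i x)" if "x \<in> sphere 0 1" for x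
    using that
    by (simp add: sum.distrib distrib_right)
  then show ?thesis by (rule hsumI)
qed

lemma hsum_cmult:
  assumes "hsum n f" shows "hsum n (\<lambda>x. c * f x)"
proof -
  obtain a where "\<And>x. x \<in> sphere 0 1 \<Longrightarrow> f x = (\<Sum>i\<in>J {..n}. a i * ysph i x)"
    using assms by (auto simp: hsum_def)
  then have "c * f x = (\<Sum>i\<in>J {..n}. (c * a i) * ysph i x)" if "x \<in> sphere 0 1" for x
    using that
    by (simp add: sum_distrib_left mult.assoc)
  then show ?thesis by (rule hsumI)
qed

lemma hsum_zero: "hsum n (\<lambda>x. 0)"
  by (rule hsumI[where c="\<lambda>_. 0"]) simp

lemma hsum_sum: "finite A \<Longrightarrow> (\<And>i. i \<in> A \<Longrightarrow> hsum n (f i)) \<Longrightarrow> hsum n (\<lambda>x. \<Sum>i\<in>A. f i x)"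
  by (induction rule: finite_induct) (auto intro: hsum_zero hsum_add)

lemma spherical_harmonic_hsum:
  assumes "spherical_harmonic l g" shows "hsum l g"
proof -
  obtain c where c: "\<And>x. x \<in> sphere 0 1 \<Longrightarrow> g x = (\<Sum>k=1..Z l. c k * Y l k x)"
    using onb assms unfolding harmonic_onb_def by blast
  have "g x = (\<Sum>i\<in>J {..l}. (if fst i = l then c (snd i) else 0) * ysph i x)" if "x \<in> sphere 0 1" for x
  proof -
    have "(\<Sum>i\<in>J {..l}. (if fst i = l then c (snd i) else 0) * ysph i x)
        = (\<Sum>i\<in>J {l}. c (snd i) * ysph i x)"
      by (intro sum.mono_neutral_cong_right) (auto simp: J_iff)
    then show ?thesis by (simp add: c[OF that] sum_J)
  qed
  then show ?thesis by (rule hsumI)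
qed

text \<open>Decomposition of a homogeneous polynomial into harmonics, by induction on a number of
  Laplacians that annihilates it. The base case is the zero polynomial, and l + 1 Laplacians
  annihilate any polynomial of degree l.\<close>

lemma homog_hsum:
  assumes "homog l p" shows "hsum l p"
proof -
  have "hsum l p" if "homog l p" "(lap ^^ j) p = (\<lambda>x. 0)" for j p
    using that
  proof (induction j arbitrary: p)
    case 0
    then show ?case using hsum_zero by simp
  next
    case (Suc j)
    define h where "h = (lap ^^ j) p"
    have h: "homog (l - 2 * j) h" "\<And>x. lap h x = 0"
      using homog_funpow_lap[OF Suc.prems(1)] Suc.prems(2) by (auto simp: h_def fun_eq_iff)
    show ?case
    proof (cases "2 * j \<le> l")
      case False
      then show ?thesis using Suc.IH[OF Suc.prems(1)] funpow_lap_eq_0[OF Suc.prems(1)] by simp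
    next
      case True
      obtain c where c: "c > 0" "(lap ^^ j) (\<lambda>x. (x \<bullet> x) ^ j * h x) = (\<lambda>x. c * h x)"
        using funpow_lap_norm2_power[OF h] by blast
      let ?r = "\<lambda>x. (x \<bullet> x) ^ j * h x"
      \<comment> \<open>j Laplacians send both p and |x|^(2j) h / c to h, so they annihilate the
        difference. On the sphere |x|^(2j) = 1, so the part subtracted restricts to a harmonic of
        lower or equal degree.\<close>
      define p' where "p' = (\<lambda>x. p x - inverse c * ?r x)"
      have hr: "homog l ?r" using homog_norm2_power_mult[OF h(1), of j] True by simp
      have hp': "homog l p'" unfolding p'_def by (intro homog_diff homog_cmult hr Suc.prems)
      have "(lap ^^ i) p' = (\<lambda>x. (lap ^^ i) p x - inverse c * (lap ^^ i) ?r x)" for i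
      proof (induction i)
        case (Suc i)
        note r1 = homog_rpf[OF homog_funpow_lap[OF \<open>homog l p\<close>, of i]]
        note r2 = homog_rpf[OF homog_funpow_lap[OF hr, of i]]
        have "real_polynomial_function (\<lambda>x. inverse c * (lap ^^ i) ?r x)"
          using r2 by (intro rpf_intros(4) rpf_intros(2))
        then show ?case
          by (simp add: Suc fun_eq_iff lap_diff[OF r1] lap_cmult[OF r2 r2])
      qed (simp add: p'_def)
      from this[of j] have "(lap ^^ j) p' = (\<lambda>x. 0)"
        using c by (simp add: h_def[symmetric] field_simps)
      then have "hsum l p'" by (rule Suc.IH[OF hp'])
      moreover have "hsum l h"
        using h by (intro hsum_mono[OF spherical_harmonic_hsum, of "l - 2 * j"]) (auto simp: spherical_harmonic_iff)
      then have "hsum l (\<lambda>x. inverse c * h x)" by (rule hsum_cmult)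
      ultimately have "hsum l (\<lambda>x. p' x + inverse c * h x)" by (rule hsum_add)
      then show ?thesis by (rule hsum_cong) (simp add: p'_def dot_square_norm)
    qed
  qed
  from this[OF assms funpow_lap_eq_0[OF assms, of "Suc l"]] show ?thesis by simp
qed

text \<open>A product of solid harmonics is homogeneous, so \<open>homog_hsum\<close> expands it.
  This is what limits the shift of degrees under multiplication by a harmonic.\<close>

lemma hsum_mult:
  assumes "hsum m f" "hsum n g" shows "hsum (m + n) (\<lambda>x. f x * g x)"
proof -
  obtain a b where ab: "\<And>x. x \<in> sphere 0 1 \<Longrightarrow> f x = (\<Sum>i\<in>J {..m}. a i * ysph i x)"
    "\<And>x. x \<in> sphere 0 1 \<Longrightarrow> g x = (\<Sum>i\<in>J {..n}. b i * ysph i x)"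
    using assms by (auto simp: hsum_def)
  have "hsum (m + n) (\<lambda>x. \<Sum>i\<in>J {..m}. \<Sum>j\<in>J {..n}. (a i * b j) * (ysph i x * ysph j x))"
  proof (intro hsum_sum hsum_cmult finite_J finite_atMost)
    fix i j assume ij: "i \<in> J {..m}" "j \<in> J {..n}"
    have "homog (fst i + fst j) (\<lambda>x. hp (fst i) (snd i) x * hp (fst j) (snd j) x)"
      using ij by (intro homog_mult hp) (auto simp: J_iff)
    from hsum_mono[OF homog_hsum[OF this], of "m + n"]
    show "hsum (m + n) (\<lambda>x. ysph i x * ysph j x)"
      using ij hp(3) by (rule_tac hsum_cong) (auto simp: J_iff)
  qed
  then show ?thesis
    by (rule hsum_cong) (simp add: ab sum_product mult_ac)
qed

lemma rpf_hsum:
  assumes "real_polynomial_function p" shows "\<exists>n. hsum n p"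
  using assms
proof (induction rule: real_polynomial_function.induct)
  case (linear f)
  then have "homog 1 f"
    by (auto simp: homog_def rpf_intros(1) linear_cmul bounded_linear.linear)
  then show ?case using homog_hsum by blast
next
  case (const c)
  show ?case using homog_hsum[OF homog_const] by blast
next
  case (add f g)
  then obtain m n where "hsum m f" "hsum n g" by auto
  then have "hsum (max m n) f" "hsum (max m n) g" by (auto elim: hsum_mono)
  then show ?case using hsum_add by blast
next
  case (mult f g)
  then show ?case using hsum_mult by blast
qed

lemma hsum_continuous: "hsum n g \<Longrightarrow> continuous_on (sphere 0 1) g"
proof -
  assume "hsum n g"
  then obtain c where "\<And>x. x \<in> sphere 0 1 \<Longrightarrow> g x = (\<Sum>i\<in>J {..n}. c i * ysph i x)"
    by (auto simp: hsum_def)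
  then show ?thesis
    using continuous_Y_sum[OF order_refl, of c "{..n}"] by (subst continuous_on_cong[OF refl]) auto
qed

lemma hsum_coeff:
  assumes "hsum n g"
  shows "x \<in> sphere 0 1 \<Longrightarrow> g x = (\<Sum>i\<in>J {..n}. I (\<lambda>x. g x * ysph i x) * ysph i x)"
    and "j \<in> J UNIV \<Longrightarrow> fst j > n \<Longrightarrow> I (\<lambda>x. g x * ysph j x) = 0"
proof -
  obtain c where c: "\<And>x. x \<in> sphere 0 1 \<Longrightarrow> g x = (\<Sum>i\<in>J {..n}. c i * ysph i x)"
    using assms(1) by (auto simp: hsum_def)
  have I: "I (\<lambda>x. g x * ysph i x) = (if i \<in> J {..n} then c i else 0)" if "i \<in> J UNIV" for i
  proof -
    have "I (\<lambda>x. g x * ysph i x) = I (\<lambda>x. (\<Sum>i\<in>J {..n}. c i * ysph i x) * ysph i x)"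
      by (rule sphere_integral_cong) (simp add: c)
    then show ?thesis using I_sum_Y[OF order_refl _ that, of "{..n}" c] by simp
  qed
  show "g x = (\<Sum>i\<in>J {..n}. I (\<lambda>x. g x * ysph i x) * ysph i x)" if "x \<in> sphere 0 1"
    unfolding c[OF that]
  proof (intro sum.cong refl)
    fix i assume "i \<in> J {..n}"
    then show "c i * ysph i x = I (\<lambda>x. g x * ysph i x) * ysph i x"
      using I[of i] J_mono[of "{..n}" UNIV] by auto
  qed
  show "I (\<lambda>x. g x * ysph j x) = 0" if "j \<in> J UNIV" "fst j > n"
    using I[of j] that by (auto simp: J_iff)
qed

text \<open>By Stone-Weierstrass h is uniformly close to a polynomial p. As h is orthogonal to p,
  the integral of h^2 equals that of h (h - p), which is arbitrarily small.\<close>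

lemma harmonics_complete:
  fixes h :: "'a \<Rightarrow> real"
  assumes h: "continuous_on (sphere 0 1) h" and 0: "\<And>i. i \<in> J UNIV \<Longrightarrow> I (\<lambda>x. h x * ysph i x) = 0"
    and x: "x \<in> sphere 0 1"
  shows "h x = 0"
proof -
  have pol: "I (\<lambda>x. h x * p x) = 0" if rp: "real_polynomial_function p" for p
  proof -
    obtain n c where c: "\<And>x. x \<in> sphere 0 1 \<Longrightarrow> p x = (\<Sum>i\<in>J {..n}. c i * ysph i x)"
      using rpf_hsum[OF rp] by (auto simp: hsum_def)
    have "I (\<lambda>x. h x * p x) = I (\<lambda>x. (\<Sum>i\<in>J {..n}. c i * ysph i x) * h x)"
      by (rule sphere_integral_cong) (simp add: c)
    also have "\<dots> = 0"
      unfolding I_sum_mult[OF order_refl h] using 0 J_mono[of "{..n}" UNIV]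
      by (intro sum.neutral) (auto simp: mult.commute)
    finally show ?thesis .
  qed
  obtain B where B: "B > 0" "\<And>x. x \<in> sphere 0 1 \<Longrightarrow> \<bar>h x\<bar> \<le> B"
    using continuous_sphere_bound[OF h] by blast
  have "I (\<lambda>x. (h x)\<^sup>2) \<le> e" if "e > 0" for e
  proof -
    have "e / B > 0" using that B by simp
    from Stone_Weierstrass_real_polynomial_function[OF compact_sphere h this]
    obtain p where p: "real_polynomial_function p" "\<And>x. x \<in> sphere 0 1 \<Longrightarrow> \<bar>h x - p x\<bar> < e / B"
      by blast
    note cp = rpf_continuous_on[OF p(1), of "sphere 0 1"]
    have "I (\<lambda>x. (h x)\<^sup>2) = I (\<lambda>x. h x * (h x - p x) + h x * p x)"
      by (rule sphere_integral_cong) (simp add: power2_eq_square algebra_simps)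
    also have "\<dots> = I (\<lambda>x. h x * (h x - p x))"
      using h cp by (subst Bochner_Integration.integral_add) (auto intro!: I_mult_integrable continuous_intros simp: pol[OF p(1)])
    also have "\<dots> \<le> I (\<lambda>x. e)"
    proof (rule integral_mono)
      fix x assume "x \<in> space (sphere_measure :: 'a measure)"
      then have "x \<in> sphere 0 1" by simp
      then have "\<bar>h x\<bar> * \<bar>h x - p x\<bar> \<le> B * (e / B)"
        using B p(2) by (intro mult_mono) (auto simp: less_imp_le)
      then show "h x * (h x - p x) \<le> e" using B by (simp flip: abs_mult)
    qed (use h cp in \<open>auto intro!: I_mult_integrable continuous_intros\<close>)
    also have "\<dots> = e" by (simp add: sph.prob_space[unfolded space_sphere_measure])
    finally show ?thesis .
  qed
  then have "I (\<lambda>x. (h x)\<^sup>2) \<le> 0" by (rule field_le_epsilon[of _ 0, simplified])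
  moreover have "I (\<lambda>x. (h x)\<^sup>2) \<ge> 0" by (intro Bochner_Integration.integral_nonneg) auto
  ultimately have "(h x)\<^sup>2 = 0"
    using h x by (intro sphere_integral_eq_0D[of "\<lambda>x. (h x)\<^sup>2"]) (auto intro!: continuous_intros)
  then show ?thesis by simp
qed

end

section \<open>Addition theorem and dimension count\<close>

context sphere_harmonics begin

text \<open>
  The operators \<open>x\<^sub>a \<partial>\<^sub>b - x\<^sub>b \<partial>\<^sub>a\<close> act antisymmetrically on the harmonics of degree \<open>l\<close>, so they kill
  \<open>\<Sum>\<^sub>k Y\<^sub>l\<^sub>k\<^sup>2\<close>.
\<close>

lemma ang_sum_hp_squares:
  assumes ab: "a \<in> Basis" "b \<in> Basis" and x: "x \<in> sphere 0 1"
  shows "ang a b (\<lambda>x. \<Sum>k=1..Z l. hp l k x * hp l k x) x = 0"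
proof -
  let ?K = "{1..Z l}"
  have rp: "real_polynomial_function (hp l k)" if "k \<in> ?K" for k
    using hp(1)[OF that] by (rule homog_rpf)
  define \<alpha> where "\<alpha> k i = I (\<lambda>x. ang a b (hp l k) x * hp l i x)" for k i
  have anti: "\<alpha> k i = - \<alpha> i k" if "k \<in> ?K" "i \<in> ?K" for k i
    using sphere_integral_ang_antisym[OF ab rp[OF that(1)] rp[OF that(2)]]
    by (simp add: \<alpha>_def mult.commute)
  have expand: "ang a b (hp l k) x = (\<Sum>i\<in>?K. \<alpha> k i * hp l i x)" if k: "k \<in> ?K" for k
  proof -
    have "spherical_harmonic l (ang a b (hp l k))"
      using homog_ang[OF hp(1)[OF k]] lap_ang[OF ab rp[OF k] hp(2)[OF k]]
      by (auto simp: spherical_harmonic_iff)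
    then obtain c where c: "\<And>x. x \<in> sphere 0 1 \<Longrightarrow> ang a b (hp l k) x = (\<Sum>i\<in>?K. c i * Y l i x)"
      using onb unfolding harmonic_onb_def by blast
    have "\<alpha> k i = c i" if i: "i \<in> ?K" for i
    proof -
      have "\<alpha> k i = I (\<lambda>x. (\<Sum>j\<in>J {l}. c (snd j) * ysph j x) * Y l i x)"
        unfolding \<alpha>_def using hp(3)[OF i] by (intro sphere_integral_cong) (simp add: c sum_J)
      also have "\<dots> = c i"
        using I_sum_Y[OF order_refl, of "{l}" "(l, i)" "{l}" "\<lambda>j. c (snd j)"] i by (simp add: J_iff)
      finally show ?thesis .
    qed
    then show ?thesis using x hp(3) by (simp add: c)
  qed
  \<comment> \<open>An antisymmetric matrix contracted with a symmetric one: exchanging the indices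
    shows that the double sum is its own negative.\<close>
  let ?S = "\<Sum>k\<in>?K. \<Sum>i\<in>?K. \<alpha> k i * (hp l k x * hp l i x)"
  have "?S = (\<Sum>k\<in>?K. \<Sum>i\<in>?K. - \<alpha> i k * (hp l k x * hp l i x))"
    by (intro sum.cong refl) (subst anti, auto)
  also have "\<dots> = (\<Sum>i\<in>?K. \<Sum>k\<in>?K. - \<alpha> i k * (hp l k x * hp l i x))"
    by (rule sum.swap)
  also have "\<dots> = (\<Sum>i\<in>?K. \<Sum>k\<in>?K. - (\<alpha> i k * (hp l i x * hp l k x)))"
    by (intro sum.cong refl) simp
  also have "\<dots> = - ?S"
    by (simp only: sum_negf)
  finally have S0: "?S = 0" by simp
  have "pd c (\<lambda>x. \<Sum>k\<in>?K. hp l k x * hp l k x) x = (\<Sum>k\<in>?K. 2 * (hp l k x * pd c (hp l k) x))" for c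
    using rp by (subst pd_sum) (auto intro!: rpf_intros(4) sum.cong simp: pd_mult)
  then have "ang a b (\<lambda>x. \<Sum>k\<in>?K. hp l k x * hp l k x) x = 2 * (\<Sum>k\<in>?K. hp l k x * ang a b (hp l k) x)"
    by (simp add: ang_def sum_distrib_left sum_subtractf[symmetric] algebra_simps)
  also have "(\<Sum>k\<in>?K. hp l k x * ang a b (hp l k) x) = ?S"
    by (intro sum.cong refl) (simp add: expand sum_distrib_left mult_ac)
  finally show ?thesis using S0 by simp
qed

text \<open>
  Pairing a harmonic \<open>p\<close> of degree \<open>j \<ge> 1\<close> with \<open>G = \<Sum>\<^sub>k Y\<^sub>l\<^sub>k\<^sup>2\<close>, whose gradient on the sphere is
  \<open>2 l G x\<close>, in Green's formula shows that \<open>p\<close> is orthogonal to \<open>G\<close>.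
\<close>

lemma sum_Y_squares:
  assumes x: "x \<in> sphere 0 1"
  shows "(\<Sum>k=1..Z l. (Y l k x)\<^sup>2) = real (Z l)"
proof -
  define G where "G x = (\<Sum>k=1..Z l. hp l k x * hp l k x)" for x
  have hG: "homog (l + l) G"
    unfolding G_def[abs_def] by (intro homog_sum homog_mult hp) auto
  note rG = homog_rpf[OF hG]
  note cG = rpf_continuous_on[OF rG]
  have GY: "G x = (\<Sum>k=1..Z l. (Y l k x)\<^sup>2)" if "x \<in> sphere 0 1" for x
    unfolding G_def using that by (intro sum.cong) (auto simp: hp(3) power2_eq_square)
  \<comment> \<open>Since all \<open>ang a b G\<close> vanish on the sphere, the gradient of G is
    radial there; contraction with x and Euler's identity in degree 2l give its length.\<close>
  have grad: "pd b G x = real (l + l) * ((x \<bullet> b) * G x)" if b: "b \<in> Basis" and x: "x \<in> sphere 0 1" for b x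
  proof -
    have "(\<Sum>a\<in>Basis. (x \<bullet> a) * ang a b G x) = 0"
      using ang_sum_hp_squares[OF _ b x] by (simp add: G_def[abs_def])
    then have "(\<Sum>a\<in>Basis. (x \<bullet> a)\<^sup>2 * pd b G x - (x \<bullet> b) * ((x \<bullet> a) * pd a G x)) = 0"
      by (simp add: ang_def power2_eq_square algebra_simps)
    then have "(\<Sum>a\<in>Basis. (x \<bullet> a)\<^sup>2) * pd b G x = (x \<bullet> b) * (\<Sum>a\<in>Basis. (x \<bullet> a) * pd a G x)"
      by (simp add: sum_subtractf sum_distrib_left sum_distrib_right)
    then show ?thesis
      unfolding pd_euler[OF hG] norm2_eq_sum using x by (simp add: dot_square_norm)
  qed
  have orth: "I (\<lambda>x. ysph i x * G x) = 0" if i: "i \<in> J UNIV" and i0: "fst i \<noteq> 0" for i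
  proof -
    let ?p = "hp (fst i) (snd i)" and ?j = "real (fst i)"
    have hi: "homog (fst i) ?p" "\<And>x. lap ?p x = 0" using i hp by (auto simp: J_iff)
    have "I (\<lambda>x. \<Sum>b\<in>Basis. pd b ?p x * pd b G x) = I (\<lambda>x. real (l + l) * ?j * (?p x * G x))"
    proof (rule sphere_integral_cong)
      fix x :: 'a assume x: "x \<in> sphere 0 1"
      have "(\<Sum>b\<in>Basis. pd b ?p x * pd b G x) = real (l + l) * G x * (\<Sum>b\<in>Basis. (x \<bullet> b) * pd b ?p x)"
        unfolding sum_distrib_left using x by (intro sum.cong) (auto simp: grad)
      then show "(\<Sum>b\<in>Basis. pd b ?p x * pd b G x) = real (l + l) * ?j * (?p x * G x)"
        unfolding pd_euler[OF hi(1)] by simp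
    qed
    then have "real (l + l) * ?j * I (\<lambda>x. ?p x * G x)
        = ?j * (?j + real (l + l) + real DIM('a) - 2) * I (\<lambda>x. ?p x * G x)"
      unfolding sphere_integral_grad[OF hi hG] by simp
    \<comment> \<open>The two factors differ by j (j + d - 1), the eigenvalue of degree j, which is
      nonzero for j > 0.\<close>
    then have "?j * (?j + real d - 1) * I (\<lambda>x. ?p x * G x) = 0"
      by (simp add: DIM_eq algebra_simps)
    moreover have "?j * (?j + real d - 1) \<noteq> 0" using i0 d_ge_1 by auto
    ultimately have "I (\<lambda>x. ?p x * G x) = 0" by simp
    moreover have "I (\<lambda>x. ysph i x * G x) = I (\<lambda>x. ?p x * G x)"
      using i hp(3) by (intro sphere_integral_cong) (auto simp: J_iff)
    ultimately show ?thesis by simp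
  qed
  define c where "c = I G"
  have G_const: "G x - c = 0" if "x \<in> sphere 0 1" for x
  proof (rule harmonics_complete[OF _ _ that])
    show "continuous_on (sphere 0 1) (\<lambda>x. G x - c)" by (intro continuous_intros cG)
    fix i assume i: "i \<in> J UNIV"
    have Yint: "integrable sphere_measure (ysph i)" using Y_continuous[OF i] by auto
    have int: "I (\<lambda>x. (G x - c) * ysph i x) = I (\<lambda>x. ysph i x * G x) - c * I (ysph i)"
      unfolding left_diff_distrib
      by (subst Bochner_Integration.integral_diff)
         (use Y_continuous[OF i] Yint cG in \<open>auto simp: mult.commute intro!: I_mult_integrable\<close>)
    show "I (\<lambda>x. (G x - c) * ysph i x) = 0"
    proof (cases "fst i = 0")
      case True
      \<comment> \<open>A harmonic of degree 0 is constant on the sphere, and c is the mean of G, so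
        the two terms cancel.\<close>
      let ?v = "hp 0 (snd i) 0"
      have h: "homog 0 (hp 0 (snd i))" using hp(1)[of "snd i" "fst i"] i True by (auto simp: J_iff)
      have "ysph i x = ?v" if "x \<in> sphere 0 1" for x
        using homog_0_const[OF h, of x] hp(3)[of "snd i" 0 x] i that True by (auto simp: J_iff)
      then have "I (ysph i) = I (\<lambda>x. ?v)" "I (\<lambda>x. ysph i x * G x) = I (\<lambda>x. ?v * G x)"
        by (simp_all only: cong: sphere_integral_cong)
      then show ?thesis
        unfolding int by (simp add: c_def sph.prob_space[unfolded space_sphere_measure])
    next
      case False
      have "hsum 0 (\<lambda>x. 1)" by (rule homog_hsum) simp
      from hsum_coeff(2)[OF this i] False have "I (ysph i) = 0" by simp
      then show ?thesis using orth[OF i False] by (simp add: int)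
    qed
  qed
  \<comment> \<open>The constant is identified by its mean, to which each of the Z l normalized
    harmonics contributes 1.\<close>
  have "c = I (\<lambda>x. \<Sum>k=1..Z l. Y l k x * Y l k x)"
    unfolding c_def using GY by (intro sphere_integral_cong) (simp add: power2_eq_square)
  also have "\<dots> = (\<Sum>k=1..Z l. I (\<lambda>x. Y l k x * Y l k x))"
    using Y_continuous[of "(l, _)" "{l}"]
    by (intro Bochner_Integration.integral_sum I_mult_integrable) (auto simp: J_iff)
  also have "\<dots> = (\<Sum>k=1..Z l. 1)"
    using Y_orthonormal[of "(l, _)" "{l}" "(l, _)" "{l}"] by (intro sum.cong) (auto simp: J_iff)
  finally have "c = real (Z l)" by simp
  then show ?thesis using G_const[OF x] GY[OF x] by simp
qed

end

section \<open>Counting harmonics through monomials on the sphere\<close>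

lemma sum_fun_apply: "(\<Sum>i\<in>A. f i) x = (\<Sum>i\<in>A. f i x)"
  by (induction A rule: infinite_finite_induct) auto

text \<open>Setting functions to 0 off the sphere makes equality on the sphere equality of
  functions, so that linear independence can be expressed in a space of functions.\<close>

definition restr :: "('a::euclidean_space \<Rightarrow> real) \<Rightarrow> 'a \<Rightarrow> real" where
  "restr f x = (if x \<in> sphere 0 1 then f x else 0)"

text \<open>On the sphere x_e^2 is a polynomial in the other coordinates, so exponents 0 and 1 of
  x_e suffice. This saves one power of n in the count. The extensional product makes each exponent
  vector occur once.\<close>

definition mono_idx :: "'a::euclidean_space \<Rightarrow> nat \<Rightarrow> (nat \<times> ('a \<Rightarrow> nat)) set" where
  "mono_idx e n = {(i, \<alpha>). i \<le> 1 \<and> \<alpha> \<in> (\<Pi>\<^sub>E b\<in>Basis - {e}. {..n}) \<and> i + (\<Sum>b\<in>Basis - {e}. \<alpha> b) \<le> n}"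

definition mono_fun :: "'a::euclidean_space \<Rightarrow> nat \<times> ('a \<Rightarrow> nat) \<Rightarrow> 'a \<Rightarrow> real" where
  "mono_fun e = (\<lambda>(i, \<alpha>). restr (\<lambda>x. (x \<bullet> e) ^ i * (\<Prod>b\<in>Basis - {e}. (x \<bullet> b) ^ \<alpha> b)))"

lemma mono_idx_finite_card:
  assumes "e \<in> Basis"
  shows "finite (mono_idx (e::'a::euclidean_space) n)" "card (mono_idx e n) \<le> 2 * (n + 1) ^ (DIM('a) - 1)"
proof -
  let ?P = "\<Pi>\<^sub>E b\<in>Basis - {e}. {..n}"
  have sub: "mono_idx e n \<subseteq> {..1} \<times> ?P" by (auto simp: mono_idx_def)
  have fin: "finite ({..1::nat} \<times> ?P)" by (intro finite_cartesian_product finite_PiE) auto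
  show "finite (mono_idx e n)" using finite_subset[OF sub fin] .
  have "card (mono_idx e n) \<le> card ({..1::nat} \<times> ?P)" by (rule card_mono[OF fin sub])
  also have "\<dots> = 2 * (n + 1) ^ (DIM('a) - 1)"
    using assms by (simp add: card_cartesian_product card_PiE)
  finally show "card (mono_idx e n) \<le> 2 * (n + 1) ^ (DIM('a) - 1)" .
qed

text \<open>Gives access to the comparison of an independent set with a spanning set, used in
  \<open>card_J_le\<close>.\<close>

interpretation fv: vector_space "\<lambda>(c::real) (f::'a::euclidean_space \<Rightarrow> real) x. c * f x"
  by unfold_locales (auto simp: fun_eq_iff algebra_simps)

abbreviation mono_span :: "'a::euclidean_space \<Rightarrow> nat \<Rightarrow> ('a \<Rightarrow> real) set" where
  "mono_span e n \<equiv> fv.span (mono_fun e ` mono_idx e n)"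

lemma mono_idx_mono: "m \<le> n \<Longrightarrow> mono_idx e m \<subseteq> mono_idx e n"
  unfolding mono_idx_def using PiE_mono[of "Basis - {e}" "\<lambda>_. {..m}" "\<lambda>_. {..n}"] by auto

lemma mono_span_mono: "m \<le> n \<Longrightarrow> mono_span e m \<subseteq> mono_span e n"
  by (intro fv.span_mono image_mono mono_idx_mono)

lemma mono_idx_upd:
  assumes "(i, \<alpha>) \<in> mono_idx e n" "b \<in> Basis - {e}"
  shows "(i, \<alpha>(b := \<alpha> b + k)) \<in> mono_idx e (n + k)"
    and "mono_fun e (i, \<alpha>(b := \<alpha> b + k)) = (\<lambda>x. (x \<bullet> b) ^ k * mono_fun e (i, \<alpha>) x)"
proof -
  have s: "(\<Sum>c\<in>Basis - {e}. (\<alpha>(b := \<alpha> b + k)) c) = (\<Sum>c\<in>Basis - {e}. \<alpha> c) + k"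
  proof -
    have "(\<Sum>c\<in>Basis - {e}. (\<alpha>(b := \<alpha> b + k)) c) = (\<Sum>c\<in>Basis - {e}. \<alpha> c + (if c = b then k else 0))"
      by (intro sum.cong) auto
    then show ?thesis using assms(2) by (simp add: sum.distrib)
  qed
  show "(i, \<alpha>(b := \<alpha> b + k)) \<in> mono_idx e (n + k)"
    using assms unfolding mono_idx_def by (simp only: mem_Collect_eq split s)
      (auto simp: PiE_iff extensional_def intro: trans_le_add1)
  have "(\<Prod>c\<in>Basis - {e}. (x \<bullet> c) ^ (\<alpha>(b := \<alpha> b + k)) c) = (x \<bullet> b) ^ k * (\<Prod>c\<in>Basis - {e}. (x \<bullet> c) ^ \<alpha> c)" for x
  proof -
    have "(\<Prod>c\<in>Basis - {e}. (x \<bullet> c) ^ (\<alpha>(b := \<alpha> b + k)) c)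
        = (\<Prod>c\<in>Basis - {e}. (x \<bullet> c) ^ \<alpha> c * (if c = b then (x \<bullet> b) ^ k else 1))"
      by (intro prod.cong) (auto simp: power_add)
    then show ?thesis using assms(2) by (simp add: prod.distrib mult.commute)
  qed
  then show "mono_fun e (i, \<alpha>(b := \<alpha> b + k)) = (\<lambda>x. (x \<bullet> b) ^ k * mono_fun e (i, \<alpha>) x)"
    by (simp add: mono_fun_def restr_def fun_eq_iff)
qed

text \<open>A second factor x_e is removed by the equation of the sphere, x_e^2 = 1 - (sum of the
  other squares); the degree still grows by at most one.\<close>

lemma mono_span_mult_inner:
  fixes e :: "'a::euclidean_space"
  assumes e: "e \<in> Basis" and b: "b \<in> Basis" and f: "f \<in> mono_span e n"
  shows "(\<lambda>x. (x \<bullet> b) * f x) \<in> mono_span e (Suc n)"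
  using f
proof (induction rule: fv.span_induct_alt)
  case base
  have "(\<lambda>x. (x \<bullet> b) * (0 :: 'a \<Rightarrow> real) x) = 0" by (simp add: fun_eq_iff)
  then show ?case using fv.span_zero by metis
next
  case (step c m g)
  then obtain i \<alpha> where m: "m = mono_fun e (i, \<alpha>)" and ia: "(i, \<alpha>) \<in> mono_idx e n" by auto
  have "(\<lambda>x. (x \<bullet> b) * m x) \<in> mono_span e (Suc n)"
  proof (cases "b = e")
    case False
    then have "b \<in> Basis - {e}" using b by auto
    from mono_idx_upd[OF ia this, of 1] m show ?thesis
      by (intro fv.span_base) (auto intro!: image_eqI)
  next
    case True
    consider "i = 0" | "i = 1" using ia by (force simp: mono_idx_def)
    then show ?thesis
    proof cases
      case 1
      have "(1, \<alpha>) \<in> mono_idx e (Suc n)"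
        using ia 1 unfolding mono_idx_def by (auto simp: PiE_iff intro: le_SucI)
      moreover have "(\<lambda>x. (x \<bullet> b) * m x) = mono_fun e (1, \<alpha>)"
        by (simp add: m mono_fun_def restr_def fun_eq_iff True 1)
      ultimately show ?thesis by (intro fv.span_base) auto
    next
      case 2
      \<comment> \<open>Dropping the factor x_e frees one degree, so the two degrees of x_b^2 lead
        to (n - 1) + 2 = n + 1. The individual bounds on the exponents follow from the bound on
        their sum.\<close>
      have a0: "(0, \<alpha>) \<in> mono_idx e (n - 1)"
      proof -
        have s: "(\<Sum>b\<in>Basis - {e}. \<alpha> b) \<le> n - 1" and p: "\<alpha> \<in> (\<Pi>\<^sub>E b\<in>Basis - {e}. {..n})"
          using ia 2 by (simp_all add: mono_idx_def) linarith
        have "\<alpha> c \<le> n - 1" if "c \<in> Basis - {e}" for c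
          using member_le_sum[of c "Basis - {e}" \<alpha>] that s by auto
        then show ?thesis using s p by (auto simp: mono_idx_def PiE_iff)
      qed
      have n1: "n \<ge> 1" using ia 2 by (auto simp: mono_idx_def)
      have sq: "(x \<bullet> e)\<^sup>2 = 1 - (\<Sum>b\<in>Basis - {e}. (x \<bullet> b)\<^sup>2)" if "x \<in> sphere 0 1" for x
        using norm2_eq_sum[of x] that sum.remove[OF finite_Basis e, of "\<lambda>b. (x \<bullet> b)\<^sup>2"]
        by (simp add: dot_square_norm)
      have "(x \<bullet> b) * m x = mono_fun e (0, \<alpha>) x - (\<Sum>b\<in>Basis - {e}. mono_fun e (0, \<alpha>(b := \<alpha> b + 2)) x)" for x
      proof (cases "x \<in> sphere 0 1")
        case True
        have "(x \<bullet> b) * m x = (x \<bullet> e)\<^sup>2 * mono_fun e (0, \<alpha>) x"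
          using \<open>b = e\<close> by (simp add: m mono_fun_def restr_def 2 power2_eq_square)
        also have "\<dots> = mono_fun e (0, \<alpha>) x - (\<Sum>b\<in>Basis - {e}. (x \<bullet> b)\<^sup>2 * mono_fun e (0, \<alpha>) x)"
          unfolding sq[OF True] by (simp add: left_diff_distrib sum_distrib_right)
        also have "(\<Sum>b\<in>Basis - {e}. (x \<bullet> b)\<^sup>2 * mono_fun e (0, \<alpha>) x)
            = (\<Sum>b\<in>Basis - {e}. mono_fun e (0, \<alpha>(b := \<alpha> b + 2)) x)"
          by (intro sum.cong refl) (subst mono_idx_upd(2)[OF a0], auto)
        finally show ?thesis .
      qed (simp add: m mono_fun_def restr_def)
      then have "(\<lambda>x. (x \<bullet> b) * m x) = mono_fun e (0, \<alpha>) - (\<Sum>b\<in>Basis - {e}. mono_fun e (0, \<alpha>(b := \<alpha> b + 2)))"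
        by (simp add: fun_eq_iff sum_fun_apply)
      also have "\<dots> \<in> mono_span e (Suc n)"
      proof (intro fv.span_diff fv.span_sum)
        show "mono_fun e (0, \<alpha>) \<in> mono_span e (Suc n)"
          using subsetD[OF mono_idx_mono[of "n - 1" "Suc n" e] a0] by (intro fv.span_base imageI) simp
        fix b assume "b \<in> Basis - {e}"
        from mono_idx_upd(1)[OF a0 this, of 2]
        show "mono_fun e (0, \<alpha>(b := \<alpha> b + 2)) \<in> mono_span e (Suc n)"
          using n1 by (intro fv.span_base imageI) (simp add: numeral_2_eq_2 fun_upd_def)
      qed
      finally show ?thesis .
    qed
  qed
  then have "(\<lambda>x. c * ((x \<bullet> b) * m x)) + (\<lambda>x. (x \<bullet> b) * g x) \<in> mono_span e (Suc n)"
    using step by (intro fv.span_add fv.span_scale)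
  also have "(\<lambda>x. c * ((x \<bullet> b) * m x)) + (\<lambda>x. (x \<bullet> b) * g x)
      = (\<lambda>x. (x \<bullet> b) * ((\<lambda>x. c * m x) + g) x)"
    by (simp add: fun_eq_iff algebra_simps)
  finally show ?case .
qed

text \<open>Euler's identity writes p as a combination of x_b times derivatives of degree one less,
  which reduces the claim to \<open>mono_span_mult_inner\<close>.\<close>

lemma homog_mono_span:
  fixes e :: "'a::euclidean_space"
  assumes e: "e \<in> Basis" and p: "homog l p"
  shows "restr p \<in> mono_span e l"
  using p
proof (induction l arbitrary: p)
  case 0
  have i: "(0, \<lambda>b\<in>Basis - {e}. 0) \<in> mono_idx e 0" by (auto simp: mono_idx_def)
  have "restr p = (\<lambda>x. p 0 * mono_fun e (0, \<lambda>b\<in>Basis - {e}. 0) x)"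
    using homog_0_const[OF 0] by (simp add: mono_fun_def restr_def fun_eq_iff)
  then show ?case using fv.span_scale[OF fv.span_base[OF imageI[OF i, of "mono_fun e"]], of "p 0"] by simp
next
  case (Suc l)
  have "restr p = (\<lambda>x. (1 / real (Suc l)) * (\<Sum>b\<in>Basis. (\<lambda>x. (x \<bullet> b) * restr (pd b p) x)) x)"
    using pd_euler[OF Suc.prems] by (auto simp: fun_eq_iff restr_def sum_fun_apply)
  also have "\<dots> \<in> mono_span e (Suc l)"
  proof (intro fv.span_scale fv.span_sum mono_span_mult_inner[OF e])
    fix b
    show "restr (pd b p) \<in> mono_span e l"
      using homog_pd[OF Suc.prems, of b] by (intro Suc.IH) simp
  qed
  finally show ?case .
qed

context sphere_harmonics begin

text \<open>Orthonormality makes the restricted harmonics of degree at most n an independent family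
  inside the span of the reduced monomials of degree at most n. The factor 2 stands for the two
  exponents of x_e.\<close>

lemma card_J_le: "card (J {..n}) \<le> 2 * (n + 1) ^ d"
proof -
  obtain e :: 'a where e: "e \<in> Basis" using nonempty_Basis by blast
  let ?A = "J {..n}" and ?r = "\<lambda>i. restr (ysph i)"
  have Irr: "I (\<lambda>x. ?r i x * ?r j x) = (if i = j then 1 else 0)" if "i \<in> ?A" "j \<in> ?A" for i j
    using Y_orthonormal[OF that] by (subst sphere_integral_cong[of _ "\<lambda>x. ysph i x * ysph j x"]) (auto simp: restr_def)
  have inj: "inj_on ?r ?A"
  proof (rule inj_onI)
    fix i j assume ij: "i \<in> ?A" "j \<in> ?A" "?r i = ?r j"
    then have "I (\<lambda>x. ?r i x * ?r j x) = I (\<lambda>x. ?r i x * ?r i x)" by simp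
    then show "i = j" using Irr[OF ij(1,2)] Irr[OF ij(1,1)] by (auto split: if_splits)
  qed
  have ind: "fv.independent (?r ` ?A)"
  proof (rule fv.independent_if_scalars_zero)
    fix c g assume 0: "(\<Sum>h\<in>?r ` ?A. (\<lambda>x. c h * h x)) = 0" and "g \<in> ?r ` ?A"
    then obtain j where j: "j \<in> ?A" "g = ?r j" by blast
    have z: "(\<Sum>i\<in>?A. c (?r i) * ysph i x) = 0" if "x \<in> sphere 0 1" for x
    proof -
      have "(\<Sum>h\<in>?r ` ?A. c h * h x) = 0"
        using fun_cong[OF 0, of x] by (simp add: sum_fun_apply)
      then show ?thesis using that by (simp add: sum.reindex[OF inj] restr_def)
    qed
    have "I (\<lambda>x. (\<Sum>i\<in>?A. c (?r i) * ysph i x) * ysph j x) = I (\<lambda>x. 0)"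
      by (rule sphere_integral_cong) (simp add: z)
    then show "c g = 0"
      using I_sum_Y[OF order_refl _ j(1), of "{..n}" "\<lambda>i. c (?r i)"] j by simp
  qed simp
  have sub: "?r ` ?A \<subseteq> mono_span e n"
  proof safe
    fix l k assume i: "(l, k) \<in> ?A"
    then have "restr (hp l k) \<in> mono_span e l" by (intro homog_mono_span[OF e] hp) (auto simp: J_iff)
    also have "restr (hp l k) = restr (Y l k)" using i hp(3)[of k l] by (auto simp: restr_def fun_eq_iff J_iff)
    finally show "restr (ysph (l, k)) \<in> mono_span e n"
      using mono_span_mono[of l n e] i by (auto simp: J_iff)
  qed
  have "card ?A = card (?r ` ?A)" by (simp add: card_image[OF inj])
  also have "\<dots> \<le> card (mono_fun e ` mono_idx e n)"
    using fv.independent_span_bound[OF _ ind sub] mono_idx_finite_card[OF e] by simp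
  also have "\<dots> \<le> card (mono_idx e n)" by (rule card_image_le[OF mono_idx_finite_card(1)[OF e]])
  also have "\<dots> \<le> 2 * (n + 1) ^ d" using mono_idx_finite_card(2)[OF e, of n] by (simp add: DIM_eq)
  finally show ?thesis .
qed

lemma sum_Z_le: "(\<Sum>l\<le>n. real (Z l)) \<le> 2 * real (n + 1) ^ d"
proof -
  have "(\<Sum>l\<le>n. real (Z l)) = real (card (J {..n}))" by (simp add: J_def card_SigmaI)
  also have "\<dots> \<le> real (2 * (n + 1) ^ d)" using card_J_le by (simp only: of_nat_le_iff)
  finally show ?thesis by simp
qed

end

section \<open>Fourier series and multipliers\<close>

lemma power_mult_powr: "x > 0 \<Longrightarrow> (x::real) ^ n * x powr a = x powr (real n + a)"
  by (simp add: powr_add powr_realpow)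

lemma abel_summation:
  fixes a b :: "nat \<Rightarrow> real"
  shows "(\<Sum>l\<le>n. a l * b l) = (\<Sum>l\<le>n. a l) * b n + (\<Sum>l<n. (\<Sum>i\<le>l. a i) * (b l - b (Suc l)))"
  by (induction n) (simp_all add: algebra_simps)

lemma powr_neg_diff_le:
  assumes "p \<ge> 0"
  shows "(1 + real l) powr (- p) - (1 + real (Suc l)) powr (- p) \<le> p * (1 + real l) powr (- p - 1)"
proof -
  have D: "((\<lambda>x. x powr (- p)) has_real_derivative - p * x powr (- p - 1)) (at x)" if "x > 0" for x :: real
    using that by (auto intro!: derivative_eq_intros)
  obtain z where z: "1 + real l < z" "z < 1 + real (Suc l)"
    "(1 + real (Suc l)) powr (- p) - (1 + real l) powr (- p) = (1 + real (Suc l) - (1 + real l)) * (- p * z powr (- p - 1))"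
    using MVT2[of "1 + real l" "1 + real (Suc l)" "\<lambda>x. x powr (- p)" "\<lambda>x. - p * x powr (- p - 1)"] D
    by auto
  have "z powr (- p - 1) \<le> (1 + real l) powr (- p - 1)"
    using z assms by (intro powr_mono2') auto
  then have "p * z powr (- p - 1) \<le> p * (1 + real l) powr (- p - 1)"
    using assms by (rule mult_left_mono)
  then show ?thesis using z(3) by simp
qed

text \<open>The dimension count controls only cumulative sums of the multiplicities. Abel summation
  moves the difference onto the weight, which costs it one power, and (1 + l)^(d - p - 1) is
  summable for p > d.\<close>

lemma summable_of_partial_sums_le:
  fixes a :: "nat \<Rightarrow> real"
  assumes a: "\<And>l. 0 \<le> a l" and S: "\<And>n. (\<Sum>l\<le>n. a l) \<le> C * real (n + 1) ^ d" and p: "p > real d"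
  shows "summable (\<lambda>l. a l * (1 + real l) powr (- p))"
proof -
  have C: "0 \<le> C" using S[of 0] a[of 0] by simp
  let ?b = "\<lambda>l. (1 + real l) powr (- p)"
  let ?e = "\<lambda>l. C * p * (1 + real l) powr (real d - p - 1)"
  have summ: "summable ?e"
  proof -
    have "summable (\<lambda>n. real (Suc n) powr (real d - p - 1))"
      using p by (subst summable_Suc_iff) (simp add: summable_real_powr_iff)
    then show ?thesis by (intro summable_mult) (simp add: add.commute)
  qed
  have Cp: "real (n + 1) ^ d * (1 + real n) powr t = (1 + real n) powr (real d + t)" for n t
    using power_mult_powr[of "1 + real n" d t] by (simp add: add.commute)
  have bound: "(\<Sum>l\<le>n. a l * ?b l) \<le> C + suminf ?e" for n
  proof -
    have "(\<Sum>l\<le>n. a l) * ?b n \<le> C * real (n + 1) ^ d * ?b n"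
      using S by (intro mult_right_mono) auto
    also have "\<dots> = C * (1 + real n) powr (real d - p)" using Cp[of n "- p"] by (simp add: mult.assoc)
    also have "\<dots> \<le> C * 1" using p C powr_mono[of "real d - p" 0 "1 + real n"] by (intro mult_left_mono) auto
    finally have 1: "(\<Sum>l\<le>n. a l) * ?b n \<le> C" by simp
    have "(\<Sum>l<n. (\<Sum>i\<le>l. a i) * (?b l - ?b (Suc l))) \<le> (\<Sum>l<n. ?e l)"
    proof (rule sum_mono)
      fix l
      have "(\<Sum>i\<le>l. a i) * (?b l - ?b (Suc l)) \<le> (C * real (l + 1) ^ d) * (p * (1 + real l) powr (- p - 1))"
        using S p C a powr_neg_diff_le[of p l]
        by (intro mult_mono) (auto intro!: powr_mono2')
      also have "\<dots> = ?e l" using Cp[of l "- p - 1"] by (simp add: mult_ac diff_diff_eq2 algebra_simps)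
      finally show "(\<Sum>i\<le>l. a i) * (?b l - ?b (Suc l)) \<le> ?e l" .
    qed
    also have "\<dots> \<le> suminf ?e" using C p by (intro sum_le_suminf summ) auto
    finally show ?thesis using 1 by (subst abel_summation) linarith
  qed
  show ?thesis
  proof (rule summableI_nonneg_bounded)
    fix n show "(\<Sum>l<n. a l * ?b l) \<le> C + suminf ?e"
      using bound[of n] a by (intro order_trans[OF sum_mono2 bound[of n]]) auto
  qed (use a in simp)
qed

lemma sphere_series:
  fixes u :: "nat \<Rightarrow> 'a::euclidean_space \<Rightarrow> real"
  assumes u: "\<And>l. continuous_on (sphere 0 1) (u l)"
    and M: "\<And>l x. x \<in> sphere 0 1 \<Longrightarrow> \<bar>u l x\<bar> \<le> M l" and sM: "summable M"
  shows "continuous_on (sphere 0 1) (\<lambda>x. \<Sum>l. u l x)"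
    and "x \<in> sphere 0 1 \<Longrightarrow> summable (\<lambda>l. u l x)"
    and "(\<lambda>l. LINT x|sphere_measure. u l x) sums (LINT x|sphere_measure. (\<Sum>l. u l x))"
proof -
  have "uniform_limit (sphere 0 1) (\<lambda>n x. \<Sum>l<n. u l x) (\<lambda>x. \<Sum>l. u l x) sequentially"
    using M sM by (intro Weierstrass_m_test) auto
  then show "continuous_on (sphere 0 1) (\<lambda>x. \<Sum>l. u l x)"
    by (rule uniform_limit_theorem[rotated]) (auto intro!: always_eventually continuous_on_sum u)
  have sa: "summable (\<lambda>l. norm (u l x))" if "x \<in> sphere 0 1" for x
    using M[OF that] by (intro summable_comparison_test'[OF sM, of 0]) auto
  show "summable (\<lambda>l. u l x)" if "x \<in> sphere 0 1" using sa[OF that] by (rule summable_norm_cancel)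
  show "(\<lambda>l. LINT x|sphere_measure. u l x) sums (LINT x|sphere_measure. (\<Sum>l. u l x))"
  proof (rule sums_integral)
    show "integrable sphere_measure (u l)" for l using u by auto
    show "AE x in sphere_measure. summable (\<lambda>l. norm (u l x))" using sa by (intro AE_I2) auto
    show "summable (\<lambda>l. LINT x|sphere_measure. norm (u l x))"
    proof (rule summable_comparison_test'[OF sM, of 0])
      fix l :: nat
      have "(LINT x|sphere_measure. norm (u l x)) \<le> (LINT x|(sphere_measure::'a measure). M l)"
        using M u by (intro integral_mono sphere_integrable_continuous continuous_intros) auto
      also have "\<dots> = M l" by (simp add: sph.prob_space[unfolded space_sphere_measure])
      finally show "norm (LINT x|sphere_measure. norm (u l x)) \<le> M l" by simp
    qed
  qed
qed

section \<open>Sobolev weights, harmonic components and Fourier series\<close>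

context sphere_harmonics begin

abbreviation ev :: "nat \<Rightarrow> real" where "ev l \<equiv> 1 + eigval d l"

text \<open>The lower bound combines (1 + l)^2 <= 2 (1 + l^2), which is (1 - l)^2 >= 0, with l^2 <=
  \<lambda>_l, which is d >= 1. Powers of \<open>ev l\<close> and of 1 + l thus become
  interchangeable up to constants.\<close>

lemma ev_bounds:
  "(1 + real l)\<^sup>2 / 2 \<le> ev l" "ev l \<le> (1 + real d) * (1 + real l)\<^sup>2" "1 \<le> ev l" "0 \<le> eigval d l"
proof -
  have d: "real d \<ge> 1" using d_ge_1 by simp
  have "real l * real l \<le> eigval d l" unfolding eigval_def using d by (intro mult_left_mono) auto
  moreover have "0 \<le> (1 - real l)\<^sup>2" by simp
  ultimately show "(1 + real l)\<^sup>2 / 2 \<le> ev l" by (simp add: power2_eq_square field_simps)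
  have "eigval d l \<le> real l * (real l + real d)" unfolding eigval_def by (intro mult_left_mono) auto
  moreover have "(1 + real d) * (1 + real l)\<^sup>2 = 1 + real l * (real l + real d) + real d + 2 * real l
      + real d * (real l * real l) + real d * real l"
    by (simp add: power2_eq_square algebra_simps)
  moreover have "0 \<le> real d * (real l * real l)" "0 \<le> real d * real l" by auto
  ultimately show "ev l \<le> (1 + real d) * (1 + real l)\<^sup>2" using d by linarith
  show "0 \<le> eigval d l" "1 \<le> ev l" using \<open>real l * real l \<le> eigval d l\<close> by (auto intro: order_trans[rotated])
qed

lemma ev_mono: "l \<le> k \<Longrightarrow> ev l \<le> ev k"
  unfolding eigval_def using d_ge_1 by (intro add_left_mono mult_mono) auto

text \<open>The weight is comparable to (1 + l)^(-2(s - \<rho>)), and the sums of the multiplicities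
  grow like the power d, hence the threshold d/2 for s - \<rho>.\<close>

lemma Z_weighted_summable:
  assumes "0 \<le> s" "s - \<rho> > real d / 2"
  shows "summable (\<lambda>l. (1 + real l) powr (2 * \<rho>) * ev l powr (- s) * real (Z l))"
proof -
  have "summable (\<lambda>l. real (Z l) * (1 + real l) powr (- (2 * (s - \<rho>))))"
    using sum_Z_le assms by (intro summable_of_partial_sums_le[where C=2 and d=d]) auto
  from summable_mult[OF this, of "2 powr s"]
  have *: "summable (\<lambda>l. 2 powr s * (real (Z l) * (1 + real l) powr (- (2 * (s - \<rho>)))))" .
  show ?thesis
  proof (rule summable_comparison_test'[OF *, of 0])
    fix l :: nat
    have "ev l powr (- s) \<le> ((1 + real l)\<^sup>2 / 2) powr (- s)"
      using ev_bounds[of l] assms(1) by (intro powr_mono2') auto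
    also have "\<dots> = 2 powr s * (1 + real l) powr (- 2 * s)"
      by (simp add: powr_divide powr_minus divide_simps powr_powr flip: powr_numeral)
    finally have "(1 + real l) powr (2 * \<rho>) * ev l powr (- s) * real (Z l)
        \<le> (1 + real l) powr (2 * \<rho>) * (2 powr s * (1 + real l) powr (- 2 * s)) * real (Z l)"
      by (intro mult_right_mono mult_left_mono) auto
    also have "\<dots> = 2 powr s * (real (Z l) * (1 + real l) powr (- (2 * (s - \<rho>))))"
      by (simp add: powr_diff powr_minus right_diff_distrib divide_simps)
    finally show "norm ((1 + real l) powr (2 * \<rho>) * ev l powr (- s) * real (Z l))
        \<le> 2 powr s * (real (Z l) * (1 + real l) powr (- (2 * (s - \<rho>))))"
      using ev_bounds[of l] by (simp add: abs_mult)
  qed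
qed

text \<open>Cauchy-Schwarz after inserting the weights of orders s/2 and -s/2. For \<rho> = 0 it is
  the Sobolev embedding into continuous functions; for \<rho> = r it sums the norms of the
  multiplications by the harmonic components.\<close>

lemma weighted_cauchy_schwarz:
  assumes s: "0 \<le> s" "s - \<rho> > real d / 2" and \<phi>: "\<And>l. 0 \<le> \<phi> l"
    and summ: "summable (\<lambda>l. ev l powr s * (\<phi> l)\<^sup>2)"
  defines "m \<equiv> \<lambda>l. (1 + real l) powr \<rho> * sqrt (real (Z l)) * \<phi> l"
    and "K \<equiv> (\<Sum>l. (1 + real l) powr (2 * \<rho>) * ev l powr (- s) * real (Z l))"
  shows "summable m" "(suminf m)\<^sup>2 \<le> K * (\<Sum>l. ev l powr s * (\<phi> l)\<^sup>2)"
proof -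
  let ?N = "\<Sum>l. ev l powr s * (\<phi> l)\<^sup>2"
  note sK = Z_weighted_summable[OF s]
  have m0: "m l \<ge> 0" for l using \<phi> by (simp add: m_def)
  have K0: "K \<ge> 0" unfolding K_def by (intro suminf_nonneg sK) auto
  have N0: "?N \<ge> 0" by (intro suminf_nonneg summ) auto
  have part: "(\<Sum>l<n. m l) \<le> sqrt (K * ?N)" for n
  proof -
    let ?u = "\<lambda>l. (1 + real l) powr \<rho> * ev l powr (- s / 2) * sqrt (real (Z l))"
    let ?v = "\<lambda>l. ev l powr (s / 2) * \<phi> l"
    have sq: "(ev l powr (t / 2))\<^sup>2 = ev l powr t" "((1 + real l) powr \<rho>)\<^sup>2 = (1 + real l) powr (2 * \<rho>)" for l t
      by (simp_all add: power2_eq_square flip: powr_add)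
    have "(\<Sum>l<n. m l) = (\<Sum>l<n. \<bar>?u l\<bar> * \<bar>?v l\<bar>)"
    proof (rule sum.cong)
      fix l
      have "ev l powr (- s / 2) * ev l powr (s / 2) = 1"
        using ev_bounds(3)[of l] by (simp flip: powr_add)
      then show "m l = \<bar>?u l\<bar> * \<bar>?v l\<bar>"
        using \<phi>[of l] by (simp add: m_def abs_mult mult_ac)
    qed simp
    also have "\<dots> \<le> L2_set ?u {..<n} * L2_set ?v {..<n}" by (rule L2_set_mult_ineq)
    also have "\<dots> \<le> sqrt K * sqrt ?N"
    proof (rule mult_mono)
      have "(\<Sum>l<n. (?u l)\<^sup>2) \<le> K"
        unfolding K_def power_mult_distrib sq using sq(1)[of _ "- s"]
        by (subst sum.cong[OF refl, of _ _ "\<lambda>l. (1 + real l) powr (2 * \<rho>) * ev l powr (- s) * real (Z l)"])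
           (auto intro!: sum_le_suminf sK)
      then show "L2_set ?u {..<n} \<le> sqrt K" by (simp add: L2_set_def)
      have "(\<Sum>l<n. (?v l)\<^sup>2) \<le> ?N"
        unfolding power_mult_distrib sq by (intro sum_le_suminf summ) auto
      then show "L2_set ?v {..<n} \<le> sqrt ?N" by (simp add: L2_set_def)
    qed (auto simp: K0 L2_set_nonneg)
    finally show ?thesis by (simp add: real_sqrt_mult)
  qed
  show sm: "summable m" by (rule summableI_nonneg_bounded[OF m0 part])
  have "suminf m \<le> sqrt (K * ?N)" by (rule suminf_le_const[OF sm part])
  then have "(suminf m)\<^sup>2 \<le> (sqrt (K * ?N))\<^sup>2"
    using m0 sm by (intro power_mono suminf_nonneg)
  then show "(suminf m)\<^sup>2 \<le> K * ?N" using K0 N0 by simp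
qed

definition fc :: "('a \<Rightarrow> real) \<Rightarrow> nat \<Rightarrow> nat \<Rightarrow> real" where
  "fc f l k = I (\<lambda>x. f x * Y l k x)"

definition fnorm :: "('a \<Rightarrow> real) \<Rightarrow> nat \<Rightarrow> real" where
  "fnorm f l = sqrt (\<Sum>k=1..Z l. (fc f l k)\<^sup>2)"

definition fproj :: "('a \<Rightarrow> real) \<Rightarrow> nat \<Rightarrow> 'a \<Rightarrow> real" where
  "fproj f l x = (\<Sum>k=1..Z l. fc f l k * Y l k x)"

lemma fnorm_nonneg: "0 \<le> fnorm f l"
  by (simp add: fnorm_def sum_nonneg)

lemma fproj_eq_J: "fproj f l x = (\<Sum>i\<in>J {l}. fc f (fst i) (snd i) * ysph i x)"
  by (simp add: fproj_def sum_J)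

lemma fproj_continuous: "continuous_on (sphere 0 1) (fproj f l)"
  unfolding fproj_eq_J[abs_def] by (rule continuous_Y_sum[OF order_refl])

lemma fproj_hsum: "hsum l (fproj f l)"
proof (rule hsumI)
  fix x :: 'a
  show "fproj f l x = (\<Sum>i\<in>J {..l}. (if fst i = l then fc f (fst i) (snd i) else 0) * ysph i x)"
    unfolding fproj_eq_J by (intro sum.mono_neutral_cong_left) (auto simp: J_iff)
qed

lemma fproj_bound:
  assumes x: "x \<in> sphere 0 1" shows "\<bar>fproj f l x\<bar> \<le> sqrt (real (Z l)) * fnorm f l"
proof -
  have "\<bar>fproj f l x\<bar> \<le> (\<Sum>k=1..Z l. \<bar>fc f l k\<bar> * \<bar>Y l k x\<bar>)"
    unfolding fproj_def by (intro order_trans[OF sum_abs]) (simp add: abs_mult)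
  also have "\<dots> \<le> L2_set (fc f l) {1..Z l} * L2_set (\<lambda>k. Y l k x) {1..Z l}"
    by (rule L2_set_mult_ineq)
  also have "\<dots> = sqrt (real (Z l)) * fnorm f l"
    using sum_Y_squares[OF x, of l] by (simp add: L2_set_def fnorm_def mult.commute)
  finally show ?thesis .
qed

text \<open>The series converges uniformly by \<open>fproj_bound\<close>, and f minus its sum has no
  harmonic coefficients, so completeness applies.\<close>

lemma fourier_series:
  assumes f: "continuous_on (sphere 0 1) f" and summ: "summable (\<lambda>l. sqrt (real (Z l)) * fnorm f l)"
    and x: "x \<in> sphere 0 1"
  shows "(\<lambda>l. fproj f l x) sums f x"
proof -
  define g where "g x = (\<Sum>l. fproj f l x)" for x
  have ser: "continuous_on (sphere 0 1) g" "\<And>x. x \<in> sphere 0 1 \<Longrightarrow> summable (\<lambda>l. fproj f l x)"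
    unfolding g_def by (rule sphere_series[OF fproj_continuous fproj_bound summ]; assumption)+
  have "f x - g x = 0"
  proof (rule harmonics_complete[OF _ _ x])
    show "continuous_on (sphere 0 1) (\<lambda>x. f x - g x)" by (intro continuous_intros f ser(1))
    fix i assume i: "i \<in> J UNIV"
    note ci = Y_continuous[OF i]
    obtain B where B: "B > 0" "\<And>x. x \<in> sphere 0 1 \<Longrightarrow> \<bar>ysph i x\<bar> \<le> B"
      using continuous_sphere_bound[OF ci] by blast
    have "(\<lambda>l. I (\<lambda>x. fproj f l x * ysph i x)) sums I (\<lambda>x. \<Sum>l. fproj f l x * ysph i x)"
    proof (rule sphere_series(3))
      show "\<bar>fproj f l x * ysph i x\<bar> \<le> (sqrt (real (Z l)) * fnorm f l) * B" if "x \<in> sphere 0 1" for l x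
        unfolding abs_mult using fproj_bound[OF that] B(2)[OF that]
        by (intro mult_mono) (auto intro: mult_nonneg_nonneg fnorm_nonneg)
      show "summable (\<lambda>l. (sqrt (real (Z l)) * fnorm f l) * B)" by (intro summable_mult2 summ)
    qed (intro continuous_intros fproj_continuous ci)
    also have "I (\<lambda>x. \<Sum>l. fproj f l x * ysph i x) = I (\<lambda>x. g x * ysph i x)"
      using ser(2) by (intro sphere_integral_cong) (simp add: g_def suminf_mult2)
    also have "(\<lambda>l. I (\<lambda>x. fproj f l x * ysph i x)) = (\<lambda>l. if l = fst i then fc f (fst i) (snd i) else 0)"
    proof
      fix l
      show "I (\<lambda>x. fproj f l x * ysph i x) = (if l = fst i then fc f (fst i) (snd i) else 0)"
        unfolding fproj_eq_J using i by (subst I_sum_Y[OF order_refl _ i]) (auto simp: J_iff)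
    qed
    finally have "I (\<lambda>x. g x * ysph i x) = I (\<lambda>x. f x * ysph i x)"
      using sums_unique2[OF _ sums_single[of "fst i" "\<lambda>_. fc f (fst i) (snd i)"]] by (simp add: fc_def)
    then show "I (\<lambda>x. (f x - g x) * ysph i x) = 0"
      unfolding left_diff_distrib using f ci ser(1)
      by (subst Bochner_Integration.integral_diff) (auto intro!: I_mult_integrable)
  qed
  then show ?thesis using summable_sums[OF ser(2)[OF x]] by (simp add: g_def)
qed

text \<open>Linearity on spherical polynomials with the values on the Y_lk as the only data; in
  particular the functional cannot see such a function off the sphere.\<close>

definition hlin :: "(('a \<Rightarrow> real) \<Rightarrow> real) \<Rightarrow> bool" where
  "hlin \<nu> \<longleftrightarrow> (\<forall>n h. hsum n h \<longrightarrow> \<nu> h = (\<Sum>i\<in>J {..n}. I (\<lambda>x. h x * ysph i x) * \<nu> (ysph i)))"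

lemma Y_hsum: "i \<in> J S \<Longrightarrow> hsum (fst i) (ysph i)"
  using onb by (intro spherical_harmonic_hsum) (auto simp: harmonic_onb_def J_iff)

text \<open>The set collects block b and its two neighbours; the condition is written with additions
  to avoid truncated subtraction at b = 0.\<close>

lemma div_window_subset:
  assumes "0 < (w::nat)" shows "{l. b \<le> l div w + 1 \<and> l div w \<le> b + 1} \<subseteq> {..<(b + 2) * w}"
proof
  fix l assume "l \<in> {l. b \<le> l div w + 1 \<and> l div w \<le> b + 1}"
  then have "l div w < b + 2" by auto
  then show "l \<in> {..<(b + 2) * w}" using div_less_iff_less_mult[OF assms] lessThan_iff by blast
qed

text \<open>
  Multiplication by a harmonic of degree \<open>i\<^sub>0\<close> changes degrees by at most \<open>i\<^sub>0\<close>, so it is block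
  tridiagonal with respect to blocks of \<open>i\<^sub>0 + 1\<close> consecutive degrees, and the Sobolev weight varies
  by a factor of at most a constant times \<open>(i\<^sub>0 + 1)\<^sup>2\<close> between neighbouring blocks.
\<close>

lemma harmonic_multiplier_block:
  assumes \<nu>: "hlin \<nu>" and g: "hsum i\<^sub>0 g" and B: "0 \<le> B" "\<And>x. x \<in> sphere 0 1 \<Longrightarrow> \<bar>g x\<bar> \<le> B"
  defines "w \<equiv> i\<^sub>0 + 1"
  shows "(\<Sum>i\<in>J {l. l div w = b}. (\<nu> (\<lambda>x. g x * ysph i x))\<^sup>2)
    \<le> B\<^sup>2 * (\<Sum>j\<in>J {l. b \<le> l div w + 1 \<and> l div w \<le> b + 1}. (\<nu> (ysph j))\<^sup>2)"
proof -
  let ?L = "{l. l div w = b}" and ?T = "{l. b \<le> l div w + 1 \<and> l div w \<le> b + 1}"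
  have w: "w > 0" by (simp add: w_def)
  have fT: "finite ?T" by (rule finite_subset[OF div_window_subset[OF w]]) simp
  have fL: "finite ?L" by (rule finite_subset[OF _ fT]) auto
  \<comment> \<open>h represents the functional on the window of three blocks, so that the
    functional at g Y_i becomes the i-th coefficient of g h.\<close>
  define h where "h x = (\<Sum>j\<in>J ?T. \<nu> (ysph j) * ysph j x)" for x
  have ch: "continuous_on (sphere 0 1) h" unfolding h_def[abs_def] by (rule continuous_Y_sum[OF order_refl])
  note cg = hsum_continuous[OF g]
  have eq: "\<nu> (\<lambda>x. g x * ysph i x) = I (\<lambda>x. (g x * h x) * ysph i x)" if i: "i \<in> J ?L" for i
  proof -
    let ?c = "\<lambda>j. I (\<lambda>x. (g x * ysph i x) * ysph j x)"
    note hgi = hsum_mult[OF g Y_hsum[OF i]]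
    \<comment> \<open>The coefficient is symmetric in i and j, so the degree bound for g Y_j applies
      too: besides degrees above that of i by more than \<open>i\<^sub>0\<close>, those below it by
      more than \<open>i\<^sub>0\<close> drop out.\<close>
    have z: "?c j = 0" if j: "j \<in> J UNIV" and "fst i > i\<^sub>0 + fst j" for j
    proof -
      have "?c j = I (\<lambda>x. (g x * ysph j x) * ysph i x)" by (simp add: mult_ac)
      also have "\<dots> = 0"
        using that i by (intro hsum_coeff(2)[OF hsum_mult[OF g Y_hsum[OF j]]]) (auto simp: J_iff)
      finally show ?thesis .
    qed
    have "\<nu> (\<lambda>x. g x * ysph i x) = (\<Sum>j\<in>J {..i\<^sub>0 + fst i}. ?c j * \<nu> (ysph j))"
      using \<nu> hgi unfolding hlin_def by blast
    also have "\<dots> = (\<Sum>j\<in>J ({..i\<^sub>0 + fst i} \<inter> ?T). ?c j * \<nu> (ysph j))"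
    proof (rule sum.mono_neutral_right)
      show "\<forall>j\<in>J {..i\<^sub>0 + fst i} - J ({..i\<^sub>0 + fst i} \<inter> ?T). ?c j * \<nu> (ysph j) = 0"
      proof
        fix j assume j: "j \<in> J {..i\<^sub>0 + fst i} - J ({..i\<^sub>0 + fst i} \<inter> ?T)"
        have b: "fst i div w = b" using i by (auto simp: J_iff)
        have jl: "fst j \<le> i\<^sub>0 + fst i" "fst j \<notin> ?T" and jU: "j \<in> J UNIV" using j by (auto simp: J_iff)
        have "fst j div w \<le> (fst i + w) div w" using jl by (intro div_le_mono) (auto simp: w_def)
        then have "fst j div w \<le> b + 1" using w b by simp
        then have "fst j div w + 1 < b" using jl by auto
        then have "(fst j + w) div w < fst i div w" using w b by simp
        then have "fst j + w < fst i" by (meson div_le_mono leD leI)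
        then show "?c j * \<nu> (ysph j) = 0" using z[OF jU] by (simp add: w_def)
      qed
    qed (auto simp: J_iff)
    also have "\<dots> = (\<Sum>j\<in>J ?T. ?c j * \<nu> (ysph j))"
    proof (rule sum.mono_neutral_left)
      show "\<forall>j\<in>J ?T - J ({..i\<^sub>0 + fst i} \<inter> ?T). ?c j * \<nu> (ysph j) = 0"
      proof
        fix j assume j: "j \<in> J ?T - J ({..i\<^sub>0 + fst i} \<inter> ?T)"
        then have "?c j = 0" by (intro hsum_coeff(2)[OF hgi]) (auto simp: J_iff)
        then show "?c j * \<nu> (ysph j) = 0" by simp
      qed
    qed (use fT in \<open>auto simp: J_iff\<close>)
    also have "\<dots> = (\<Sum>j\<in>J ?T. \<nu> (ysph j) * I (\<lambda>x. ysph j x * (g x * ysph i x)))"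
      by (simp add: mult_ac)
    also have "\<dots> = I (\<lambda>x. h x * (g x * ysph i x))"
      unfolding h_def by (rule I_sum_mult[OF order_refl, symmetric]) (intro continuous_intros cg Y_continuous[OF i])
    finally show ?thesis by (simp add: mult_ac)
  qed
  have "(\<Sum>i\<in>J ?L. (\<nu> (\<lambda>x. g x * ysph i x))\<^sup>2) = (\<Sum>i\<in>J ?L. (I (\<lambda>x. (g x * h x) * ysph i x))\<^sup>2)"
    by (intro sum.cong refl) (simp add: eq)
  \<comment> \<open>Bessel's inequality for the single function g h; in L^2 the factor g costs only
    its supremum.\<close>
  also have "\<dots> \<le> I (\<lambda>x. (g x * h x)\<^sup>2)"
    using fL by (intro bessel_inequality[OF order_refl] continuous_intros cg ch) auto
  also have "\<dots> \<le> I (\<lambda>x. B\<^sup>2 * (h x)\<^sup>2)"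
  proof (rule integral_mono)
    fix x :: 'a assume "x \<in> space sphere_measure"
    then have "(g x)\<^sup>2 \<le> B\<^sup>2" using B(2)[of x] B(1) by (intro abs_le_square_iff[THEN iffD1]) auto
    then show "(g x * h x)\<^sup>2 \<le> B\<^sup>2 * (h x)\<^sup>2" unfolding power_mult_distrib by (intro mult_right_mono) auto
  qed (auto intro!: sphere_integrable_continuous continuous_intros cg ch)
  also have "\<dots> = B\<^sup>2 * (\<Sum>j\<in>J ?T. (\<nu> (ysph j))\<^sup>2)"
    using I_sum_square[OF order_refl finite_J[OF fT], of "\<lambda>j. \<nu> (ysph j)"] by (simp add: h_def)
  finally show ?thesis .
qed

end

context sphere_harmonics begin

text \<open>The factor 3 counts the windows that contain a given degree. With w =
  \<open>i\<^sub>0 + 1\<close> the base 8 (1 + d) w^2 arises from ev l <= (1 + d)(1 + l)^2, from 1 +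
  l <= 2 w (1 + b w) on the window of block b, and from ev (b w) >= (1 + b w)^2 / 2.\<close>

lemma harmonic_multiplier:
  assumes \<nu>: "hlin \<nu>" and r: "0 \<le> r"
    and g: "hsum i\<^sub>0 g" and B: "0 \<le> B" "\<And>x. x \<in> sphere 0 1 \<Longrightarrow> \<bar>g x\<bar> \<le> B"
    and summ: "summable (sobolev_term d Z Y (- r) \<nu>)"
  shows "(\<Sum>i\<in>J {..n}. ev (fst i) powr (- r) * (\<nu> (\<lambda>x. g x * ysph i x))\<^sup>2)
    \<le> 3 * (8 * (1 + real d) * (1 + real i\<^sub>0)\<^sup>2) powr r * B\<^sup>2 * (\<Sum>l. sobolev_term d Z Y (- r) \<nu> l)"
proof -
  define w where "w = i\<^sub>0 + 1"
  define t where "t = sobolev_term d Z Y (- r) \<nu>"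
  define T where "T l = ev l powr (- r) * (\<Sum>k=1..Z l. (\<nu> (\<lambda>x. g x * Y l k x))\<^sup>2)" for l
  define \<kappa> where "\<kappa> = (8 * (1 + real d) * (1 + real i\<^sub>0)\<^sup>2) powr r"
  let ?L = "\<lambda>b. {l. l div w = b}" and ?T = "\<lambda>b. {l. b \<le> l div w + 1 \<and> l div w \<le> b + 1}"
  have w: "w > 0" by (simp add: w_def)
  have fT: "finite (?T b)" for b by (rule finite_subset[OF div_window_subset[OF w]]) simp
  have fL: "finite (?L b)" for b by (rule finite_subset[OF _ fT[of b]]) auto
  have T0: "0 \<le> T l" for l unfolding T_def by (intro mult_nonneg_nonneg sum_nonneg) auto
  have t0: "0 \<le> t l" for l unfolding t_def sobolev_term_def by (intro mult_nonneg_nonneg sum_nonneg) auto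
  have block: "(\<Sum>l\<in>?L b. T l) \<le> \<kappa> * B\<^sup>2 * (\<Sum>l\<in>?T b. t l)" for b
  proof -
    \<comment> \<open>The weight at the lowest degree of block b, the largest one in the block
      because the exponent -r is not positive.\<close>
    let ?W = "ev (b * w) powr (- r)"
    have W1: "ev l powr (- r) \<le> ?W" if "l \<in> ?L b" for l
      using that r ev_bounds(3)[of "b * w"] by (intro powr_mono2' ev_mono) auto
    have W2: "?W \<le> \<kappa> * ev l powr (- r)" if "l \<in> ?T b" for l
    proof -
      have "l < (b + 2) * w" using div_window_subset[OF w, of b] that by blast
      then have "l + 1 \<le> (b + 2) * w" by simp
      then have "1 + real l \<le> real ((b + 2) * w)" by (metis of_nat_1 of_nat_add of_nat_le_iff add.commute)
      also have "\<dots> \<le> 2 * real w * (1 + real (b * w))"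
      proof -
        have "b * w \<le> 2 * w * (b * w)" using w by simp
        then have "(b + 2) * w \<le> 2 * w * (1 + b * w)" by (simp add: algebra_simps)
        then have "real ((b + 2) * w) \<le> real (2 * w * (1 + b * w))" by (simp only: of_nat_le_iff)
        also have "\<dots> = 2 * real w * (1 + real (b * w))" by (simp add: algebra_simps)
        finally show ?thesis .
      qed
      finally have le: "1 + real l \<le> 2 * real w * (1 + real (b * w))" .
      have "ev l \<le> (1 + real d) * (1 + real l)\<^sup>2" by (rule ev_bounds)
      also have "\<dots> \<le> (1 + real d) * (2 * real w * (1 + real (b * w)))\<^sup>2"
        by (intro mult_left_mono power_mono le) auto
      also have "\<dots> = 8 * (1 + real d) * (real w)\<^sup>2 * ((1 + real (b * w))\<^sup>2 / 2)"
        by (simp add: power_mult_distrib)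
      also have "\<dots> \<le> 8 * (1 + real d) * (real w)\<^sup>2 * ev (b * w)"
        by (intro mult_left_mono ev_bounds) auto
      finally have "ev l powr r \<le> (8 * (1 + real d) * (real w)\<^sup>2 * ev (b * w)) powr r"
        using r ev_bounds(3)[of l] by (intro powr_mono2) auto
      also have "\<dots> = \<kappa> * ev (b * w) powr r"
        unfolding \<kappa>_def using ev_bounds(3)[of "b * w"] by (subst powr_mult) (auto simp: w_def add.commute)
      finally show ?thesis
        using ev_bounds(3)[of l] ev_bounds(3)[of "b * w"] by (simp add: powr_minus field_simps)
    qed
    have "(\<Sum>l\<in>?L b. T l) \<le> (\<Sum>l\<in>?L b. ?W * (\<Sum>k=1..Z l. (\<nu> (\<lambda>x. g x * Y l k x))\<^sup>2))"
      unfolding T_def using W1 by (intro sum_mono mult_right_mono sum_nonneg) auto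
    also have "\<dots> = ?W * (\<Sum>i\<in>J (?L b). (\<nu> (\<lambda>x. g x * ysph i x))\<^sup>2)"
      by (simp only: sum_J[OF fL] sum_distrib_left fst_conv snd_conv)
    also have "\<dots> \<le> ?W * (B\<^sup>2 * (\<Sum>j\<in>J (?T b). (\<nu> (ysph j))\<^sup>2))"
      using harmonic_multiplier_block[OF \<nu> g B, of b] by (intro mult_left_mono) (auto simp: w_def)
    also have "\<dots> = (\<Sum>l\<in>?T b. ?W * (B\<^sup>2 * (\<Sum>k=1..Z l. (\<nu> (Y l k))\<^sup>2)))"
      by (simp only: sum_J[OF fT] sum_distrib_left fst_conv snd_conv)
    also have "\<dots> \<le> (\<Sum>l\<in>?T b. (\<kappa> * ev l powr (- r)) * (B\<^sup>2 * (\<Sum>k=1..Z l. (\<nu> (Y l k))\<^sup>2)))"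
      using W2 by (intro sum_mono mult_right_mono mult_nonneg_nonneg sum_nonneg) auto
    also have "\<dots> = \<kappa> * B\<^sup>2 * (\<Sum>l\<in>?T b. t l)"
      by (simp add: t_def sobolev_term_def sum_distrib_left mult_ac)
    finally show ?thesis .
  qed
  have "(\<Sum>i\<in>J {..n}. ev (fst i) powr (- r) * (\<nu> (\<lambda>x. g x * ysph i x))\<^sup>2) = (\<Sum>l\<le>n. T l)"
    by (simp add: sum_J T_def sum_distrib_left)
  also have "\<dots> = (\<Sum>b\<le>n. \<Sum>l\<in>{l\<in>{..n}. l div w = b}. T l)"
    by (rule sum.group[symmetric]) (auto intro: order_trans[OF div_le_dividend])
  also have "\<dots> \<le> (\<Sum>b\<le>n. \<Sum>l\<in>?L b. T l)"
    using fL T0 by (intro sum_mono sum_mono2) auto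
  also have "\<dots> \<le> (\<Sum>b\<le>n. \<kappa> * B\<^sup>2 * (\<Sum>l\<in>?T b. t l))"
    by (intro sum_mono block)
  also have "\<dots> = \<kappa> * B\<^sup>2 * (\<Sum>b\<le>n. \<Sum>l\<in>?T b. t l)" by (simp add: sum_distrib_left)
  also have "\<dots> \<le> \<kappa> * B\<^sup>2 * (3 * suminf t)"
  proof (intro mult_left_mono)
    let ?m = "(n + 2) * w"
    have "(\<Sum>b\<le>n. \<Sum>l\<in>?T b. t l) = (\<Sum>b\<le>n. \<Sum>l<?m. if l \<in> ?T b then t l else 0)"
    proof (rule sum.cong)
      fix b assume "b \<in> {..n}"
      have "{..<(b + 2) * w} \<subseteq> {..<?m}" using \<open>b \<in> {..n}\<close> by simp
      with div_window_subset[OF w, of b] have "?T b \<subseteq> {..<?m}" by (rule subset_trans)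
      then show "(\<Sum>l\<in>?T b. t l) = (\<Sum>l<?m. if l \<in> ?T b then t l else 0)"
        by (intro sum.mono_neutral_cong_left) auto
    qed simp
    also have "\<dots> = (\<Sum>l<?m. \<Sum>b\<le>n. if l \<in> ?T b then t l else 0)" by (rule sum.swap)
    also have "\<dots> \<le> (\<Sum>l<?m. 3 * t l)"
    proof (rule sum_mono)
      fix l
      have "(\<Sum>b\<le>n. if l \<in> ?T b then t l else 0) = (\<Sum>b\<in>{b\<in>{..n}. l \<in> ?T b}. t l)"
        by (rule sum.inter_filter[symmetric]) simp
      also have "\<dots> = real (card {b\<in>{..n}. l \<in> ?T b}) * t l" by simp
      also have "\<dots> \<le> real 3 * t l"
      proof (intro mult_right_mono t0 of_nat_mono)
        \<comment> \<open>A degree lies in the windows of its own block and of the two neighbours;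
          truncation at block 0 only merges two of the three.\<close>
        have "card {b\<in>{..n}. l \<in> ?T b} \<le> card {l div w - 1, l div w, l div w + 1}"
          by (intro card_mono) auto
        also have "\<dots> \<le> 3" by (simp add: card_insert_if)
        finally show "card {b\<in>{..n}. l \<in> ?T b} \<le> 3" .
      qed
      finally show "(\<Sum>b\<le>n. if l \<in> ?T b then t l else 0) \<le> 3 * t l" by simp
    qed
    also have "\<dots> = 3 * (\<Sum>l<?m. t l)" by (simp add: sum_distrib_left)
    also have "\<dots> \<le> 3 * suminf t"
      using summ t0 by (intro mult_left_mono sum_le_suminf) (auto simp: t_def)
    finally show "(\<Sum>b\<le>n. \<Sum>l\<in>?T b. t l) \<le> 3 * suminf t" .
  qed (auto simp: \<kappa>_def)
  finally show ?thesis by (simp add: \<kappa>_def t_def mult_ac)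
qed

text \<open>The functional commutes with series that satisfy the Weierstrass M-test. This is how it
  reaches products with f, which need not be smooth.\<close>

definition series_cont :: "(('a \<Rightarrow> real) \<Rightarrow> real) \<Rightarrow> bool" where
  "series_cont \<nu> \<longleftrightarrow> (\<forall>u f M. (\<forall>l. continuous_on (sphere 0 1) (u l)) \<longrightarrow>
     (\<forall>l. \<forall>x\<in>sphere 0 1. \<bar>u l x\<bar> \<le> M l) \<longrightarrow> summable M \<longrightarrow>
     (\<forall>x\<in>sphere 0 1. (\<lambda>l. u l x) sums f x) \<longrightarrow> (\<lambda>l. \<nu> (u l)) sums \<nu> f)"

lemma L2_set_sum_le:
  "L2_set (\<lambda>i. \<Sum>l<(k::nat). c l i) A \<le> (\<Sum>l<k. L2_set (c l) A)"
proof (induction k)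
  case (Suc k)
  have "L2_set (\<lambda>i. \<Sum>l<Suc k. c l i) A \<le> L2_set (\<lambda>i. \<Sum>l<k. c l i) A + L2_set (c k) A"
    using L2_set_triangle_ineq[of "\<lambda>i. \<Sum>l<k. c l i" "c k" A] by simp
  with Suc show ?case by simp
qed (simp add: L2_set_def)

text \<open>The constant of \<open>harmonic_multiplier\<close> times that of
  \<open>weighted_cauchy_schwarz\<close>. The power (1 + l)^(2r) inside the series is the dependence
  of the multiplier norm on the degree of the component.\<close>

definition mult_const :: "real \<Rightarrow> real \<Rightarrow> real" where
  "mult_const r s = 3 * (8 * (1 + real d)) powr r *
     (\<Sum>l. (1 + real l) powr (2 * r) * ev l powr (- s) * real (Z l))"

text \<open>The bounds for the harmonic components of \<open>f\<close> are summed by Minkowski's inequality.\<close>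

lemma multiplication_bound:
  assumes \<nu>: "hlin \<nu>" "series_cont \<nu>" and rs: "0 \<le> r" "s > real d / 2 + r"
    and summ: "summable (sobolev_term d Z Y (- r) \<nu>)"
    and f: "continuous_on (sphere 0 1) f" and fs: "summable (\<lambda>l. ev l powr s * (fnorm f l)\<^sup>2)"
  shows "(\<Sum>i\<in>J {..n}. ev (fst i) powr (- r) * (\<nu> (\<lambda>x. f x * ysph i x))\<^sup>2)
    \<le> mult_const r s * (\<Sum>l. sobolev_term d Z Y (- r) \<nu> l) * (\<Sum>l. ev l powr s * (fnorm f l)\<^sup>2)"
proof -
  let ?N = "\<Sum>l. sobolev_term d Z Y (- r) \<nu> l" and ?Ns = "\<Sum>l. ev l powr s * (fnorm f l)\<^sup>2"
  have N0: "?N \<ge> 0"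
    by (rule suminf_nonneg[OF summ]) (auto simp: sobolev_term_def intro!: mult_nonneg_nonneg sum_nonneg)
  define m where "m l = (1 + real l) powr r * sqrt (real (Z l)) * fnorm f l" for l
  \<comment> \<open>Two uses of the weighted Cauchy-Schwarz inequality: \<rho> = r for the sum of
    multiplier norms, \<rho> = 0 for uniform convergence of the expansion of f.\<close>
  have s0: "0 \<le> s" "s - r > real d / 2" "s - 0 > real d / 2"
    using rs by (auto intro: order_trans[of _ "real d / 2 + r"])
  note m = weighted_cauchy_schwarz[OF s0(1,2) fnorm_nonneg fs, folded m_def]
  have m0: "m l \<ge> 0" for l by (simp add: m_def fnorm_nonneg)
  have sf: "summable (\<lambda>l. sqrt (real (Z l)) * fnorm f l)"
    using weighted_cauchy_schwarz(1)[OF s0(1,3) fnorm_nonneg fs] by simp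
  define A where "A = sqrt (3 * (8 * (1 + real d)) powr r * ?N)"
  have A0: "A \<ge> 0" using N0 by (simp add: A_def)
  \<comment> \<open>Weighted so that the l2 norm of c l is the truncated H^(-r) norm of the
    functional multiplied by the l-th component of f.\<close>
  define c where "c l i = ev (fst i) powr (- r / 2) * \<nu> (\<lambda>x. fproj f l x * ysph i x)" for l i
  have sq: "(ev l powr (- r / 2))\<^sup>2 = ev l powr (- r)" for l
    by (simp add: power2_eq_square flip: powr_add)
  have cl: "L2_set (c l) (J {..n}) \<le> A * m l" for l
  proof -
    have "(\<Sum>i\<in>J {..n}. (c l i)\<^sup>2) \<le> 3 * (8 * (1 + real d) * (1 + real l)\<^sup>2) powr r
        * (sqrt (real (Z l)) * fnorm f l)\<^sup>2 * ?N"
      unfolding c_def power_mult_distrib[of "_ powr _"] sq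
      by (rule harmonic_multiplier[OF \<nu>(1) rs(1) fproj_hsum _ fproj_bound summ])
         (auto simp: fnorm_nonneg)
    also have "(8 * (1 + real d) * (1 + real l)\<^sup>2) powr r = (8 * (1 + real d)) powr r * ((1 + real l) powr r)\<^sup>2"
    proof -
      have "((1 + real l)\<^sup>2) powr r = ((1 + real l) powr r)\<^sup>2"
        by (simp add: power2_eq_square powr_mult)
      then show ?thesis by (simp add: powr_mult)
    qed
    also have "3 * ((8 * (1 + real d)) powr r * ((1 + real l) powr r)\<^sup>2) * (sqrt (real (Z l)) * fnorm f l)\<^sup>2 * ?N
        = (3 * (8 * (1 + real d)) powr r * ?N) * (m l)\<^sup>2"
      by (simp add: m_def power_mult_distrib mult_ac)
    finally have "L2_set (c l) (J {..n}) \<le> sqrt ((3 * (8 * (1 + real d)) powr r * ?N) * (m l)\<^sup>2)"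
      unfolding L2_set_def by (rule real_sqrt_le_mono)
    then show ?thesis using m0[of l] by (simp add: real_sqrt_mult A_def)
  qed
  \<comment> \<open>Truncating the expansion of f at k as well keeps Minkowski's inequality finite;
    the bound does not depend on k.\<close>
  have part: "(\<Sum>i\<in>J {..n}. (\<Sum>l<k. c l i)\<^sup>2) \<le> (A * suminf m)\<^sup>2" for k
  proof -
    have "L2_set (\<lambda>i. \<Sum>l<k. c l i) (J {..n}) \<le> (\<Sum>l<k. A * m l)"
      by (rule order_trans[OF L2_set_sum_le sum_mono[OF cl]])
    also have "\<dots> \<le> A * suminf m"
      unfolding sum_distrib_left[symmetric] using m0 m(1) A0 by (intro mult_left_mono sum_le_suminf) auto
    finally have "(L2_set (\<lambda>i. \<Sum>l<k. c l i) (J {..n}))\<^sup>2 \<le> (A * suminf m)\<^sup>2"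
      by (intro power_mono L2_set_nonneg)
    then show ?thesis by (simp add: L2_set_def sum_nonneg)
  qed
  \<comment> \<open>For a fixed index i the product with Y_i is dominated termwise by the bound for
    the components times a bound for Y_i, so \<open>series_cont\<close> applies.\<close>
  have lim: "(\<lambda>k. \<Sum>l<k. c l i) \<longlonglongrightarrow> ev (fst i) powr (- r / 2) * \<nu> (\<lambda>x. f x * ysph i x)"
    if i: "i \<in> J {..n}" for i
  proof -
    note ci = Y_continuous[OF i]
    obtain B where B: "B > 0" "\<And>x. x \<in> sphere 0 1 \<Longrightarrow> \<bar>ysph i x\<bar> \<le> B"
      using continuous_sphere_bound[OF ci] by blast
    have "(\<lambda>l. \<nu> (\<lambda>x. fproj f l x * ysph i x)) sums \<nu> (\<lambda>x. f x * ysph i x)"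
    proof (rule \<nu>(2)[unfolded series_cont_def, rule_format])
      show "summable (\<lambda>l. (sqrt (real (Z l)) * fnorm f l) * B)" by (intro summable_mult2 sf)
      fix x :: 'a assume x: "x \<in> sphere 0 1"
      show "\<bar>fproj f l x * ysph i x\<bar> \<le> (sqrt (real (Z l)) * fnorm f l) * B" for l
        unfolding abs_mult using fproj_bound[OF x] B(2)[OF x]
        by (intro mult_mono) (auto intro: mult_nonneg_nonneg fnorm_nonneg)
      show "(\<lambda>l. fproj f l x * ysph i x) sums (f x * ysph i x)"
        by (intro sums_mult2 fourier_series[OF f sf x])
    qed (intro continuous_intros fproj_continuous ci)
    then have "(\<lambda>l. c l i) sums (ev (fst i) powr (- r / 2) * \<nu> (\<lambda>x. f x * ysph i x))"
      unfolding c_def by (rule sums_mult)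
    then show ?thesis by (simp add: sums_def)
  qed
  have "(\<lambda>k. \<Sum>i\<in>J {..n}. (\<Sum>l<k. c l i)\<^sup>2)
      \<longlonglongrightarrow> (\<Sum>i\<in>J {..n}. (ev (fst i) powr (- r / 2) * \<nu> (\<lambda>x. f x * ysph i x))\<^sup>2)"
    by (intro tendsto_sum tendsto_power lim)
  then have "(\<Sum>i\<in>J {..n}. (ev (fst i) powr (- r / 2) * \<nu> (\<lambda>x. f x * ysph i x))\<^sup>2) \<le> (A * suminf m)\<^sup>2"
    by (rule LIMSEQ_le_const2) (use part in auto)
  also have "\<dots> = 3 * (8 * (1 + real d)) powr r * ?N * (suminf m)\<^sup>2"
    using N0 by (simp add: power_mult_distrib A_def)
  also have "\<dots> \<le> 3 * (8 * (1 + real d)) powr r * ?N *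
      ((\<Sum>l. (1 + real l) powr (2 * r) * ev l powr (- s) * real (Z l)) * ?Ns)"
    using N0 by (intro mult_left_mono m(2)) auto
  also have "\<dots> = mult_const r s * ?N * ?Ns" by (simp add: mult_const_def mult_ac)
  finally show ?thesis unfolding power_mult_distrib sq .
qed

lemma mult_const_nonneg:
  assumes "0 \<le> r" "s > real d / 2 + r" shows "0 \<le> mult_const r s"
  unfolding mult_const_def using assms
  by (intro mult_nonneg_nonneg suminf_nonneg Z_weighted_summable) (auto intro: order_trans[of _ "real d / 2 + r"])

end

section \<open>Caps and separated points\<close>

lemma sphere_dist_eq_geodist:
  fixes x y :: "'a::euclidean_space"
  assumes "x \<in> sphere 0 1" "y \<in> sphere 0 1"
  shows "0 \<le> geodist x y" "geodist x y \<le> pi" "norm (x - y) = 2 * sin (geodist x y / 2)"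
proof -
  have b: "\<bar>x \<bullet> y\<bar> \<le> 1" using Cauchy_Schwarz_ineq2[of x y] assms by simp
  then show g: "0 \<le> geodist x y" "geodist x y \<le> pi"
    unfolding geodist_def by (auto intro: arccos_lbound arccos_ubound)
  have "(norm (x - y))\<^sup>2 = 2 - 2 * (x \<bullet> y)"
  proof -
    have "x \<bullet> x = 1" "y \<bullet> y = 1" using assms by (simp_all add: dot_square_norm)
    then show ?thesis
      by (simp add: power2_norm_eq_inner inner_diff_left inner_diff_right inner_commute[of y x])
  qed
  also have "x \<bullet> y = cos (2 * (geodist x y / 2))" using b by (simp add: geodist_def)
  also have "2 - 2 * cos (2 * (geodist x y / 2)) = (2 * sin (geodist x y / 2))\<^sup>2"
    by (subst cos_double_sin) (simp add: power_mult_distrib)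
  finally show "norm (x - y) = 2 * sin (geodist x y / 2)"
  proof (rule power2_eq_imp_eq)
    have "0 \<le> sin (geodist x y / 2)" using g by (intro sin_ge_zero) auto
    then show "0 \<le> 2 * sin (geodist x y / 2)" by simp
  qed simp
qed

text \<open>A crude form of Jordan's inequality: the cosine is at least 1/2 up to pi/3, and beyond
  that point sin u >= 1/2 > pi/8 >= u/4. The quarter reappears as the ratio between chords and
  arcs.\<close>

lemma sin_ge_quarter:
  fixes u :: real
  assumes "0 \<le> u" "u \<le> pi / 2" shows "u / 4 \<le> sin u"
proof (cases "u \<le> pi / 3")
  case True
  show ?thesis
  proof (cases "u = 0")
    case False
    then have "0 < u" using assms by simp
    from MVT2[OF this, of sin cos] obtain z where z: "0 < z" "z < u" "sin u - sin 0 = (u - 0) * cos z"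
      by auto
    have "1 / 2 \<le> cos z"
      using z True cos_monotone_0_pi_le[of z "pi / 3"] by (auto simp: cos_60)
    then have "u * (1 / 2) \<le> u * cos z" using assms by (intro mult_left_mono)
    then show ?thesis using z assms by simp
  qed simp
next
  case False
  have "1 / 2 = sin (pi / 6)" by (simp add: sin_30)
  also have "\<dots> \<le> sin u" using False assms by (intro sin_monotone_2pi_le) auto
  finally show ?thesis using assms pi_less_4 by simp
qed

lemma norm_le_geodist:
  fixes x y :: "'a::euclidean_space"
  assumes "x \<in> sphere 0 1" "y \<in> sphere 0 1"
  shows "norm (x - y) \<le> geodist x y" "geodist x y / 4 \<le> norm (x - y)"
  using sphere_dist_eq_geodist[OF assms] sin_x_le_x[of "geodist x y / 2"] sin_ge_quarter[of "geodist x y / 2"]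
  by auto

text \<open>The solid cone over a cap measured by chords. Points of the sphere are counted through
  Lebesgue measures of such cones, and deleting the origin keeps cones over disjoint caps
  disjoint.\<close>

definition ocone :: "'a::euclidean_space \<Rightarrow> real \<Rightarrow> 'a set" where
  "ocone x t = {u \<in> cball 0 1 - {0}. norm (sgn u - x) < t}"

lemma ocone_lmeasurable: "ocone x t \<in> sets borel" "emeasure lborel (ocone x t) < \<infinity>"
proof -
  have "ocone x t = (cball 0 1 - {0}) \<inter> sgn -` ball x t"
    by (auto simp: ocone_def dist_norm norm_minus_commute)
  moreover have "sgn -` ball x t \<in> sets borel"
    using measurable_sets[OF borel_measurable_sgn_euclidean, of "ball x t"] by simp
  ultimately show m: "ocone x t \<in> sets borel" by auto
  have "emeasure lborel (ocone x t) \<le> emeasure lborel (cball (0::'a) 1)"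
    by (intro emeasure_mono) (auto simp: ocone_def)
  also have "\<dots> < \<infinity>" using emeasure_cball_pos(2) by (simp add: less_top)
  finally show "emeasure lborel (ocone x t) < \<infinity>" .
qed

lemma measure_ball_DIM:
  "0 \<le> r \<Longrightarrow> measure lborel (ball (c::'a::euclidean_space) r) = unit_ball_vol (real DIM('a)) * r ^ DIM('a)"
  "0 \<le> r \<Longrightarrow> measure lborel (cball (c::'a::euclidean_space) r) = unit_ball_vol (real DIM('a)) * r ^ DIM('a)"
  by (simp_all add: content_ball content_cball)

text \<open>The cone over a cap of radius \<open>t\<close> is covered by about \<open>1/t\<close> balls of radius \<open>2t\<close> along its axis.\<close>

lemma measure_ocone_le:
  fixes x :: "'a::euclidean_space"
  assumes D: "DIM('a) = d + 1" and x: "norm x = 1" and t: "0 < t"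
  shows "measure lborel (ocone x t) \<le> unit_ball_vol (real DIM('a)) * 2 ^ (d + 2) * t ^ d"
proof -
  let ?V = "unit_ball_vol (real DIM('a))"
  have V: "?V > 0" by (simp add: unit_ball_vol_pos)
  show ?thesis
  proof (cases "t \<ge> 1")
    case True
    have "measure lborel (ocone x t) \<le> measure lborel (cball (0::'a) 1)"
      using emeasure_cball_pos(2)[where 'a='a] ocone_lmeasurable[of x t]
      by (intro measure_mono_fmeasurable) (auto simp: ocone_def fmeasurable_def less_top)
    also have "\<dots> = ?V * 1" by (simp add: measure_ball_DIM)
    also have "\<dots> \<le> ?V * (2 ^ (d + 2) * t ^ d)"
    proof (intro mult_left_mono)
      have "1 * 1 \<le> 2 ^ (d + 2) * t ^ d" using True by (intro mult_mono one_le_power) auto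
      then show "1 \<le> 2 ^ (d + 2) * t ^ d" by simp
    qed (use V in simp)
    finally show ?thesis by simp
  next
    case False
    \<comment> \<open>Centres at the multiples of t along the axis. A point u of the cone is within
      t of the axis point with norm |u|, and that one is within t of a centre, whence the radius
      2t.\<close>
    define K where "K = nat \<lfloor>1 / t\<rfloor>"
    have K: "real K \<le> 1 / t" using t by (simp add: K_def)
    let ?B = "\<lambda>k. cball ((real k * t) *\<^sub>R x) (2 * t)"
    have "ocone x t \<subseteq> (\<Union>k\<le>K. ?B k)"
    proof
      fix u assume u: "u \<in> ocone x t"
      let ?\<rho> = "norm u"
      have u0: "0 < ?\<rho>" "?\<rho> \<le> 1" "norm (sgn u - x) < t" using u by (auto simp: ocone_def)
      define k where "k = nat \<lfloor>?\<rho> / t\<rfloor>"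
      have k: "real k \<le> ?\<rho> / t" "?\<rho> / t < real k + 1" using t by (simp_all add: k_def)
      have "norm (u - ?\<rho> *\<^sub>R x) = ?\<rho> * norm (sgn u - x)"
      proof -
        have "u - ?\<rho> *\<^sub>R x = ?\<rho> *\<^sub>R (sgn u - x)" using u0 by (simp add: sgn_div_norm scaleR_diff_right)
        then show ?thesis by simp
      qed
      also have "\<dots> \<le> 1 * t" using u0 by (intro mult_mono) auto
      finally have 1: "norm (u - ?\<rho> *\<^sub>R x) \<le> t" by simp
      have "norm (?\<rho> *\<^sub>R x - (real k * t) *\<^sub>R x) = \<bar>?\<rho> - real k * t\<bar>"
        using x by (simp flip: scaleR_diff_left)
      also have "\<dots> \<le> t" using k t by (simp add: field_simps abs_le_iff)
      finally have "norm (u - (real k * t) *\<^sub>R x) \<le> 2 * t"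
        using 1 norm_triangle_ineq[of "u - ?\<rho> *\<^sub>R x" "?\<rho> *\<^sub>R x - (real k * t) *\<^sub>R x"] by simp
      moreover have "k \<le> K" unfolding k_def K_def using u0 t
        by (intro nat_mono floor_mono divide_right_mono) auto
      ultimately show "u \<in> (\<Union>k\<le>K. ?B k)" by (auto simp: dist_norm norm_minus_commute)
    qed
    then have "measure lborel (ocone x t) \<le> measure lborel (\<Union>k\<le>K. ?B k)"
      using ocone_lmeasurable[of x t] by (intro measure_mono_fmeasurable) (auto intro!: fmeasurable.finite_UN fmeasurableI emeasure_bounded_finite)
    also have "\<dots> \<le> (\<Sum>k\<le>K. measure lborel (?B k))"
      by (intro measure_UNION_le) auto
    also have "\<dots> = (real K + 1) * (?V * (2 * t) ^ (d + 1))"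
      using t D by (simp add: measure_ball_DIM)
    also have "\<dots> \<le> (2 / t) * (?V * (2 * t) ^ (d + 1))"
    proof (rule mult_right_mono)
      have "1 \<le> 1 / t" using False t by simp
      then show "real K + 1 \<le> 2 / t" using K by linarith
    qed (use t V in simp)
    also have "\<dots> = ?V * 2 ^ (d + 2) * t ^ d" using t by (simp add: power_mult_distrib field_simps)
    finally show ?thesis .
  qed
qed

text \<open>Conversely it contains about \<open>1/t\<close> disjoint balls of radius \<open>t/8\<close> along its axis.\<close>

lemma measure_ocone_ge:
  fixes x :: "'a::euclidean_space"
  assumes D: "DIM('a) = d + 1" and x: "norm x = 1" and t: "0 < t" "t \<le> 1"
  shows "unit_ball_vol (real DIM('a)) / 8 ^ (d + 1) * t ^ d \<le> measure lborel (ocone x t)"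
proof -
  let ?V = "unit_ball_vol (real DIM('a))"
  have V: "?V > 0" by (simp add: unit_ball_vol_pos)
  define K where "K = nat \<lfloor>1 / t\<rfloor>"
  have K: "real K \<le> 1 / t" "1 / t \<le> real K + 1" using t by (simp_all add: K_def less_imp_le)
  \<comment> \<open>Centres between 1/2 and 3/4 on the axis with spacing t/4, twice the radius.
    Keeping the distance 1/2 from the origin limits the angular deviation to (t/8 + t/8) / (1/2) <
    t.\<close>
  define \<rho> where "\<rho> k = 1 / 2 + real k * t / 4" for k
  let ?B = "\<lambda>k. ball (\<rho> k *\<^sub>R x) (t / 8)"
  have sub: "?B k \<subseteq> ocone x t" if "k \<le> K" for k
  proof
    fix u assume "u \<in> ?B k"
    then have u: "norm (u - \<rho> k *\<^sub>R x) < t / 8" by (simp add: dist_norm norm_minus_commute)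
    have "real k \<le> 1 / t" using K that by simp
    then have "real k * t \<le> 1" using t by (simp add: field_simps)
    then have \<rho>: "1 / 2 \<le> \<rho> k" "\<rho> k \<le> 3 / 4" using t by (auto simp: \<rho>_def)
    have nr: "norm (\<rho> k *\<^sub>R x) = \<rho> k" using \<rho> x by simp
    have d1: "\<bar>norm u - \<rho> k\<bar> < t / 8" using norm_triangle_ineq3[of u "\<rho> k *\<^sub>R x"] u nr by simp
    then have nu: "0 < norm u" "norm u \<le> 1" using \<rho> t by linarith+
    have "\<rho> k *\<^sub>R (sgn u - x) = (\<rho> k - norm u) *\<^sub>R sgn u + (u - \<rho> k *\<^sub>R x)"
      using nu by (simp add: algebra_simps sgn_div_norm)
    then have "\<rho> k * norm (sgn u - x) = norm ((\<rho> k - norm u) *\<^sub>R sgn u + (u - \<rho> k *\<^sub>R x))"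
      using \<rho> by (metis abs_of_nonneg norm_scaleR order_trans zero_le_divide_1_iff zero_le_numeral)
    also have "\<dots> \<le> norm ((\<rho> k - norm u) *\<^sub>R sgn u) + norm (u - \<rho> k *\<^sub>R x)" by (rule norm_triangle_ineq)
    also have "norm ((\<rho> k - norm u) *\<^sub>R sgn u) = \<bar>norm u - \<rho> k\<bar>" using nu by (simp add: norm_sgn)
    finally have "\<rho> k * norm (sgn u - x) < t / 4" using d1 u by simp
    moreover have "1 / 2 * norm (sgn u - x) \<le> \<rho> k * norm (sgn u - x)" using \<rho> by (intro mult_right_mono) auto
    ultimately have "norm (sgn u - x) < t" using t by simp
    then show "u \<in> ocone x t" using nu by (auto simp: ocone_def)
  qed
  have disj: "disjoint_family_on ?B {..K}"
    unfolding disjoint_family_on_def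
  proof (intro ballI impI)
    fix i j :: nat assume "i \<noteq> j"
    have "dist (\<rho> i *\<^sub>R x) (\<rho> j *\<^sub>R x) = \<bar>\<rho> i - \<rho> j\<bar>" using x by (simp add: dist_norm flip: scaleR_diff_left)
    also have "\<rho> i - \<rho> j = (real i - real j) * t / 4" by (simp add: \<rho>_def field_simps)
    also have "\<bar>\<dots>\<bar> = \<bar>real i - real j\<bar> * t / 4" using t by (simp add: abs_mult)
    also have "\<dots> \<ge> 1 * t / 4" using \<open>i \<noteq> j\<close> t by (intro divide_right_mono mult_right_mono) auto
    finally have "t / 8 + t / 8 \<le> dist (\<rho> i *\<^sub>R x) (\<rho> j *\<^sub>R x)" by simp
    then show "?B i \<inter> ?B j = {}" by (rule disjoint_ballI)
  qed
  have "?V / 8 ^ (d + 1) * t ^ d = (1 / t) * (?V * (t / 8) ^ (d + 1))"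
    using t by (simp add: power_divide)
  also have "\<dots> \<le> (real K + 1) * (?V * (t / 8) ^ (d + 1))"
    using V t K by (intro mult_right_mono) auto
  also have "\<dots> = (\<Sum>k\<le>K. measure lborel (?B k))" using t D by (simp add: measure_ball_DIM)
  also have "\<dots> = measure lborel (\<Union>k\<le>K. ?B k)"
    using disj by (intro measure_finite_Union[symmetric]) (auto simp: emeasure_ball t less_imp_le ennreal_mult_eq_top_iff)
  also have "\<dots> \<le> measure lborel (ocone x t)"
    using sub ocone_lmeasurable[of x t] by (intro measure_mono_fmeasurable) (auto simp: fmeasurable_def)
  finally show ?thesis .
qed

text \<open>Cones of width t around the points are disjoint and lie in the cone of width R + t
  around x. The constant is the quotient of the constants in the two volume estimates.\<close>

lemma separated_card_le:
  fixes y :: "'i \<Rightarrow> 'a::euclidean_space"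
  assumes D: "DIM('a) = d + 1" and x: "norm x = 1" and t: "0 < t" "t \<le> 1" and "0 < R"
    and A: "finite A" "\<And>i. i \<in> A \<Longrightarrow> norm (y i) = 1" "\<And>i. i \<in> A \<Longrightarrow> norm (x - y i) < R"
    and sep: "\<And>i j. i \<in> A \<Longrightarrow> j \<in> A \<Longrightarrow> i \<noteq> j \<Longrightarrow> 2 * t \<le> norm (y i - y j)"
  shows "real (card A) \<le> 2 ^ (d + 2) * 8 ^ (d + 1) * ((R + t) / t) ^ d"
proof -
  let ?V = "unit_ball_vol (real DIM('a))"
  have V: "?V > 0" by (simp add: unit_ball_vol_pos)
  have disj: "disjoint_family_on (\<lambda>i. ocone (y i) t) A"
    unfolding disjoint_family_on_def
  proof (intro ballI impI equals0I)
    fix i j u assume ij: "i \<in> A" "j \<in> A" "i \<noteq> j" and "u \<in> ocone (y i) t \<inter> ocone (y j) t"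
    then have "norm (sgn u - y i) < t" "norm (sgn u - y j) < t" by (auto simp: ocone_def)
    then have "norm (y i - y j) < 2 * t"
      using norm_triangle_ineq4[of "sgn u - y j" "sgn u - y i"] by simp
    then show False using sep[OF ij] by simp
  qed
  have "real (card A) * (?V / 8 ^ (d + 1) * t ^ d) = (\<Sum>i\<in>A. ?V / 8 ^ (d + 1) * t ^ d)" by simp
  also have "\<dots> \<le> (\<Sum>i\<in>A. measure lborel (ocone (y i) t))"
    by (intro sum_mono measure_ocone_ge[OF D A(2) t])
  also have "\<dots> = measure lborel (\<Union>i\<in>A. ocone (y i) t)"
    using disj A(1) ocone_lmeasurable[where 'a='a] by (intro measure_finite_Union[symmetric]) (auto simp: less_top)
  also have "\<dots> \<le> measure lborel (ocone x (R + t))"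
  proof (rule measure_mono_fmeasurable)
    show "(\<Union>i\<in>A. ocone (y i) t) \<subseteq> ocone x (R + t)"
    proof safe
      fix i u assume "i \<in> A" "u \<in> ocone (y i) t"
      then have "norm (sgn u - y i) < t" "norm (x - y i) < R" "u \<in> cball 0 1 - {0}"
        using A(3) by (auto simp: ocone_def)
      moreover have "norm (sgn u - x) \<le> norm (sgn u - y i) + norm (x - y i)"
        using norm_triangle_ineq4[of "sgn u - y i" "x - y i"] by simp
      ultimately show "u \<in> ocone x (R + t)" by (auto simp: ocone_def)
    qed
  qed (use A(1) ocone_lmeasurable[where 'a='a] in \<open>auto simp: fmeasurable_def\<close>)
  also have "\<dots> \<le> ?V * 2 ^ (d + 2) * (R + t) ^ d"
    using \<open>0 < R\<close> t by (intro measure_ocone_le[OF D x]) auto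
  finally have "?V * (real (card A) * t ^ d) \<le> ?V * (2 ^ (d + 2) * 8 ^ (d + 1) * (R + t) ^ d)"
    by (simp add: field_simps)
  then have "real (card A) * t ^ d \<le> 2 ^ (d + 2) * 8 ^ (d + 1) * (R + t) ^ d" using V by simp
  then show ?thesis using t by (simp add: power_divide field_simps)
qed

text \<open>Points are grouped by the integer part k of n times their distance to x. A shell is
  counted as part of a full cap, so it holds O((1 + k)^d) points of weight at most (1 + k)^(-L);
  this is summable for L > d + 1.\<close>

lemma separated_sum_le:
  fixes y :: "nat \<Rightarrow> 'a::euclidean_space"
  assumes D: "DIM('a) = d + 1" and x: "norm x = 1" and t: "0 < t" "t \<le> 1"
    and A: "finite A" "\<And>i. i \<in> A \<Longrightarrow> norm (y i) = 1"
    and sep: "\<And>i j. i \<in> A \<Longrightarrow> j \<in> A \<Longrightarrow> i \<noteq> j \<Longrightarrow> 2 * t \<le> norm (y i - y j)"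
    and n: "0 < n" "n * t \<le> \<theta>" and L: "L > real d + 1"
  shows "(\<Sum>i\<in>A. (1 + n * norm (x - y i)) powr (- L)) \<le>
    2 ^ (d + 2) * 8 ^ (d + 1) * (1 + \<theta>) ^ d * (\<Sum>k. (1 + real k) powr (real d - L)) / (n * t) ^ d"
proof -
  define K where "K = (2::real) ^ (d + 2) * 8 ^ (d + 1) * (1 + \<theta>) ^ d / (n * t) ^ d"
  have \<theta>: "0 \<le> \<theta>" using n t by (meson less_imp_le mult_nonneg_nonneg order_trans)
  have K0: "0 \<le> K" unfolding K_def using n t \<theta> by (intro divide_nonneg_nonneg mult_nonneg_nonneg) auto
  have summ: "summable (\<lambda>k. (1 + real k) powr (real d - L))"
  proof -
    have "summable (\<lambda>k. real (Suc k) powr (real d - L))"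
      using L by (subst summable_Suc_iff) (simp add: summable_real_powr_iff)
    then show ?thesis by (simp add: add.commute)
  qed
  define \<kappa> where "\<kappa> i = nat \<lfloor>n * norm (x - y i)\<rfloor>" for i
  have \<kappa>: "real (\<kappa> i) \<le> n * norm (x - y i)" "n * norm (x - y i) < real (\<kappa> i) + 1" for i
    using n by (simp_all add: \<kappa>_def)
  have "finite (\<kappa> ` A)" using A(1) by simp
  then obtain m where m: "\<kappa> ` A \<subseteq> {..<m}" using finite_nat_iff_bounded by blast
  have shell: "(\<Sum>i\<in>{i\<in>A. \<kappa> i = k}. (1 + n * norm (x - y i)) powr (- L)) \<le> K * (1 + real k) powr (real d - L)" for k
  proof -
    let ?A = "{i\<in>A. \<kappa> i = k}" and ?R = "(1 + real k) / n"
    have "real (card ?A) \<le> 2 ^ (d + 2) * 8 ^ (d + 1) * ((?R + t) / t) ^ d"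
    proof (rule separated_card_le[OF D x t])
      show "0 < ?R" using n by simp
      fix i assume "i \<in> ?A"
      then show "norm (x - y i) < ?R" using \<kappa>(2)[of i] n by (simp add: field_simps)
    qed (use A sep in auto)
    also have "\<dots> \<le> 2 ^ (d + 2) * 8 ^ (d + 1) * ((1 + real k) * (1 + \<theta>) / (n * t)) ^ d"
    proof (intro mult_left_mono power_mono)
      \<comment> \<open>With R = (1 + k) / n the quotient (R + t) / t is (1 + k + n t) / (n t), and
        n t <= \<theta> bounds the numerator by (1 + k)(1 + \<theta>).\<close>
      have "n * t \<le> (1 + real k) * \<theta>" using n \<theta> mult_right_mono[of 1 "1 + real k" \<theta>] by simp
      moreover have "(?R + t) * n = 1 + real k + n * t" using n by (simp only: distrib_right) simp
      ultimately have "(?R + t) * n \<le> (1 + real k) * (1 + \<theta>)" by (simp add: distrib_left)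
      then have "(?R + t) * n / (n * t) \<le> (1 + real k) * (1 + \<theta>) / (n * t)"
        using n t by (intro divide_right_mono) auto
      moreover have "(?R + t) * n / (n * t) = (?R + t) / t" using n by simp
      ultimately show "(?R + t) / t \<le> (1 + real k) * (1 + \<theta>) / (n * t)" by (simp only:)
    qed (use n t in auto)
    also have "\<dots> = K * (1 + real k) ^ d" by (simp add: K_def power_mult_distrib power_divide)
    finally have c: "real (card ?A) \<le> K * (1 + real k) ^ d" .
    have "(\<Sum>i\<in>?A. (1 + n * norm (x - y i)) powr (- L)) \<le> (\<Sum>i\<in>?A. (1 + real k) powr (- L))"
    proof (rule sum_mono)
      fix i assume "i \<in> ?A"
      then show "(1 + n * norm (x - y i)) powr (- L) \<le> (1 + real k) powr (- L)"
        using \<kappa>(1)[of i] L by (intro powr_mono2') auto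
    qed
    also have "\<dots> = real (card ?A) * (1 + real k) powr (- L)" by simp
    also have "\<dots> \<le> K * (1 + real k) ^ d * (1 + real k) powr (- L)" using c by (intro mult_right_mono) auto
    also have "\<dots> = K * (1 + real k) powr (real d - L)"
      using power_mult_powr[of "1 + real k" d "- L"] by (simp add: mult.assoc)
    finally show ?thesis .
  qed
  have "(\<Sum>i\<in>A. (1 + n * norm (x - y i)) powr (- L))
      = (\<Sum>k<m. \<Sum>i\<in>{i\<in>A. \<kappa> i = k}. (1 + n * norm (x - y i)) powr (- L))"
    using A(1) m by (intro sum.group[symmetric]) auto
  also have "\<dots> \<le> (\<Sum>k<m. K * (1 + real k) powr (real d - L))" by (intro sum_mono shell)
  also have "\<dots> \<le> K * (\<Sum>k. (1 + real k) powr (real d - L))"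
    unfolding sum_distrib_left[symmetric] using K0 by (intro mult_left_mono sum_le_suminf summ) auto
  finally show ?thesis by (simp add: K_def)
qed

section \<open>Essential suprema of continuous functions\<close>

lemma Linf_norm_continuous_ge:
  fixes f :: "'a::euclidean_space \<Rightarrow> real"
  assumes f: "continuous_on (sphere 0 1) f" and x: "x \<in> sphere 0 1"
  shows "ereal \<bar>f x\<bar> \<le> Linf_norm f"
proof -
  have cf: "continuous_on (sphere 0 1) (\<lambda>x. \<bar>f x\<bar>)" using f by (intro continuous_intros)
  have AE: "AE x in sphere_measure. ereal \<bar>f x\<bar> \<le> Linf_norm f"
    unfolding Linf_norm_def by (rule esssup_AE)
  show ?thesis
  proof (cases "Linf_norm f")
    case (real c)
    then have "AE x in sphere_measure. \<bar>f x\<bar> \<le> c" using AE by simp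
    from sphere_AE_continuous[OF cf this x] show ?thesis by (simp add: real)
  next
    case MInf
    then have "AE x in (sphere_measure :: 'a measure). \<bar>f x\<bar> \<le> - 1" using AE by simp
    from sphere_AE_continuous[OF cf this x] show ?thesis by simp
  qed simp
qed

lemma Linf_norm_le:
  fixes f :: "'a::euclidean_space \<Rightarrow> real"
  assumes "continuous_on (sphere 0 1) f" "\<And>x. x \<in> sphere 0 1 \<Longrightarrow> \<bar>f x\<bar> \<le> c"
  shows "Linf_norm f \<le> ereal c"
  unfolding Linf_norm_def
proof (rule esssup_I)
  show "(\<lambda>x. ereal \<bar>f x\<bar>) \<in> borel_measurable sphere_measure"
    using sphere_measurable_continuous[OF assms(1)] by measurable
  show "AE x in sphere_measure. ereal \<bar>f x\<bar> \<le> ereal c" using assms(2) by (intro AE_I2) auto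
qed

section \<open>The sampling operator\<close>

text \<open>For t <= 1 the left side is at most a t by exp x >= 1 + x, and t <= t^\<kappa> since
  \<kappa> <= 1; this is the saturation of the method. For t > 1 it is at most 1, and the constant 1
  + a covers both cases.\<close>

lemma one_minus_powr_neg_le:
  fixes a t \<kappa> :: real
  assumes a: "0 \<le> a" and t: "0 \<le> t" and \<kappa>: "0 < \<kappa>" "\<kappa> \<le> 1"
  shows "0 \<le> 1 - (1 + t) powr (- a)" "1 - (1 + t) powr (- a) \<le> (1 + a) * t powr \<kappa>"
proof -
  have "(1 + t) powr (- a) \<le> (1 + t) powr 0" using a t powr_mono[of "- a" 0 "1 + t"] by simp
  then show "0 \<le> 1 - (1 + t) powr (- a)" using t by simp
  show "1 - (1 + t) powr (- a) \<le> (1 + a) * t powr \<kappa>"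
  proof (cases "t \<le> 1")
    case True
    have "1 - a * t \<le> 1 + (- a * ln (1 + t))"
      using a t ln_add_one_self_le_self[of t] by (simp add: mult_left_mono)
    also have "\<dots> \<le> exp (- a * ln (1 + t))" by (rule exp_ge_add_one_self)
    also have "\<dots> = (1 + t) powr (- a)" using t by (simp add: powr_def)
    finally have "1 - (1 + t) powr (- a) \<le> a * t" by simp
    also have "\<dots> \<le> (1 + a) * t" using t by (simp add: distrib_right)
    also have "t \<le> t powr \<kappa>"
    proof (cases "t = 0")
      case False
      then show ?thesis using True t \<kappa> powr_mono'[of \<kappa> 1 t] by simp
    qed simp
    finally show ?thesis using a by (simp add: mult_left_mono)
  next
    case False
    have "1 * 1 \<le> (1 + a) * t powr \<kappa>"
      using False a \<kappa> by (intro mult_mono ge_one_powr_ge_zero) auto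
    moreover have "0 \<le> (1 + t) powr (- a)" by simp
    ultimately show ?thesis by linarith
  qed
qed

lemma sphere_smooth_continuous:
  fixes \<phi> :: "'a::euclidean_space \<Rightarrow> real"
  assumes "\<phi> \<in> sphere_smooth" shows "continuous_on (sphere 0 1) \<phi>"
proof -
  have "sphere_deriv [] \<phi> differentiable_on (- {0})"
    using assms unfolding sphere_smooth_def by (auto dest!: spec[of _ "[]"])
  then have "continuous_on (- {0}) (\<lambda>x. \<phi> (sgn x))"
    by (simp add: sphere_deriv_def differentiable_imp_continuous_on)
  then have "continuous_on (sphere 0 1) (\<lambda>x. \<phi> (sgn x))"
    by (rule continuous_on_subset) auto
  then show ?thesis by (subst continuous_on_cong[OF refl, of _ _ "\<lambda>x. \<phi> (sgn x)"]) (auto simp: sgn_div_norm)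
qed

text \<open>Membership in \<open>sobolev\<close> includes being a distribution. Integration against
  an integrable function has order 0, so the supremum norm of the test function suffices.\<close>

lemma sphere_distribution_regular:
  fixes g :: "'a::euclidean_space \<Rightarrow> real"
  assumes g: "integrable sphere_measure g"
  shows "sphere_distribution (regular_distribution g)"
proof -
  have int: "integrable sphere_measure (\<lambda>x. g x * \<phi> x)" if c\<phi>: "continuous_on (sphere 0 1) \<phi>" for \<phi>
  proof -
    obtain B where B: "\<And>x. x \<in> sphere 0 1 \<Longrightarrow> \<bar>\<phi> x\<bar> \<le> B" using continuous_sphere_bound[OF c\<phi>] by blast
    have "integrable sphere_measure (\<lambda>x. g x * B)" using g by simp
    then show ?thesis
    proof (rule Bochner_Integration.integrable_bound)
      show "AE x in sphere_measure. norm (g x * \<phi> x) \<le> norm (g x * B)"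
      proof (rule AE_I2)
        fix x :: 'a assume "x \<in> space sphere_measure"
        then have "\<bar>\<phi> x\<bar> \<le> \<bar>B\<bar>" using B[of x] by simp
        then show "norm (g x * \<phi> x) \<le> norm (g x * B)" by (simp add: abs_mult mult_left_mono)
      qed
    qed (use g sphere_measurable_continuous[OF c\<phi>] in measurable)
  qed
  have "\<bar>regular_distribution g \<phi>\<bar> \<le> (LINT x|sphere_measure. \<bar>g x\<bar>) * sphere_Ck_norm 0 \<phi>"
    if "\<phi> \<in> sphere_smooth" for \<phi>
  proof -
    note c\<phi> = sphere_smooth_continuous[OF that]
    have C0: "sphere_Ck_norm 0 \<phi> = (SUP x\<in>sphere 0 1. \<bar>\<phi> x\<bar>)"
    proof -
      have "{bs :: 'a list. set bs \<subseteq> Basis \<and> length bs \<le> 0} = {[]}" by auto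
      then show ?thesis by (simp add: sphere_Ck_norm_def sphere_deriv_def sgn_div_norm cong: SUP_cong_simp)
    qed
    obtain B where B: "\<And>x. x \<in> sphere 0 1 \<Longrightarrow> \<bar>\<phi> x\<bar> \<le> B" using continuous_sphere_bound[OF c\<phi>] by blast
    have S: "\<bar>\<phi> x\<bar> \<le> sphere_Ck_norm 0 \<phi>" if "x \<in> sphere 0 1" for x
      unfolding C0 using B that by (intro cSUP_upper) (auto intro!: bdd_aboveI2)
    have "\<bar>regular_distribution g \<phi>\<bar> \<le> (LINT x|sphere_measure. \<bar>g x * \<phi> x\<bar>)"
      unfolding regular_distribution_def by (rule integral_abs_bound)
    also have "\<dots> \<le> (LINT x|sphere_measure. \<bar>g x\<bar> * sphere_Ck_norm 0 \<phi>)"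
    proof (rule integral_mono)
      show "integrable sphere_measure (\<lambda>x. \<bar>g x * \<phi> x\<bar>)" using int[OF c\<phi>] by (rule integrable_abs)
      show "integrable sphere_measure (\<lambda>x. \<bar>g x\<bar> * sphere_Ck_norm 0 \<phi>)" using g by simp
      fix x :: 'a assume "x \<in> space sphere_measure"
      then show "\<bar>g x * \<phi> x\<bar> \<le> \<bar>g x\<bar> * sphere_Ck_norm 0 \<phi>" using S by (simp add: abs_mult mult_left_mono)
    qed
    finally show ?thesis by simp
  qed
  moreover have "regular_distribution g (\<lambda>x. a * \<phi> x + b * \<psi> x) = a * regular_distribution g \<phi> + b * regular_distribution g \<psi>"
    if "\<phi> \<in> sphere_smooth" "\<psi> \<in> sphere_smooth" for \<phi> \<psi> a b
  proof -
    have "(\<lambda>x. g x * (a * \<phi> x + b * \<psi> x)) = (\<lambda>x. a * (g x * \<phi> x) + b * (g x * \<psi> x))"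
      by (simp add: fun_eq_iff algebra_simps)
    then show ?thesis
      using that by (simp add: regular_distribution_def int sphere_smooth_continuous)
  qed
  ultimately show ?thesis unfolding sphere_distribution_def by blast
qed

text \<open>Geodesic distances are at most pi, which makes the real-valued \<open>SUP\<close>
  meaningful.\<close>

lemma mesh_norm_nonneg:
  fixes xs :: "nat \<Rightarrow> 'a::euclidean_space"
  assumes xs: "\<And>j. j \<in> {1..m} \<Longrightarrow> xs j \<in> sphere 0 1" and m: "m \<ge> 1"
  shows "0 \<le> mesh_norm m xs"
proof -
  let ?g = "\<lambda>x. Min ((\<lambda>j. geodist x (xs j)) ` {1..m})"
  obtain x :: 'a where x: "x \<in> sphere 0 1" using nonempty_Basis norm_Basis by fastforce
  have "0 \<le> ?g x" using m x sphere_dist_eq_geodist(1)[OF x xs] by (intro Min.boundedI) auto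
  also have "\<dots> \<le> (SUP x\<in>sphere 0 1. ?g x)"
  proof (rule cSUP_upper[OF x])
    show "bdd_above (?g ` sphere 0 1)"
    proof (rule bdd_aboveI2)
      fix y :: 'a assume y: "y \<in> sphere 0 1"
      have "?g y \<le> geodist y (xs 1)" using m by (intro Min_le) auto
      also have "\<dots> \<le> pi" using sphere_dist_eq_geodist(2)[OF y xs] m by simp
      finally show "?g y \<le> pi" .
    qed
  qed
  finally show ?thesis by (simp add: mesh_norm_def)
qed

lemma separation_radius_props:
  fixes xs :: "nat \<Rightarrow> 'a::euclidean_space"
  assumes xs: "\<And>j. j \<in> {1..m} \<Longrightarrow> xs j \<in> sphere 0 1" and m: "m \<ge> 2"
  shows "0 \<le> separation_radius m xs"
    and "i \<in> {1..m} \<Longrightarrow> j \<in> {1..m} \<Longrightarrow> i \<noteq> j \<Longrightarrow> 2 * separation_radius m xs \<le> geodist (xs i) (xs j)"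
proof -
  let ?S = "{geodist (xs i) (xs j) | i j. i \<in> {1..m} \<and> j \<in> {1..m} \<and> i \<noteq> j}"
  have fin: "finite ?S"
    by (rule finite_subset[of _ "(\<lambda>(i, j). geodist (xs i) (xs j)) ` ({1..m} \<times> {1..m})"]) auto
  have "geodist (xs 1) (xs 2) \<in> ?S" using m by force
  then have "Min ?S \<in> ?S" using fin by (intro Min_in) auto
  then obtain a b where "Min ?S = geodist (xs a) (xs b)" "a \<in> {1..m}" "b \<in> {1..m}" by blast
  then show "0 \<le> separation_radius m xs"
    using sphere_dist_eq_geodist(1)[OF xs xs, of a b] by (simp add: separation_radius_def)
  show "2 * separation_radius m xs \<le> geodist (xs i) (xs j)" if "i \<in> {1..m}" "j \<in> {1..m}" "i \<noteq> j"
    using Min_le[OF fin, of "geodist (xs i) (xs j)"] that by (force simp: separation_radius_def)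
qed

section \<open>Coefficients of the sampling operator, the error estimate and stability\<close>

context sphere_harmonics begin

lemma sampling_nu_hlin:
  assumes "\<And>j. j \<in> {1..m} \<Longrightarrow> xs j \<in> sphere 0 1"
  shows "hlin (sampling_nu m xs ws)"
  unfolding hlin_def
proof (intro allI impI)
  fix n h assume h: "hsum n h"
  let ?c = "\<lambda>i. I (\<lambda>x. h x * ysph i x)"
  have "I h = I (\<lambda>x. (\<Sum>i\<in>J {..n}. ?c i * ysph i x) * 1)"
    by (rule sphere_integral_cong) (simp only: mult_1_right hsum_coeff(1)[OF h, symmetric])
  also have "\<dots> = (\<Sum>i\<in>J {..n}. ?c i * I (\<lambda>x. ysph i x * 1))"
    by (rule I_sum_mult[OF order_refl]) auto
  finally have Ih: "I h = (\<Sum>i\<in>J {..n}. ?c i * I (ysph i))" by simp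
  have "(\<Sum>j=1..m. ws j * h (xs j)) = (\<Sum>j=1..m. ws j * (\<Sum>i\<in>J {..n}. ?c i * ysph i (xs j)))"
    using assms by (intro sum.cong refl arg_cong2[of _ _ _ _ "(*)"] hsum_coeff(1)[OF h]) auto
  also have "\<dots> = (\<Sum>j=1..m. \<Sum>i\<in>J {..n}. ?c i * (ws j * ysph i (xs j)))"
    by (simp only: sum_distrib_left mult.left_commute)
  also have "\<dots> = (\<Sum>i\<in>J {..n}. \<Sum>j=1..m. ?c i * (ws j * ysph i (xs j)))" by (rule sum.swap)
  also have "\<dots> = (\<Sum>i\<in>J {..n}. ?c i * (\<Sum>j=1..m. ws j * ysph i (xs j)))"
    by (simp only: sum_distrib_left)
  finally show "sampling_nu m xs ws h = (\<Sum>i\<in>J {..n}. ?c i * sampling_nu m xs ws (ysph i))"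
    unfolding sampling_nu_def Ih by (simp only: right_diff_distrib sum_subtractf)
qed

lemma sampling_nu_series_cont:
  assumes xs: "\<And>j. j \<in> {1..m} \<Longrightarrow> xs j \<in> sphere 0 1"
  shows "series_cont (sampling_nu m xs ws)"
  unfolding series_cont_def
proof (intro allI impI)
  fix u :: "nat \<Rightarrow> 'a \<Rightarrow> real" and f M
  assume u: "\<forall>l. continuous_on (sphere 0 1) (u l)" "\<forall>l. \<forall>x\<in>sphere 0 1. \<bar>u l x\<bar> \<le> M l" "summable M"
    and f: "\<forall>x\<in>sphere 0 1. (\<lambda>l. u l x) sums f x"
  have "(\<lambda>l. I (u l)) sums I (\<lambda>x. \<Sum>l. u l x)"
    by (rule sphere_series(3)[of u M]) (use u in auto)
  also have "I (\<lambda>x. \<Sum>l. u l x) = I f"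
    using f by (intro sphere_integral_cong) (auto simp: sums_iff)
  finally have "(\<lambda>l. I (u l)) sums I f" .
  moreover have "(\<lambda>l. \<Sum>j=1..m. ws j * u l (xs j)) sums (\<Sum>j=1..m. ws j * f (xs j))"
    using xs f by (intro sums_sum sums_mult) auto
  ultimately show "(\<lambda>l. sampling_nu m xs ws (u l)) sums sampling_nu m xs ws f"
    unfolding sampling_nu_def by (intro sums_diff)
qed

abbreviation bw :: "real \<Rightarrow> real \<Rightarrow> nat \<Rightarrow> real" where
  "bw \<beta> n l \<equiv> (1 + eigval d l / n\<^sup>2) powr (- \<beta> / 2)"

text \<open>On the diagonal the addition theorem turns the terms of the kernel into b_l Z(d,l).
  Summability at the one point (y, y) therefore provides a majorant for all x, and integration term
  by term is allowed.\<close>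

lemma bessel_kernel_coeff:
  assumes summ: "\<And>x y. x \<in> sphere 0 1 \<Longrightarrow> y \<in> sphere 0 1 \<Longrightarrow> summable (bessel_term d Z Y \<beta> n x y)"
    and y: "y \<in> sphere 0 1"
  shows "continuous_on (sphere 0 1) (\<lambda>x. bessel_kernel d Z Y \<beta> n x y)"
    and "i \<in> J UNIV \<Longrightarrow> I (\<lambda>x. bessel_kernel d Z Y \<beta> n x y * ysph i x) = bw \<beta> n (fst i) * ysph i y"
proof -
  have eq: "bessel_term d Z Y \<beta> n x y l = (\<Sum>j\<in>J {l}. (bw \<beta> n l * ysph j y) * ysph j x)" for x l
    by (simp add: bessel_term_def sum_J sum_distrib_left sum_distrib_right mult_ac)
  have cont: "continuous_on (sphere 0 1) (\<lambda>x. bessel_term d Z Y \<beta> n x y l)" for l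
    unfolding eq by (rule continuous_Y_sum[OF order_refl])
  have sZ: "summable (\<lambda>l. bw \<beta> n l * real (Z l))"
  proof -
    have "bessel_term d Z Y \<beta> n y y = (\<lambda>l. bw \<beta> n l * real (Z l))"
      using sum_Y_squares[OF y] by (auto simp: bessel_term_def power2_eq_square fun_eq_iff)
    then show ?thesis using summ[OF y y] by simp
  qed
  have le: "\<bar>bessel_term d Z Y \<beta> n x y l\<bar> \<le> bw \<beta> n l * real (Z l)" if x: "x \<in> sphere 0 1" for x l
  proof -
    have "\<bar>\<Sum>k=1..Z l. Y l k x * Y l k y\<bar> \<le> (\<Sum>k=1..Z l. \<bar>Y l k x\<bar> * \<bar>Y l k y\<bar>)"
      by (intro order_trans[OF sum_abs]) (simp add: abs_mult)
    also have "\<dots> \<le> L2_set (\<lambda>k. Y l k x) {1..Z l} * L2_set (\<lambda>k. Y l k y) {1..Z l}"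
      by (rule L2_set_mult_ineq)
    also have "\<dots> = real (Z l)" unfolding L2_set_def sum_Y_squares[OF x] sum_Y_squares[OF y] by simp
    finally show ?thesis unfolding bessel_term_def abs_mult by (simp add: mult_left_mono)
  qed
  show "continuous_on (sphere 0 1) (\<lambda>x. bessel_kernel d Z Y \<beta> n x y)"
    unfolding bessel_kernel_def by (rule sphere_series(1)[OF cont le sZ])
  assume i: "i \<in> J UNIV"
  note ci = Y_continuous[OF i]
  obtain B where B: "B > 0" "\<And>x. x \<in> sphere 0 1 \<Longrightarrow> \<bar>ysph i x\<bar> \<le> B"
    using continuous_sphere_bound[OF ci] by blast
  have "(\<lambda>l. I (\<lambda>x. bessel_term d Z Y \<beta> n x y l * ysph i x)) sums
      I (\<lambda>x. \<Sum>l. bessel_term d Z Y \<beta> n x y l * ysph i x)"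
  proof (rule sphere_series(3))
    show "\<bar>bessel_term d Z Y \<beta> n x y l * ysph i x\<bar> \<le> (bw \<beta> n l * real (Z l)) * B"
      if "x \<in> sphere 0 1" for l x
      unfolding abs_mult using le[OF that] B(2)[OF that] by (intro mult_mono) auto
    show "summable (\<lambda>l. (bw \<beta> n l * real (Z l)) * B)" by (intro summable_mult2 sZ)
  qed (intro continuous_on_mult cont ci)
  also have "I (\<lambda>x. \<Sum>l. bessel_term d Z Y \<beta> n x y l * ysph i x)
      = I (\<lambda>x. bessel_kernel d Z Y \<beta> n x y * ysph i x)"
    using summ[OF _ y] by (intro sphere_integral_cong) (simp add: bessel_kernel_def suminf_mult2)
  also have "(\<lambda>l. I (\<lambda>x. bessel_term d Z Y \<beta> n x y l * ysph i x))
      = (\<lambda>l. if l = fst i then bw \<beta> n (fst i) * ysph i y else 0)"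
  proof
    fix l
    show "I (\<lambda>x. bessel_term d Z Y \<beta> n x y l * ysph i x) = (if l = fst i then bw \<beta> n (fst i) * ysph i y else 0)"
      unfolding eq using i by (subst I_sum_Y[OF order_refl _ i]) (auto simp: J_iff)
  qed
  finally show "I (\<lambda>x. bessel_kernel d Z Y \<beta> n x y * ysph i x) = bw \<beta> n (fst i) * ysph i y"
    using sums_unique2[OF _ sums_single[of "fst i" "\<lambda>_. bw \<beta> n (fst i) * ysph i y"]] by simp
qed

lemma sobolev_term_regular:
  "sobolev_term d Z Y t (regular_distribution g) l = ev l powr t * (fnorm g l)\<^sup>2"
  by (simp add: sobolev_term_def regular_distribution_def fnorm_def fc_def sum_nonneg)

context
  fixes \<beta> n :: real and m :: nat and xs :: "nat \<Rightarrow> 'a" and ws :: "nat \<Rightarrow> real"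
  assumes summ: "\<And>x y. x \<in> sphere 0 1 \<Longrightarrow> y \<in> sphere 0 1 \<Longrightarrow> summable (bessel_term d Z Y \<beta> n x y)"
    and xs: "\<And>j. j \<in> {1..m} \<Longrightarrow> xs j \<in> sphere 0 1"
begin

abbreviation (input) smp :: "('a \<Rightarrow> real) \<Rightarrow> 'a \<Rightarrow> real" where
  "smp \<equiv> sampling_op d Z Y \<beta> m xs ws n"

lemma sampling_op_continuous:
  shows "continuous_on (sphere 0 1) (smp f)"
  unfolding sampling_op_def using summ xs
  by (intro continuous_on_sum continuous_on_mult continuous_on_const bessel_kernel_coeff(1)) auto

lemma sampling_error_coeff:
  assumes f: "continuous_on (sphere 0 1) f" and k: "k \<in> {1..Z l}"
  shows "fc (\<lambda>x. f x - smp f x) l k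
    = (1 - bw \<beta> n l) * fc f l k - bw \<beta> n l * sampling_nu m xs ws (\<lambda>x. f x * Y l k x)"
proof -
  have i: "(l, k) \<in> J UNIV" using k by (simp add: J_iff)
  note cY = Y_continuous[OF i, simplified]
  let ?\<Phi> = "bessel_kernel d Z Y \<beta> n"
  have c\<Phi>: "continuous_on (sphere 0 1) (\<lambda>x. ?\<Phi> x (xs j))" if "j \<in> {1..m}" for j
    using bessel_kernel_coeff(1)[OF summ xs[OF that]] by simp
  have "I (\<lambda>x. smp f x * Y l k x)
      = I (\<lambda>x. \<Sum>j=1..m. ws j * f (xs j) * (?\<Phi> x (xs j) * Y l k x))"
    by (simp only: sampling_op_def sum_distrib_right mult.assoc)
  also have "\<dots> = (\<Sum>j=1..m. I (\<lambda>x. ws j * f (xs j) * (?\<Phi> x (xs j) * Y l k x)))"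
    using c\<Phi> cY by (intro Bochner_Integration.integral_sum integrable_mult_right I_mult_integrable) auto
  also have "\<dots> = (\<Sum>j=1..m. ws j * f (xs j) * (bw \<beta> n l * Y l k (xs j)))"
    using bessel_kernel_coeff(2)[OF summ xs i] by (intro sum.cong) auto
  also have "\<dots> = bw \<beta> n l * (\<Sum>j=1..m. ws j * (f (xs j) * Y l k (xs j)))"
    unfolding sum_distrib_left by (intro sum.cong refl) (simp only: mult_ac)
  also have "(\<Sum>j=1..m. ws j * (f (xs j) * Y l k (xs j))) = sampling_nu m xs ws (\<lambda>x. f x * Y l k x) + fc f l k"
    by (simp add: sampling_nu_def fc_def)
  finally have F: "I (\<lambda>x. smp f x * Y l k x)
    = bw \<beta> n l * (sampling_nu m xs ws (\<lambda>x. f x * Y l k x) + fc f l k)" .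
  have "fc (\<lambda>x. f x - smp f x) l k
      = fc f l k - I (\<lambda>x. smp f x * Y l k x)"
    unfolding fc_def left_diff_distrib
    by (intro Bochner_Integration.integral_diff I_mult_integrable f cY sampling_op_continuous)
  then show ?thesis unfolding F by (simp add: algebra_simps)
qed

text \<open>c stands for \<open>C\<^sub>1\<close> and T for the power of the mesh norm: kept apart,
  they leave a constant that depends on neither the nodes nor n. Summability for the error is a
  conclusion, from bounded partial sums.\<close>

lemma sampling_error:
  assumes n: "n \<ge> 1" and r: "0 \<le> r" and s: "s > real d / 2 + r" and q: "0 \<le> q" "q < s" "s - q \<le> 2"
    and \<beta>: "\<beta> \<ge> r + q"
    and \<nu>: "summable (sobolev_term d Z Y (- r) (sampling_nu m xs ws))"
      "(\<Sum>l. sobolev_term d Z Y (- r) (sampling_nu m xs ws) l) \<le> (c * T)\<^sup>2" and T: "0 \<le> T"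
    and f: "continuous_on (sphere 0 1) f"
    and fs: "summable (sobolev_term d Z Y s (regular_distribution f))"
  defines "e \<equiv> \<lambda>x. f x - smp f x"
  shows "summable (sobolev_term d Z Y q (regular_distribution e))"
    and "sobolev_fun_norm d Z Y q e \<le> sqrt (2 * ((1 + \<beta> / 2)\<^sup>2 + mult_const r s * c\<^sup>2)) *
      (n powr (- (s - q)) + T * n powr (r + q)) * sobolev_fun_norm d Z Y s f"
proof -
  let ?\<nu> = "sampling_nu m xs ws"
  let ?N = "\<Sum>l. sobolev_term d Z Y (- r) ?\<nu> l" and ?Ns = "\<Sum>l. ev l powr s * (fnorm f l)\<^sup>2"
  let ?A = "n powr (- (s - q))" and ?B = "n powr (r + q)" and ?mc = "mult_const r s"
  let ?K = "2 * ((1 + \<beta> / 2)\<^sup>2 + ?mc * c\<^sup>2) * (?A + T * ?B)\<^sup>2 * ?Ns"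
  have fs': "summable (\<lambda>l. ev l powr s * (fnorm f l)\<^sup>2)"
    using fs by (simp add: sobolev_term_regular[abs_def])
  have Ns0: "0 \<le> ?Ns" by (intro suminf_nonneg fs') auto
  have mc0: "0 \<le> ?mc" using r s by (rule mult_const_nonneg)
  have \<beta>0: "0 \<le> \<beta> / 2" using \<beta> r q by simp
  have sq: "(x powr y)\<^sup>2 = x powr (2 * y)" for x y :: real by (simp add: power2_eq_square flip: powr_add)
  have pw: "(E / n\<^sup>2) powr a = E powr a * (n powr (- a))\<^sup>2" if "0 \<le> E" for E a :: real
  proof -
    have "n\<^sup>2 = n powr 2" using n by simp
    then have "(E / n\<^sup>2) powr a = E powr a / (n powr 2) powr a" using that by (simp add: powr_divide del: powr_numeral)
    also have "\<dots> = E powr a * n powr (2 * - a)" by (simp add: powr_powr powr_minus divide_inverse del: powr_numeral)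
    finally show ?thesis by (simp only: sq)
  qed
  have sq2: "(x powr (y / 2))\<^sup>2 = x powr y" for x y :: real by (simp add: sq)
  \<comment> \<open>The approximation part. The exponent \<kappa> = (s - q)/2 is admissible because
    s - q <= 2; enlarging \<lambda>_l to 1 + \<lambda>_l lets the Sobolev weights combine to order
    s.\<close>
  have w1: "ev l powr q * (1 - bw \<beta> n l)\<^sup>2 \<le> (1 + \<beta> / 2)\<^sup>2 * ?A\<^sup>2 * ev l powr s" for l
  proof -
    let ?t = "eigval d l / n\<^sup>2"
    have t: "0 \<le> ?t" using ev_bounds(4)[of l] n by simp
    have "0 \<le> 1 - bw \<beta> n l" "1 - bw \<beta> n l \<le> (1 + \<beta> / 2) * ?t powr ((s - q) / 2)"
      using one_minus_powr_neg_le[OF \<beta>0 t, of "(s - q) / 2"] q by simp_all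
    then have "(1 - bw \<beta> n l)\<^sup>2 \<le> ((1 + \<beta> / 2) * ?t powr ((s - q) / 2))\<^sup>2" by (intro power_mono)
    also have "\<dots> = (1 + \<beta> / 2)\<^sup>2 * ?t powr (s - q)" by (simp only: power_mult_distrib sq2)
    also have "?t powr (s - q) \<le> (ev l / n\<^sup>2) powr (s - q)"
      using t q n by (intro powr_mono2 divide_right_mono) auto
    also have "(ev l / n\<^sup>2) powr (s - q) = ev l powr (s - q) * ?A\<^sup>2"
      using pw[of "ev l"] ev_bounds(3)[of l] by (simp add: add.commute)
    finally have "ev l powr q * (1 - bw \<beta> n l)\<^sup>2 \<le> ev l powr q * ((1 + \<beta> / 2)\<^sup>2 * (ev l powr (s - q) * ?A\<^sup>2))"
      using \<beta>0 by (simp add: mult_left_mono)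
    also have "\<dots> = (1 + \<beta> / 2)\<^sup>2 * ?A\<^sup>2 * (ev l powr q * ev l powr (s - q))" by (simp only: mult_ac)
    also have "ev l powr q * ev l powr (s - q) = ev l powr s" by (simp flip: powr_add)
    finally show ?thesis .
  qed
  \<comment> \<open>The sampling part. After lowering \<beta> to r + q, the inequality 1 +
    \<lambda>_l / n^2 >= (1 + \<lambda>_l) / n^2, valid for n >= 1, converts smoothing into the
    weight of order -r at the cost of n^(2(r+q)).\<close>
  have w2: "ev l powr q * (bw \<beta> n l)\<^sup>2 \<le> ?B\<^sup>2 * ev l powr (- r)" for l
  proof -
    have l0: "0 \<le> eigval d l / n\<^sup>2" using ev_bounds(4)[of l] n by simp
    have "(bw \<beta> n l)\<^sup>2 = (1 + eigval d l / n\<^sup>2) powr (- \<beta>)" by (simp add: sq)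
    also have "\<dots> \<le> (1 + eigval d l / n\<^sup>2) powr (- (r + q))" 
      using l0 \<beta> powr_mono[of "- \<beta>" "- (r + q)" "1 + eigval d l / n\<^sup>2"] by simp
    also have "\<dots> \<le> (ev l / n\<^sup>2) powr (- (r + q))"
    proof (rule powr_mono2')
      show "0 < ev l / n\<^sup>2" using ev_bounds(3)[of l] n by simp
      show "ev l / n\<^sup>2 \<le> 1 + eigval d l / n\<^sup>2" using n by (simp add: add_divide_distrib)
    qed (use r q in simp)
    also have "\<dots> = ev l powr (- (r + q)) * ?B\<^sup>2"
      using pw[of "ev l"] ev_bounds(3)[of l] by (simp add: add.commute)
    finally have "ev l powr q * (bw \<beta> n l)\<^sup>2 \<le> ev l powr q * (ev l powr (- (r + q)) * ?B\<^sup>2)"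
      by (simp add: mult_left_mono)
    also have "\<dots> = ?B\<^sup>2 * (ev l powr q * ev l powr (- (r + q)))" by (simp only: mult_ac)
    also have "ev l powr q * ev l powr (- (r + q)) = ev l powr (- r)" by (simp flip: powr_add)
    finally show ?thesis .
  qed
  have part: "(\<Sum>l\<le>k. sobolev_term d Z Y q (regular_distribution e) l) \<le> ?K" for k
  proof -
    have tm: "sobolev_term d Z Y t (regular_distribution g) l = (\<Sum>k=1..Z l. ev l powr t * (fc g l k)\<^sup>2)" for t g l
      by (simp add: sobolev_term_regular fnorm_def sum_nonneg sum_distrib_left)
    let ?f1 = "\<lambda>i. ev (fst i) powr s * (fc f (fst i) (snd i))\<^sup>2"
    let ?f2 = "\<lambda>i. ev (fst i) powr (- r) * (?\<nu> (\<lambda>x. f x * ysph i x))\<^sup>2"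
    have "(\<Sum>l\<le>k. sobolev_term d Z Y q (regular_distribution e) l)
        = (\<Sum>i\<in>J {..k}. ev (fst i) powr q * (fc e (fst i) (snd i))\<^sup>2)"
      by (simp add: tm sum_J)
    also have "\<dots> \<le> (\<Sum>i\<in>J {..k}. 2 * (1 + \<beta> / 2)\<^sup>2 * ?A\<^sup>2 * ?f1 i + 2 * ?B\<^sup>2 * ?f2 i)"
    proof (rule sum_mono)
      fix i assume "i \<in> J {..k}"
      then have "snd i \<in> {1..Z (fst i)}" by (simp add: J_iff)
      let ?b = "bw \<beta> n (fst i)" and ?a = "fc f (fst i) (snd i)" and ?v = "?\<nu> (\<lambda>x. f x * ysph i x)"
      let ?E = "ev (fst i) powr q"
      have "fc e (fst i) (snd i) = (1 - ?b) * ?a - ?b * ?v"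
        unfolding e_def using sampling_error_coeff[OF f \<open>snd i \<in> _\<close>] by simp
      moreover have "(x - y)\<^sup>2 \<le> 2 * x\<^sup>2 + 2 * y\<^sup>2" for x y :: real
        using zero_le_power2[of "x + y"] by (simp add: power2_eq_square algebra_simps)
      ultimately have "?E * (fc e (fst i) (snd i))\<^sup>2 \<le> ?E * (2 * ((1 - ?b) * ?a)\<^sup>2 + 2 * (?b * ?v)\<^sup>2)"
        by (intro mult_left_mono) auto
      also have "\<dots> = 2 * (?E * (1 - ?b)\<^sup>2) * ?a\<^sup>2 + 2 * (?E * ?b\<^sup>2) * ?v\<^sup>2"
        by (simp add: power_mult_distrib distrib_left mult_ac)
      also have "\<dots> \<le> 2 * ((1 + \<beta> / 2)\<^sup>2 * ?A\<^sup>2 * ev (fst i) powr s) * ?a\<^sup>2 + 2 * (?B\<^sup>2 * ev (fst i) powr (- r)) * ?v\<^sup>2"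
        by (intro add_mono mult_right_mono mult_left_mono w1 w2) auto
      also have "\<dots> = 2 * (1 + \<beta> / 2)\<^sup>2 * ?A\<^sup>2 * ?f1 i + 2 * ?B\<^sup>2 * ?f2 i" by (simp only: mult_ac)
      finally show "?E * (fc e (fst i) (snd i))\<^sup>2 \<le> 2 * (1 + \<beta> / 2)\<^sup>2 * ?A\<^sup>2 * ?f1 i + 2 * ?B\<^sup>2 * ?f2 i" .
    qed
    also have "\<dots> = 2 * (1 + \<beta> / 2)\<^sup>2 * ?A\<^sup>2 * sum ?f1 (J {..k}) + 2 * ?B\<^sup>2 * sum ?f2 (J {..k})"
      by (simp only: sum.distrib sum_distrib_left)
    also have "\<dots> \<le> 2 * (1 + \<beta> / 2)\<^sup>2 * ?A\<^sup>2 * ?Ns + 2 * ?B\<^sup>2 * (?mc * (c * T)\<^sup>2 * ?Ns)"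
    proof (intro add_mono mult_left_mono)
      have "sum ?f1 (J {..k}) = (\<Sum>l\<le>k. ev l powr s * (fnorm f l)\<^sup>2)"
        by (simp add: sum_J fnorm_def sum_nonneg sum_distrib_left)
      also have "\<dots> \<le> ?Ns" by (intro sum_le_suminf fs') auto
      finally show "sum ?f1 (J {..k}) \<le> ?Ns" .
      have "sum ?f2 (J {..k}) \<le> ?mc * ?N * ?Ns"
        by (rule multiplication_bound[OF sampling_nu_hlin[OF xs] sampling_nu_series_cont[OF xs] r s \<nu>(1) f fs'])
      also have "\<dots> \<le> ?mc * (c * T)\<^sup>2 * ?Ns"
        using mc0 Ns0 \<nu>(2) by (intro mult_right_mono mult_left_mono)
      finally show "sum ?f2 (J {..k}) \<le> ?mc * (c * T)\<^sup>2 * ?Ns" .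
    qed auto
    also have "\<dots> = 2 * ((1 + \<beta> / 2)\<^sup>2 * ?A\<^sup>2 + ?mc * c\<^sup>2 * (T * ?B)\<^sup>2) * ?Ns"
      by (simp add: power_mult_distrib algebra_simps)
    \<comment> \<open>Both squares are bounded by the square of the sum, so that the square root
      becomes linear in A + T B.\<close>
    also have "\<dots> \<le> 2 * ((1 + \<beta> / 2)\<^sup>2 * (?A + T * ?B)\<^sup>2 + ?mc * c\<^sup>2 * (?A + T * ?B)\<^sup>2) * ?Ns"
      using T mc0 Ns0 by (intro mult_right_mono mult_left_mono add_mono power_mono) auto
    also have "\<dots> = ?K" by (simp add: algebra_simps)
    finally show ?thesis .
  qed
  have part': "(\<Sum>l<k. sobolev_term d Z Y q (regular_distribution e) l) \<le> ?K" for k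
    by (rule order_trans[OF sum_mono2 part[of k]]) (auto simp: sobolev_term_regular)
  show sm: "summable (sobolev_term d Z Y q (regular_distribution e))"
    by (rule summableI_nonneg_bounded[OF _ part']) (simp add: sobolev_term_regular)
  have "(\<Sum>l. sobolev_term d Z Y q (regular_distribution e) l) \<le> ?K"
    by (rule suminf_le_const[OF sm part'])
  then have "sobolev_fun_norm d Z Y q e \<le> sqrt ?K"
    unfolding sobolev_fun_norm_def sobolev_norm_def by (rule real_sqrt_le_mono)
  also have "\<dots> = sqrt (2 * ((1 + \<beta> / 2)\<^sup>2 + ?mc * c\<^sup>2)) * (?A + T * ?B) * sqrt ?Ns"
    using T by (simp add: real_sqrt_mult)
  also have "sqrt ?Ns = sobolev_fun_norm d Z Y s f"
    by (simp add: sobolev_fun_norm_def sobolev_norm_def sobolev_term_regular)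
  finally show "sobolev_fun_norm d Z Y q e \<le> sqrt (2 * ((1 + \<beta> / 2)\<^sup>2 + ?mc * c\<^sup>2)) *
      (?A + T * ?B) * sobolev_fun_norm d Z Y s f" .
qed

text \<open>The weights contribute \<delta>^d, the kernel n^d, and the packing estimate divides by
  (n t)^d with t proportional to \<delta>, so all dependence on m and n cancels.\<close>

lemma sampling_op_Linf_bound:
  assumes m: "m \<ge> 2" and n: "n \<ge> 1"
    and \<Phi>: "\<And>x y. x \<in> sphere 0 1 \<Longrightarrow> y \<in> sphere 0 1 \<Longrightarrow>
      \<bar>bessel_kernel d Z Y \<beta> n x y\<bar> \<le> C\<^sub>L * n ^ d * (1 + n * geodist x y) powr (- L)" and L: "L > real d + 1"
    and qu: "mesh_norm m xs \<le> C\<^sub>0 * separation_radius m xs"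
    and w: "\<And>j. j \<in> {1..m} \<Longrightarrow> 0 < ws j \<and> ws j \<le> C\<^sub>2 * mesh_norm m xs ^ d"
    and n_le: "n \<le> C\<^sub>3 / mesh_norm m xs"
    and f: "continuous_on (sphere 0 1) f"
  defines "K \<equiv> 2 ^ (d + 2) * 8 ^ (d + 1) * (1 + C\<^sub>3 / (4 * C\<^sub>0)) ^ d * (\<Sum>k. (1 + real k) powr (real d - L))"
  shows "Linf_norm (smp f)
    \<le> ereal (\<bar>C\<^sub>2 * \<bar>C\<^sub>L\<bar> * K * (4 * C\<^sub>0) ^ d\<bar> + 1) * Linf_norm f"
proof (cases "Linf_norm f")
  case PInf
  \<comment> \<open>The summand 1 keeps the factor strictly positive, which matters because 0 times
    infinity is 0 in \<open>ereal\<close>.\<close>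
  have "\<bar>C\<^sub>2 * \<bar>C\<^sub>L\<bar> * K * (4 * C\<^sub>0) ^ d\<bar> + 1 > 0" by (rule add_nonneg_pos) auto
  then show ?thesis using PInf by simp
next
  case MInf
  obtain x :: 'a where x: "x \<in> sphere 0 1" using xs[of 1] m by auto
  show ?thesis using Linf_norm_continuous_ge[OF f x] MInf by simp
next
  case (real c)
  have fc: "\<bar>f x\<bar> \<le> c" if "x \<in> sphere 0 1" for x
    using Linf_norm_continuous_ge[OF f that] real by simp
  have c0: "0 \<le> c" using fc[OF xs[of 1]] m by simp
  let ?\<delta> = "mesh_norm m xs" and ?\<gamma> = "separation_radius m xs"
  have "0 \<le> ?\<delta>" using m by (intro mesh_norm_nonneg xs) auto
  \<comment> \<open>Division by zero yields 0, so a vanishing mesh norm would force n <= 0.\<close>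
  moreover have "?\<delta> \<noteq> 0" using n n_le by auto
  ultimately have \<delta>: "0 < ?\<delta>" by simp
  have \<gamma>: "0 \<le> ?\<gamma>" using separation_radius_props(1)[OF xs m] by simp
  have C0: "0 < C\<^sub>0"
  proof (rule ccontr)
    assume "\<not> 0 < C\<^sub>0"
    then have "C\<^sub>0 * ?\<gamma> \<le> 0" using \<gamma> by (intro mult_nonpos_nonneg) auto
    then show False using qu \<delta> by simp
  qed
  have C2: "0 < C\<^sub>2"
  proof -
    have "0 < C\<^sub>2 * ?\<delta> ^ d" using w[of 1] m by force
    then show ?thesis using \<delta> by (simp add: zero_less_mult_iff)
  qed
  \<comment> \<open>Arcs between nodes are at least 2 \<gamma> and chords at least a quarter of
    arcs, so nodes are \<gamma>/2 apart; \<delta> <= \<open>C\<^sub>0\<close> \<gamma> makes this at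
    least 2t.\<close>
  define t where "t = ?\<delta> / (4 * C\<^sub>0)"
  have t0: "0 < t" using \<delta> C0 by (simp add: t_def)
  have sep: "2 * t \<le> norm (xs i - xs j)" if "i \<in> {1..m}" "j \<in> {1..m}" "i \<noteq> j" for i j
  proof -
    have "2 * t \<le> ?\<gamma> / 2" using qu C0 by (simp add: t_def field_simps)
    also have "\<dots> \<le> geodist (xs i) (xs j) / 4" using separation_radius_props(2)[OF xs m that] by simp
    also have "\<dots> \<le> norm (xs i - xs j)" by (rule norm_le_geodist(2)[OF xs xs]) (use that in auto)
    finally show ?thesis .
  qed
  \<comment> \<open>Two distinct nodes exist, and their chord, at least 2t, is at most 2.\<close>
  have t1: "t \<le> 1"
    using sep[of 1 2] norm_triangle_ineq4[of "xs 1" "xs 2"] xs[of 1] xs[of 2] m by auto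
  have nt: "n * t \<le> C\<^sub>3 / (4 * C\<^sub>0)"
  proof -
    have "n * ?\<delta> \<le> C\<^sub>3" using n_le \<delta> by (simp add: field_simps)
    then show ?thesis unfolding t_def times_divide_eq_right using C0 by (intro divide_right_mono) auto
  qed
  have bound: "\<bar>smp f x\<bar> \<le> c * (C\<^sub>2 * \<bar>C\<^sub>L\<bar> * K * (4 * C\<^sub>0) ^ d)"
    if x: "x \<in> sphere 0 1" for x
  proof -
    have "\<bar>smp f x\<bar> \<le> (\<Sum>j=1..m. \<bar>ws j * f (xs j) * bessel_kernel d Z Y \<beta> n x (xs j)\<bar>)"
      unfolding sampling_op_def by (rule sum_abs)
    also have "\<dots> \<le> (\<Sum>j=1..m. (C\<^sub>2 * ?\<delta> ^ d) * c * (\<bar>C\<^sub>L\<bar> * n ^ d * (1 + n * norm (x - xs j)) powr (- L)))"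
    proof (rule sum_mono)
      fix j assume j: "j \<in> {1..m}"
      have "\<bar>bessel_kernel d Z Y \<beta> n x (xs j)\<bar> \<le> C\<^sub>L * n ^ d * (1 + n * geodist x (xs j)) powr (- L)"
        by (rule \<Phi>[OF x xs[OF j]])
      also have "\<dots> \<le> \<bar>C\<^sub>L\<bar> * n ^ d * (1 + n * norm (x - xs j)) powr (- L)"
        using n L norm_le_geodist(1)[OF x xs[OF j]]
        by (intro mult_mono powr_mono2' mult_right_mono add_left_mono mult_left_mono) (auto simp: add_pos_nonneg)
      finally show "\<bar>ws j * f (xs j) * bessel_kernel d Z Y \<beta> n x (xs j)\<bar>
          \<le> (C\<^sub>2 * ?\<delta> ^ d) * c * (\<bar>C\<^sub>L\<bar> * n ^ d * (1 + n * norm (x - xs j)) powr (- L))"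
        unfolding abs_mult using w[OF j] fc[OF xs[OF j]] c0 C2 \<delta> by (intro mult_mono) auto
    qed
    also have "\<dots> = (C\<^sub>2 * ?\<delta> ^ d) * c * (\<bar>C\<^sub>L\<bar> * n ^ d) * (\<Sum>j=1..m. (1 + n * norm (x - xs j)) powr (- L))"
      by (simp add: sum_distrib_left mult.assoc)
    also have "\<dots> \<le> (C\<^sub>2 * ?\<delta> ^ d) * c * (\<bar>C\<^sub>L\<bar> * n ^ d) * (K / (n * t) ^ d)"
    proof (rule mult_left_mono)
      show "(\<Sum>j=1..m. (1 + n * norm (x - xs j)) powr (- L)) \<le> K / (n * t) ^ d"
        unfolding K_def using x xs n
        by (intro separated_sum_le[OF DIM_eq _ t0 t1 _ _ sep _ nt L]) auto
    qed (use C2 \<delta> c0 n in auto)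
    also have "\<dots> = c * (C\<^sub>2 * \<bar>C\<^sub>L\<bar> * K * (?\<delta> / t) ^ d)"
      using n t0 by (simp add: power_mult_distrib power_divide)
    also have "?\<delta> / t = 4 * C\<^sub>0" using \<delta> C0 by (simp add: t_def)
    finally show ?thesis .
  qed
  have "Linf_norm (smp f) \<le> ereal (c * (C\<^sub>2 * \<bar>C\<^sub>L\<bar> * K * (4 * C\<^sub>0) ^ d))"
    using bound by (intro Linf_norm_le sampling_op_continuous)
  also have "\<dots> \<le> ereal ((\<bar>C\<^sub>2 * \<bar>C\<^sub>L\<bar> * K * (4 * C\<^sub>0) ^ d\<bar> + 1) * c)"
    using c0 by (subst mult.commute) (auto intro!: mult_right_mono)
  finally show ?thesis by (simp add: real)
qed

end

end

text \<open>\<open>N\<close> is the set of admissible scales; leaving it arbitrary in [1,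
  \<infinity>) covers integer and real n alike. Summability belongs to the kernel hypothesis because
  \<open>suminf\<close> carries no information about a divergent series. A class in H^s is given by
  its continuous representative f.\<close>

theorem corollary4p10:
  fixes d :: nat and r s q \<beta> L C\<^sub>L C\<^sub>1 :: real
    and Z :: "nat \<Rightarrow> nat" and Y :: "nat \<Rightarrow> nat \<Rightarrow> 'a::euclidean_space \<Rightarrow> real"
    and M :: "nat set" and N :: "real set"
    and X :: "nat \<Rightarrow> nat \<Rightarrow> 'a" and w :: "nat \<Rightarrow> nat \<Rightarrow> real"
  defines "\<delta> \<equiv> (\<lambda>m. mesh_norm m (X m))"
    and "\<gamma> \<equiv> (\<lambda>m. separation_radius m (X m))"
    and "F \<equiv> (\<lambda>m n. sampling_op d Z Y \<beta> m (X m) (w m) n)"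
  assumes "d \<ge> 1" and "DIM('a) = d + 1"
    and "harmonic_onb Z Y"
    and "r > d / 2" and "s > d / 2 + r" and "0 \<le> q" and "q < s" and "0 < s - q" and "s - q \<le> 2"
    and "infinite M" and "\<forall>m\<in>M. m \<ge> 1"
    and "N \<subseteq> {1..}"
    and "\<forall>m\<in>M. \<forall>j\<in>{1..m}. X m j \<in> sphere 0 1 \<and> w m j > 0"
    and "\<forall>m\<in>M. (\<Sum>j=1..m. w m j) = 1"
    and "\<beta> \<ge> r + q"
    and "L > d + 1"
    and "\<forall>n\<in>N. \<forall>x\<in>sphere 0 1. \<forall>y\<in>sphere 0 1.
           summable (bessel_term d Z Y \<beta> n x y) \<and>
           \<bar>bessel_kernel d Z Y \<beta> n x y\<bar> \<le> C\<^sub>L * n ^ d * (1 + n * geodist x y) powr (- L)"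
    and "\<forall>m\<in>M. sampling_nu m (X m) (w m) \<in> sobolev d Z Y (- r) \<and>
           sobolev_norm d Z Y (- r) (sampling_nu m (X m) (w m)) \<le> C\<^sub>1 * \<delta> m powr r"
  shows
    "(\<exists>C>0. \<forall>m\<in>M. \<forall>n\<in>N. \<forall>f. continuous_on (sphere 0 1) f \<and> f \<in> sobolev_fun d Z Y s \<longrightarrow>
        (\<lambda>x. f x - F m n f x) \<in> sobolev_fun d Z Y q \<and>
        sobolev_fun_norm d Z Y q (\<lambda>x. f x - F m n f x)
          \<le> C * (n powr (- (s - q)) + \<delta> m powr r * n powr (r + q)) * sobolev_fun_norm d Z Y s f)
     \<and>
     (\<forall>nn c\<^sub>1 c\<^sub>2. c\<^sub>1 > 0 \<and> c\<^sub>2 > 0 \<and>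
        (\<forall>m\<in>M. nn m \<in> N \<and> c\<^sub>1 * \<delta> m powr (- r / (s + r)) \<le> nn m \<and>
                 nn m \<le> c\<^sub>2 * \<delta> m powr (- r / (s + r))) \<longrightarrow>
        (\<exists>C'>0. \<forall>m\<in>M. \<forall>f. continuous_on (sphere 0 1) f \<and> f \<in> sobolev_fun d Z Y s \<longrightarrow>
           (\<lambda>x. f x - F m (nn m) f x) \<in> sobolev_fun d Z Y q \<and>
           sobolev_fun_norm d Z Y q (\<lambda>x. f x - F m (nn m) f x)
             \<le> C' * \<delta> m powr (r * (s - q) / (s + r)) * sobolev_fun_norm d Z Y s f))
     \<and>
     (\<forall>C\<^sub>0 C\<^sub>2. (\<forall>m\<in>M. m \<ge> 2) \<and> (\<forall>m\<in>M. \<delta> m \<le> C\<^sub>0 * \<gamma> m) \<and>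
        (\<forall>m\<in>M. \<forall>j\<in>{1..m}. 0 < w m j \<and> w m j \<le> C\<^sub>2 * \<delta> m ^ d) \<longrightarrow>
        (\<forall>C\<^sub>3>0. \<exists>C''>0. \<forall>m\<in>M. \<forall>n\<in>N. n \<le> C\<^sub>3 / \<delta> m \<longrightarrow>
           (\<forall>f. continuous_on (sphere 0 1) f \<longrightarrow>
              Linf_norm (F m n f) \<le> ereal C'' * Linf_norm f)))"
proof -
  interpret sphere_harmonics d Z Y using assms(4-6) by unfold_locales
  have n1: "n \<ge> 1" if "n \<in> N" for n using assms(15) that by auto
  have xs: "X m j \<in> sphere 0 1" if "m \<in> M" "j \<in> {1..m}" for m j using assms(16) that by blast
  have summ: "summable (bessel_term d Z Y \<beta> n x y)"
    if "n \<in> N" "x \<in> sphere 0 1" "y \<in> sphere 0 1" for n x y using assms(20) that by blast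
  have \<Phi>: "\<bar>bessel_kernel d Z Y \<beta> n x y\<bar> \<le> C\<^sub>L * n ^ d * (1 + n * geodist x y) powr (- L)"
    if "n \<in> N" "x \<in> sphere 0 1" "y \<in> sphere 0 1" for n x y using assms(20) that by blast
  have r0: "0 \<le> r" using assms(7) of_nat_0_le_iff[of d] by linarith
  have sr: "0 < s + r" 
  proof -
    have "0 \<le> real d / 2" by simp
    then show ?thesis using assms(8) r0 by linarith
  qed
  have \<delta>0: "0 \<le> \<delta> m" if "m \<in> M" for m
    unfolding \<delta>_def using assms(14) that by (intro mesh_norm_nonneg xs) auto
  \<comment> \<open>The constant of \<open>sampling_error\<close> with c = \<open>C\<^sub>1\<close>
    and T = \<delta>^r; the square of 1 + \<beta>/2 makes it positive.\<close>
  define C where "C = sqrt (2 * ((1 + \<beta> / 2)\<^sup>2 + mult_const r s * C\<^sub>1\<^sup>2))"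
  have "0 \<le> \<beta>" using assms(9,18) r0 by simp
  then have C: "0 < C"
    using mult_const_nonneg[OF r0 assms(8)] by (auto simp: C_def intro!: add_pos_nonneg)
  have part_i: "(\<lambda>x. f x - F m n f x) \<in> sobolev_fun d Z Y q \<and>
      sobolev_fun_norm d Z Y q (\<lambda>x. f x - F m n f x)
        \<le> C * (n powr (- (s - q)) + \<delta> m powr r * n powr (r + q)) * sobolev_fun_norm d Z Y s f"
    if m: "m \<in> M" and n: "n \<in> N" and f: "continuous_on (sphere 0 1) f" "f \<in> sobolev_fun d Z Y s" for m n f
  proof -
    let ?\<nu> = "sampling_nu m (X m) (w m)"
    have \<nu>: "summable (sobolev_term d Z Y (- r) ?\<nu>)"
      using assms(21) m by (auto simp: sobolev_def)
    have "sqrt (\<Sum>l. sobolev_term d Z Y (- r) ?\<nu> l) \<le> C\<^sub>1 * \<delta> m powr r"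
      using assms(21) m by (auto simp: sobolev_norm_def)
    then have \<nu>': "(\<Sum>l. sobolev_term d Z Y (- r) ?\<nu> l) \<le> (C\<^sub>1 * \<delta> m powr r)\<^sup>2"
      by (rule sqrt_le_D)
    have fs: "summable (sobolev_term d Z Y s (regular_distribution f))"
      using f(2) by (auto simp: sobolev_fun_def sobolev_def)
    note err = sampling_error[OF summ[OF n] xs[OF m] n1[OF n] r0 assms(8,9,10,12,18) \<nu> \<nu>' _ f(1) fs]
    have int: "integrable sphere_measure (\<lambda>x. f x - F m n f x)"
      unfolding F_def by (intro sphere_integrable_continuous continuous_on_diff f sampling_op_continuous summ[OF n] xs[OF m])
    then show ?thesis
      using err sphere_distribution_regular[OF int] by (auto simp: sobolev_fun_def sobolev_def F_def C_def)
  qed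
  have part_ii: "\<exists>C'>0. \<forall>m\<in>M. \<forall>f. continuous_on (sphere 0 1) f \<and> f \<in> sobolev_fun d Z Y s \<longrightarrow>
           (\<lambda>x. f x - F m (nn m) f x) \<in> sobolev_fun d Z Y q \<and>
           sobolev_fun_norm d Z Y q (\<lambda>x. f x - F m (nn m) f x)
             \<le> C' * \<delta> m powr (r * (s - q) / (s + r)) * sobolev_fun_norm d Z Y s f"
    if c: "c\<^sub>1 > 0" "c\<^sub>2 > 0" and nn: "\<forall>m\<in>M. nn m \<in> N \<and> c\<^sub>1 * \<delta> m powr (- r / (s + r)) \<le> nn m \<and>
                 nn m \<le> c\<^sub>2 * \<delta> m powr (- r / (s + r))" for nn c\<^sub>1 c\<^sub>2
  proof (intro exI[of _ "C * (c\<^sub>1 powr (- (s - q)) + c\<^sub>2 powr (r + q))"] conjI ballI allI impI)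
    show "0 < C * (c\<^sub>1 powr (- (s - q)) + c\<^sub>2 powr (r + q))" using C c by (intro mult_pos_pos add_pos_pos) auto
    fix m f assume m: "m \<in> M" and f: "continuous_on (sphere 0 1) f \<and> f \<in> sobolev_fun d Z Y s"
    let ?n = "nn m" and ?D = "\<delta> m powr (r * (s - q) / (s + r))"
    have n: "?n \<in> N" "c\<^sub>1 * \<delta> m powr (- r / (s + r)) \<le> ?n" "?n \<le> c\<^sub>2 * \<delta> m powr (- r / (s + r))"
      using nn m by blast+
    \<comment> \<open>Since 0 powr anything is 0, a vanishing mesh norm would make the upper bound
      for n equal to 0, against n >= 1.\<close>
    have "\<delta> m \<noteq> 0" using n n1[OF n(1)] by auto
    then have \<delta>: "0 < \<delta> m" using \<delta>0[OF m] by simp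
    \<comment> \<open>The lower bound on n controls the approximation term, whose exponent is
      negative; the upper bound controls the sampling term that follows.\<close>
    have 1: "?n powr (- (s - q)) \<le> c\<^sub>1 powr (- (s - q)) * ?D"
    proof -
      have "?n powr (- (s - q)) \<le> (c\<^sub>1 * \<delta> m powr (- r / (s + r))) powr (- (s - q))"
        using n c \<delta> assms(11) by (intro powr_mono2') auto
      also have "\<dots> = c\<^sub>1 powr (- (s - q)) * ?D"
      proof -
        have "- r / (s + r) * - (s - q) = r * (s - q) / (s + r)" using sr by (simp add: field_simps)
        then show ?thesis using c by (subst powr_mult) (auto simp only: powr_powr)
      qed
      finally show ?thesis .
    qed
    have 2: "\<delta> m powr r * ?n powr (r + q) \<le> c\<^sub>2 powr (r + q) * ?D"
    proof -
      have "?n powr (r + q) \<le> (c\<^sub>2 * \<delta> m powr (- r / (s + r))) powr (r + q)"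
        using n n1[OF n(1)] r0 assms(9) by (intro powr_mono2) auto
      also have "\<dots> = c\<^sub>2 powr (r + q) * \<delta> m powr (- r / (s + r) * (r + q))"
        using c by (subst powr_mult) (auto simp: powr_powr)
      finally have "\<delta> m powr r * ?n powr (r + q)
          \<le> c\<^sub>2 powr (r + q) * (\<delta> m powr r * \<delta> m powr (- r / (s + r) * (r + q)))"
        by (simp add: mult.left_commute mult_left_mono)
      also have "\<delta> m powr r * \<delta> m powr (- r / (s + r) * (r + q)) = \<delta> m powr (r + - r / (s + r) * (r + q))"
        by (simp only: powr_add)
      \<comment> \<open>The balance: r - r (r + q) / (s + r) is the same exponent of \<delta> as in
        the first term.\<close>
      also have "r + - r / (s + r) * (r + q) = r * (s - q) / (s + r)"
        using sr by (simp add: field_simps)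
      finally show ?thesis .
    qed
    have Nf: "0 \<le> sobolev_fun_norm d Z Y s f"
    proof -
      have "summable (sobolev_term d Z Y s (regular_distribution f))"
        using f by (auto simp: sobolev_fun_def sobolev_def)
      then show ?thesis
        unfolding sobolev_fun_norm_def sobolev_norm_def
        by (intro real_sqrt_ge_zero suminf_nonneg) (auto simp: sobolev_term_regular)
    qed
    note i = part_i[OF m n(1) conjunct1[OF f] conjunct2[OF f]]
    show "(\<lambda>x. f x - F m ?n f x) \<in> sobolev_fun d Z Y q" using i by blast
    have "sobolev_fun_norm d Z Y q (\<lambda>x. f x - F m ?n f x)
        \<le> C * (?n powr (- (s - q)) + \<delta> m powr r * ?n powr (r + q)) * sobolev_fun_norm d Z Y s f"
      using i by blast
    also have "\<dots> \<le> C * (c\<^sub>1 powr (- (s - q)) * ?D + c\<^sub>2 powr (r + q) * ?D) * sobolev_fun_norm d Z Y s f"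
      using C Nf 1 2 by (intro mult_right_mono mult_left_mono add_mono) auto
    also have "\<dots> = C * (c\<^sub>1 powr (- (s - q)) + c\<^sub>2 powr (r + q)) * ?D * sobolev_fun_norm d Z Y s f"
      by (simp only: distrib_right[of "c\<^sub>1 powr (- (s - q))" "c\<^sub>2 powr (r + q)" ?D] mult.assoc)
    finally show "sobolev_fun_norm d Z Y q (\<lambda>x. f x - F m ?n f x)
        \<le> C * (c\<^sub>1 powr (- (s - q)) + c\<^sub>2 powr (r + q)) * ?D * sobolev_fun_norm d Z Y s f" .
  qed
  have part_iii: "\<exists>C''>0. \<forall>m\<in>M. \<forall>n\<in>N. n \<le> C\<^sub>3 / \<delta> m \<longrightarrow>
           (\<forall>f. continuous_on (sphere 0 1) f \<longrightarrow> Linf_norm (F m n f) \<le> ereal C'' * Linf_norm f)"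
    if h: "\<forall>m\<in>M. m \<ge> 2" "\<forall>m\<in>M. \<delta> m \<le> C\<^sub>0 * \<gamma> m"
      "\<forall>m\<in>M. \<forall>j\<in>{1..m}. 0 < w m j \<and> w m j \<le> C\<^sub>2 * \<delta> m ^ d" for C\<^sub>0 C\<^sub>2 C\<^sub>3
  proof (intro exI conjI ballI allI impI)
    fix m n and f :: "'a \<Rightarrow> real"
    assume m: "m \<in> M" and n: "n \<in> N" "n \<le> C\<^sub>3 / \<delta> m" and f: "continuous_on (sphere 0 1) f"
    show "Linf_norm (F m n f) \<le> ereal (\<bar>C\<^sub>2 * \<bar>C\<^sub>L\<bar> * (2 ^ (d + 2) * 8 ^ (d + 1) * (1 + C\<^sub>3 / (4 * C\<^sub>0)) ^ d *
        (\<Sum>k. (1 + real k) powr (real d - L))) * (4 * C\<^sub>0) ^ d\<bar> + 1) * Linf_norm f"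
      unfolding F_def
      using h m n assms(19)
      by (intro sampling_op_Linf_bound[OF summ[OF n(1)] xs[OF m] _ n1[OF n(1)] \<Phi>[OF n(1)] _ _ _ _ f])
        (auto simp: \<delta>_def \<gamma>_def)
  qed (simp add: add_nonneg_pos)
  show ?thesis
  proof (rule conjI[OF _ conjI], goal_cases)
    case 1
    show ?case
      by (rule exI[of _ C], rule conjI[OF C], intro ballI allI impI, elim conjE, rule part_i)
  next
    case 2
    show ?case by (intro allI impI, elim conjE, rule part_ii)
  next
    case 3
    show ?case by (intro allI impI, elim conjE, rule part_iii)
  qed
qed

end
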